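(* Let $\mathcal V$ be a closed monoidal category. Suppose $\mathcal C,\mathcal D$ are $\mathcal V$-categories with $\mathcal D$ tensored, and $\mathcal F:\mathcal C\to\mathcal D$ is a $\mathcal V$-functor. Then there exists a tensored $\mathcal V$-functor $\overline{\mathcal F}:\overline{\mathcal C}\to\mathcal D$ such that $\mathcal I\circ\overline{\mathcal F}\cong\mathcal F$ as $\mathcal V$-functors (where $\mathcal I\circ\overline{\mathcal F}$ means first $\mathcal I:\mathcal C\to\overline{\mathcal C}$, then $\overline{\mathcal F}$).
   Context: Conventions: composition is written left to right; tensor products in $\mathcal V$ are juxtaposition; associators and unitors are suppressed; "mate" means the morphism corresponding under the indicated adjunction. A $\mathcal V$-category $\mathcal C$ has hom objects $\mathcal C(a\to b)\in\mathcal V$, identities $j_a:1_{\mathcal V}\to\mathcal C(a\to a)$ and composition $-\circ_{\mathcal C}-:\mathcal C(a\to b)\mathcal C(b\to c)\to\mathcal C(a\to c)$, associative and unital. A $\mathcal V$-functor $F$ has morphisms $F_{a\to b}:\mathcal C(a\to b)\to\mathcal D(F(a)\to F(b))$ compatible with composition and identities. A $\mathcal V$-natural transformation $\sigma:F\Rightarrow G$ is a family $\sigma_a\in\mathcal V(1_{\mathcal V}\to\mathcal D(F(a)\to G(a)))$ with $(\sigma_aG_{a\to b})\circ(-\circ_{\mathcal D}-)=(F_{a\to b}\sigma_b)\circ(-\circ_{\mathcal D}-)$. The underlying category $\mathcal C^{\mathcal V}$ has $\mathcal C^{\mathcal V}(a\to b)=\mathcal V(1_{\mathcal V}\to\mathcal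 C(a\to b))$. $\mathcal V$ closed: internal homs satisfy $\mathcal V(uw\to v)\cong\mathcal V(w\to\widehat{\mathcal V}(u\to v))$, with $\varepsilon^{\widehat{\mathcal V}}_{u\to v}:u\widehat{\mathcal V}(u\to v)\to v$ the mate of the identity. $\widehat{\mathcal V}$ is the self-enriched $\mathcal V$-category. For $a\in\mathcal D$, $\mathcal R^a:\mathcal D\to\widehat{\mathcal V}$ is $b\mapsto\mathcal D(a\to b)$, with action the mate of $-\circ_{\mathcal D}-$. $\mathcal D$ is tensored if each $\mathcal R^a$ has a left $\mathcal V$-adjoint $v\mapsto a\vartriangleleft v$, i.e. a $\mathcal V$-functor with $\mathcal V$-natural isomorphisms $\mathcal D(a\vartriangleleft v\to b)\cong\widehat{\mathcal V}(v\to\mathcal D(a\to b))$ in $\mathcal V$. Then $\mathcal D^{\mathcal V}(a\vartriangleleft v\to b)\cong\mathcal V(v\to\mathcal D(a\to b))$, with unit $\eta^{\mathcal D}_{a,v}:v\to\mathcal D(a\to a\vartriangleleft v)$. A $\mathcal V$-functor $F:\mathcal A\to\mathcal D$ of tensored $\mathcal V$-categories is tensored if for all $c\in\mathcal A$, $v\in\mathcal V$ the morphism $\mu^F_{c,v}\in\mathcal D^{\mathcal V}(F(c)\vartriangleleft v\to F(c\vartriangleleft v))$, the mate of $\eta^{\mathcal A}_{c,v}\circ F_{c\to c\vartriangleleft v}\in\mathcal V(v\to\mathcal D(F(c)\to F(c\vartriangleleft v)))$, is an isomorphism. Completion: $\overline{\mathcal C}$ is the $\mathcal V$-category with objects formal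 symbols $a\blacktriangleleft u$ ($a\in\mathcal C$, $u\in\mathcal V$), hom objects $\overline{\mathcal C}(a\blacktriangleleft u\to b\blacktriangleleft v)=\widehat{\mathcal V}(u\to\mathcal C(a\to b)v)$, identity $j_{a\blacktriangleleft u}$ the mate of $j_a\mathrm{id}_u$, and composition the mate of $(\varepsilon^{\widehat{\mathcal V}}_{u\to\mathcal C(a\to b)v}\mathrm{id})\circ(\mathrm{id}_{\mathcal C(a\to b)}\varepsilon^{\widehat{\mathcal V}}_{v\to\mathcal C(b\to c)w})\circ((-\circ_{\mathcal C}-)\mathrm{id}_w)$. It is tensored with $(a\blacktriangleleft u)\vartriangleleft v=a\blacktriangleleft uv$. $\mathcal I:\mathcal C\to\overline{\mathcal C}$ is $a\mapsto a\blacktriangleleft1_{\mathcal V}$ with $\mathcal I_{a\to b}:\mathcal C(a\to b)\to\widehat{\mathcal V}(1_{\mathcal V}\to\mathcal C(a\to b))$ the mate of $\mathrm{id}_{\mathcal C(a\to b)}$. *)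

theory Defs
  imports Main
begin

section \<open>Categories and closed monoidal categories\<close>

text \<open>
  Composition is diagrammatic: \<open>f \<Zsemi> g\<close> is first \<open>f\<close>, then \<open>g\<close>. Objects and arrows are
  carrier sets in arbitrary types; nothing is assumed about values outside the carriers.
\<close>

record ('o, 'm) category =
  Obj :: "'o set"
  Arr :: "'m set"
  Dom :: "'m \<Rightarrow> 'o"
  Cod :: "'m \<Rightarrow> 'o"
  Id :: "'o \<Rightarrow> 'm" ("\<i>\<d>\<index>")
  Seq :: "'m \<Rightarrow> 'm \<Rightarrow> 'm" (infixl "\<Zsemi>\<index>" 60)

definition hom :: "('o, 'm, 'z) category_scheme \<Rightarrow> 'o \<Rightarrow> 'o \<Rightarrow> 'm set" where
  "hom V a b = {f \<in> Arr V. Dom V f = a \<and> Cod V f = b}"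

locale category =
  fixes V :: "('o, 'm, 'z) category_scheme" (structure)
  assumes Dom_closed: "f \<in> Arr V \<Longrightarrow> Dom V f \<in> Obj V"
    and Cod_closed: "f \<in> Arr V \<Longrightarrow> Cod V f \<in> Obj V"
    and Id_hom: "a \<in> Obj V \<Longrightarrow> \<i>\<d> a \<in> hom V a a"
    and Seq_hom: "\<lbrakk>f \<in> hom V a b; g \<in> hom V b c\<rbrakk> \<Longrightarrow> f \<Zsemi> g \<in> hom V a c"
    and Id_left: "f \<in> hom V a b \<Longrightarrow> \<i>\<d> a \<Zsemi> f = f"
    and Id_right: "f \<in> hom V a b \<Longrightarrow> f \<Zsemi> \<i>\<d> b = f"
    and Seq_assoc: "\<lbrakk>f \<in> hom V a b; g \<in> hom V b c; h \<in> hom V c d\<rbrakk>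
      \<Longrightarrow> (f \<Zsemi> g) \<Zsemi> h = f \<Zsemi> (g \<Zsemi> h)"

definition inverse_arrows :: "('o, 'm, 'z) category_scheme \<Rightarrow> 'm \<Rightarrow> 'm \<Rightarrow> bool" where
  "inverse_arrows V f g \<longleftrightarrow> f \<in> Arr V \<and> g \<in> hom V (Cod V f) (Dom V f)
     \<and> Seq V f g = Id V (Dom V f) \<and> Seq V g f = Id V (Cod V f)"

definition is_iso :: "('o, 'm, 'z) category_scheme \<Rightarrow> 'm \<Rightarrow> bool" where
  "is_iso V f \<longleftrightarrow> (\<exists>g. inverse_arrows V f g)"

definition inv_arr :: "('o, 'm, 'z) category_scheme \<Rightarrow> 'm \<Rightarrow> 'm" ("\<i>\<n>\<v>\<index>") where
  "inv_arr V f = (THE g. inverse_arrows V f g)"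

text \<open>\<open>\<odot>\<close> is the tensor product on objects, \<open>\<otimes>\<close> the tensor product on arrows.\<close>

record ('o, 'm) monoidal_category = "('o, 'm) category" +
  Unit :: "'o" ("\<one>\<index>")
  TenO :: "'o \<Rightarrow> 'o \<Rightarrow> 'o" (infixl "\<odot>\<index>" 70)
  TenA :: "'m \<Rightarrow> 'm \<Rightarrow> 'm" (infixl "\<otimes>\<index>" 70)
  Assoc :: "'o \<Rightarrow> 'o \<Rightarrow> 'o \<Rightarrow> 'm" ("\<alpha>\<index>")
  LUnit :: "'o \<Rightarrow> 'm" ("\<lambda>\<^sub>V\<index>")
  RUnit :: "'o \<Rightarrow> 'm" ("\<rho>\<index>")

locale monoidal_category = category V
  for V :: "('o, 'm, 'z) monoidal_category_scheme" (structure) +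
  assumes Unit_closed: "\<one> \<in> Obj V"
    and TenO_closed: "\<lbrakk>u \<in> Obj V; v \<in> Obj V\<rbrakk> \<Longrightarrow> u \<odot> v \<in> Obj V"
    and TenA_hom: "\<lbrakk>f \<in> hom V u u'; g \<in> hom V v v'\<rbrakk> \<Longrightarrow> f \<otimes> g \<in> hom V (u \<odot> v) (u' \<odot> v')"
    and TenA_Id: "\<lbrakk>u \<in> Obj V; v \<in> Obj V\<rbrakk> \<Longrightarrow> \<i>\<d> u \<otimes> \<i>\<d> v = \<i>\<d> (u \<odot> v)"
    and interchange:
      "\<lbrakk>f \<in> hom V u u'; f' \<in> hom V u' u''; g \<in> hom V v v'; g' \<in> hom V v' v''\<rbrakk>
       \<Longrightarrow> (f \<Zsemi> f') \<otimes> (g \<Zsemi> g') = (f \<otimes> g) \<Zsemi> (f' \<otimes> g')"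
    and Assoc_hom: "\<lbrakk>u \<in> Obj V; v \<in> Obj V; w \<in> Obj V\<rbrakk>
      \<Longrightarrow> \<alpha> u v w \<in> hom V (u \<odot> v \<odot> w) (u \<odot> (v \<odot> w))"
    and Assoc_iso: "\<lbrakk>u \<in> Obj V; v \<in> Obj V; w \<in> Obj V\<rbrakk> \<Longrightarrow> is_iso V (\<alpha> u v w)"
    and Assoc_natural: "\<lbrakk>f \<in> hom V u u'; g \<in> hom V v v'; h \<in> hom V w w'\<rbrakk>
      \<Longrightarrow> (f \<otimes> g \<otimes> h) \<Zsemi> \<alpha> u' v' w' = \<alpha> u v w \<Zsemi> (f \<otimes> (g \<otimes> h))"
    and LUnit_hom: "u \<in> Obj V \<Longrightarrow> \<lambda>\<^sub>V u \<in> hom V (\<one> \<odot> u) u"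
    and LUnit_iso: "u \<in> Obj V \<Longrightarrow> is_iso V (\<lambda>\<^sub>V u)"
    and LUnit_natural: "f \<in> hom V u u' \<Longrightarrow> (\<i>\<d> \<one> \<otimes> f) \<Zsemi> \<lambda>\<^sub>V u' = \<lambda>\<^sub>V u \<Zsemi> f"
    and RUnit_hom: "u \<in> Obj V \<Longrightarrow> \<rho> u \<in> hom V (u \<odot> \<one>) u"
    and RUnit_iso: "u \<in> Obj V \<Longrightarrow> is_iso V (\<rho> u)"
    and RUnit_natural: "f \<in> hom V u u' \<Longrightarrow> (f \<otimes> \<i>\<d> \<one>) \<Zsemi> \<rho> u' = \<rho> u \<Zsemi> f"
    and pentagon: "\<lbrakk>u \<in> Obj V; v \<in> Obj V; w \<in> Obj V; x \<in> Obj V\<rbrakk>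
      \<Longrightarrow> \<alpha> (u \<odot> v) w x \<Zsemi> \<alpha> u v (w \<odot> x)
        = (\<alpha> u v w \<otimes> \<i>\<d> x) \<Zsemi> \<alpha> u (v \<odot> w) x \<Zsemi> (\<i>\<d> u \<otimes> \<alpha> v w x)"
    and triangle: "\<lbrakk>u \<in> Obj V; v \<in> Obj V\<rbrakk>
      \<Longrightarrow> \<alpha> u \<one> v \<Zsemi> (\<i>\<d> u \<otimes> \<lambda>\<^sub>V v) = \<rho> u \<otimes> \<i>\<d> v"

text \<open>
  \<open>IHom u v\<close> is the internal hom, right adjoint to tensoring with \<open>u\<close> on the \<^emph>\<open>left\<close>;
  \<open>Mate u w v\<close> is the adjunction bijection from \<open>V(u w \<rightarrow> v)\<close> to \<open>V(w \<rightarrow> IHom u v)\<close>. Naturality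
  in \<open>w\<close> suffices: the action of \<open>IHom u\<close> on arrows is the one induced by the bijection, for
  which naturality in \<open>v\<close> is automatic. No braiding is assumed.
\<close>

record ('o, 'm) closed_monoidal_category = "('o, 'm) monoidal_category" +
  IHom :: "'o \<Rightarrow> 'o \<Rightarrow> 'o"
  Mate :: "'o \<Rightarrow> 'o \<Rightarrow> 'o \<Rightarrow> 'm \<Rightarrow> 'm"

locale closed_monoidal_category = monoidal_category V
  for V :: "('o, 'm) closed_monoidal_category" (structure) +
  assumes IHom_closed: "\<lbrakk>u \<in> Obj V; v \<in> Obj V\<rbrakk> \<Longrightarrow> IHom V u v \<in> Obj V"
    and Mate_bij: "\<lbrakk>u \<in> Obj V; w \<in> Obj V; v \<in> Obj V\<rbrakk>
      \<Longrightarrow> bij_betw (Mate V u w v) (hom V (u \<odot> w) v) (hom V w (IHom V u v))"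
    and Mate_natural: "\<lbrakk>u \<in> Obj V; v \<in> Obj V; h \<in> hom V w' w; f \<in> hom V (u \<odot> w) v\<rbrakk>
      \<Longrightarrow> Mate V u w' v ((\<i>\<d> u \<otimes> h) \<Zsemi> f) = h \<Zsemi> Mate V u w v f"

definition unmate ::
  "('o, 'm) closed_monoidal_category \<Rightarrow> 'o \<Rightarrow> 'o \<Rightarrow> 'o \<Rightarrow> 'm \<Rightarrow> 'm" where
  "unmate V u w v = inv_into (hom V (TenO V u w) v) (Mate V u w v)"

definition ev :: "('o, 'm) closed_monoidal_category \<Rightarrow> 'o \<Rightarrow> 'o \<Rightarrow> 'm" ("\<epsilon>\<index>") where
  "ev V u v = unmate V u (IHom V u v) v (Id V (IHom V u v))"


section \<open>Enriched categories, functors and natural transformations\<close>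

text \<open>
  \<open>VId C a\<close> is the identity \<open>j a : 1 \<rightarrow> C(a \<rightarrow> a)\<close> and \<open>VComp C a b c\<close> the composition
  \<open>C(a \<rightarrow> b) C(b \<rightarrow> c) \<rightarrow> C(a \<rightarrow> c)\<close>.
\<close>

record ('o, 'm, 'a) vcategory =
  VObj :: "'a set"
  VHom :: "'a \<Rightarrow> 'a \<Rightarrow> 'o"
  VId :: "'a \<Rightarrow> 'm"
  VComp :: "'a \<Rightarrow> 'a \<Rightarrow> 'a \<Rightarrow> 'm"

locale v_category = monoidal_category V
  for V :: "('o, 'm, 'z) monoidal_category_scheme" (structure)
    and C :: "('o, 'm, 'a) vcategory" +
  assumes VHom_closed: "\<lbrakk>a \<in> VObj C; b \<in> VObj C\<rbrakk> \<Longrightarrow> VHom C a b \<in> Obj V"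
    and VId_hom: "a \<in> VObj C \<Longrightarrow> VId C a \<in> hom V \<one> (VHom C a a)"
    and VComp_hom: "\<lbrakk>a \<in> VObj C; b \<in> VObj C; c \<in> VObj C\<rbrakk>
      \<Longrightarrow> VComp C a b c \<in> hom V (VHom C a b \<odot> VHom C b c) (VHom C a c)"
    and VComp_assoc: "\<lbrakk>a \<in> VObj C; b \<in> VObj C; c \<in> VObj C; d \<in> VObj C\<rbrakk>
      \<Longrightarrow> (VComp C a b c \<otimes> \<i>\<d> (VHom C c d)) \<Zsemi> VComp C a c d
        = \<alpha> (VHom C a b) (VHom C b c) (VHom C c d)
            \<Zsemi> (\<i>\<d> (VHom C a b) \<otimes> VComp C b c d) \<Zsemi> VComp C a b d"
    and VComp_VId_left: "\<lbrakk>a \<in> VObj C; b \<in> VObj C\<rbrakk>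
      \<Longrightarrow> (VId C a \<otimes> \<i>\<d> (VHom C a b)) \<Zsemi> VComp C a a b = \<lambda>\<^sub>V (VHom C a b)"
    and VComp_VId_right: "\<lbrakk>a \<in> VObj C; b \<in> VObj C\<rbrakk>
      \<Longrightarrow> (\<i>\<d> (VHom C a b) \<otimes> VId C b) \<Zsemi> VComp C a b b = \<rho> (VHom C a b)"

record ('a, 'b, 'm) vfunctor =
  FObj :: "'a \<Rightarrow> 'b"
  FMap :: "'a \<Rightarrow> 'a \<Rightarrow> 'm"

locale v_functor = C: v_category V C + D: v_category V D
  for V :: "('o, 'm, 'z) monoidal_category_scheme" (structure)
    and C :: "('o, 'm, 'a) vcategory"
    and D :: "('o, 'm, 'b) vcategory"
    and F :: "('a, 'b, 'm) vfunctor" +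
  assumes FObj_closed: "a \<in> VObj C \<Longrightarrow> FObj F a \<in> VObj D"
    and FMap_hom: "\<lbrakk>a \<in> VObj C; b \<in> VObj C\<rbrakk>
      \<Longrightarrow> FMap F a b \<in> hom V (VHom C a b) (VHom D (FObj F a) (FObj F b))"
    and FMap_VComp: "\<lbrakk>a \<in> VObj C; b \<in> VObj C; c \<in> VObj C\<rbrakk>
      \<Longrightarrow> VComp C a b c \<Zsemi> FMap F a c
        = (FMap F a b \<otimes> FMap F b c) \<Zsemi> VComp D (FObj F a) (FObj F b) (FObj F c)"
    and FMap_VId: "a \<in> VObj C \<Longrightarrow> VId C a \<Zsemi> FMap F a a = VId D (FObj F a)"

text \<open>The functor that is first \<open>F\<close>, then \<open>G\<close>.\<close>

definition vfunctor_comp ::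
  "('o, 'm, 'z) category_scheme \<Rightarrow> ('a, 'b, 'm) vfunctor \<Rightarrow> ('b, 'c, 'm) vfunctor
    \<Rightarrow> ('a, 'c, 'm) vfunctor" where
  "vfunctor_comp V F G = \<lparr>
     FObj = (\<lambda>a. FObj G (FObj F a)),
     FMap = (\<lambda>a b. Seq V (FMap F a b) (FMap G (FObj F a) (FObj F b)))\<rparr>"

locale v_natural_transformation = F: v_functor V C D F + G: v_functor V C D G
  for V :: "('o, 'm, 'z) monoidal_category_scheme" (structure)
    and C :: "('o, 'm, 'a) vcategory"
    and D :: "('o, 'm, 'b) vcategory"
    and F G :: "('a, 'b, 'm) vfunctor"
    and \<sigma> :: "'a \<Rightarrow> 'm" +
  assumes component_hom: "a \<in> VObj C \<Longrightarrow> \<sigma> a \<in> hom V \<one> (VHom D (FObj F a) (FObj G a))"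
    and naturality: "\<lbrakk>a \<in> VObj C; b \<in> VObj C\<rbrakk>
      \<Longrightarrow> \<i>\<n>\<v> (\<lambda>\<^sub>V (VHom C a b)) \<Zsemi> (\<sigma> a \<otimes> FMap G a b)
            \<Zsemi> VComp D (FObj F a) (FObj G a) (FObj G b)
        = \<i>\<n>\<v> (\<rho> (VHom C a b)) \<Zsemi> (FMap F a b \<otimes> \<sigma> b)
            \<Zsemi> VComp D (FObj F a) (FObj F b) (FObj G b)"

definition ucomp :: "('o, 'm, 'z) monoidal_category_scheme \<Rightarrow> ('o, 'm, 'a) vcategory
    \<Rightarrow> 'a \<Rightarrow> 'a \<Rightarrow> 'a \<Rightarrow> 'm \<Rightarrow> 'm \<Rightarrow> 'm" where
  "ucomp V C a b c f g =
     Seq V (Seq V (inv_arr V (LUnit V (Unit V))) (TenA V f g)) (VComp C a b c)"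

text \<open>
  The underlying category. An arrow \<open>1 \<rightarrow> C(a \<rightarrow> b)\<close> is tagged with its source \<open>a\<close> and target
  \<open>b\<close>, since different pairs of objects of \<open>C\<close> may share the same hom object.
\<close>

definition underlying :: "('o, 'm, 'z) monoidal_category_scheme \<Rightarrow> ('o, 'm, 'a) vcategory
    \<Rightarrow> ('a, 'a \<times> 'm \<times> 'a) category" where
  "underlying V C = \<lparr>
     Obj = VObj C,
     Arr = {(a, f, b). a \<in> VObj C \<and> b \<in> VObj C \<and> f \<in> hom V (Unit V) (VHom C a b)},
     Dom = (\<lambda>(a, f, b). a),
     Cod = (\<lambda>(a, f, b). b),
     Id = (\<lambda>a. (a, VId C a, a)),
     Seq = (\<lambda>(a, f, b) (b', g, c). (a, ucomp V C a b c f g, c))\<rparr>"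

definition v_functors_isomorphic ::
  "('o, 'm, 'z) monoidal_category_scheme \<Rightarrow> ('o, 'm, 'a) vcategory \<Rightarrow> ('o, 'm, 'b) vcategory
    \<Rightarrow> ('a, 'b, 'm) vfunctor \<Rightarrow> ('a, 'b, 'm) vfunctor \<Rightarrow> bool" where
  "v_functors_isomorphic V C D F G \<longleftrightarrow>
     (\<exists>\<sigma> \<tau>. v_natural_transformation V C D F G \<sigma> \<and> v_natural_transformation V C D G F \<tau>
       \<and> (\<forall>a\<in>VObj C.
            ucomp V D (FObj F a) (FObj G a) (FObj F a) (\<sigma> a) (\<tau> a) = VId D (FObj F a)
          \<and> ucomp V D (FObj G a) (FObj F a) (FObj G a) (\<tau> a) (\<sigma> a) = VId D (FObj G a)))"

text \<open>
  \<open>L\<close> is left adjoint to \<open>R\<close>: a family of isomorphisms \<open>D(L x \<rightarrow> b) \<cong> A(x \<rightarrow> R b)\<close> in \<open>V\<close>,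
  enriched-natural in \<open>x\<close> and in \<open>b\<close>. Since \<open>V\<close> is not braided there is no opposite enriched
  category, so both naturality conditions are expressed with composition in \<open>A\<close> and \<open>D\<close>.
\<close>

locale v_adjunction = L: v_functor V A D L + R: v_functor V D A R
  for V :: "('o, 'm, 'z) monoidal_category_scheme" (structure)
    and A :: "('o, 'm, 'a) vcategory"
    and D :: "('o, 'm, 'b) vcategory"
    and L :: "('a, 'b, 'm) vfunctor"
    and R :: "('b, 'a, 'm) vfunctor"
    and \<phi> :: "'a \<Rightarrow> 'b \<Rightarrow> 'm" +
  assumes adj_hom: "\<lbrakk>x \<in> VObj A; b \<in> VObj D\<rbrakk>
      \<Longrightarrow> \<phi> x b \<in> hom V (VHom D (FObj L x) b) (VHom A x (FObj R b))"
    and adj_iso: "\<lbrakk>x \<in> VObj A; b \<in> VObj D\<rbrakk> \<Longrightarrow> is_iso V (\<phi> x b)"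
    and adj_natural_left: "\<lbrakk>x \<in> VObj A; y \<in> VObj A; b \<in> VObj D\<rbrakk>
      \<Longrightarrow> (FMap L x y \<otimes> \<i>\<d> (VHom D (FObj L y) b)) \<Zsemi> VComp D (FObj L x) (FObj L y) b \<Zsemi> \<phi> x b
        = (\<i>\<d> (VHom A x y) \<otimes> \<phi> y b) \<Zsemi> VComp A x y (FObj R b)"
    and adj_natural_right: "\<lbrakk>x \<in> VObj A; b \<in> VObj D; c \<in> VObj D\<rbrakk>
      \<Longrightarrow> VComp D (FObj L x) b c \<Zsemi> \<phi> x c
        = (\<phi> x b \<otimes> FMap R b c) \<Zsemi> VComp A x (FObj R b) (FObj R c)"


section \<open>Self-enrichment and tensored categories\<close>

context
  fixes V :: "('o, 'm) closed_monoidal_category" (structure)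
begin

definition self_enriched :: "('o, 'm, 'o) vcategory" where
  "self_enriched = \<lparr>
     VObj = Obj V,
     VHom = IHom V,
     VId = (\<lambda>u. Mate V u \<one> u (\<rho> u)),
     VComp = (\<lambda>u v w. Mate V u (IHom V u v \<odot> IHom V v w) w
       (\<i>\<n>\<v> (\<alpha> u (IHom V u v) (IHom V v w)) \<Zsemi> (\<epsilon> u v \<otimes> \<i>\<d> (IHom V v w)) \<Zsemi> \<epsilon> v w))\<rparr>"

definition representable :: "('o, 'm, 'b) vcategory \<Rightarrow> 'b \<Rightarrow> ('b, 'o, 'm) vfunctor" where
  "representable D a = \<lparr>
     FObj = VHom D a,
     FMap = (\<lambda>b c. Mate V (VHom D a b) (VHom D b c) (VHom D a c) (VComp D a b c))\<rparr>"

end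

text \<open>
  A choice of left adjoints \<open>L\<^sub>a = (v \<mapsto> TObj a v)\<close> to the representable functors:
  \<open>TMap a v w : [v, w] \<rightarrow> D(TObj a v \<rightarrow> TObj a w)\<close> is the functor action of \<open>L\<^sub>a\<close>, and
  \<open>TIso a v b : D(TObj a v \<rightarrow> b) \<rightarrow> [v, D(a \<rightarrow> b)]\<close> the adjunction isomorphism.
\<close>

record ('o, 'm, 'b) tensoring =
  TObj :: "'b \<Rightarrow> 'o \<Rightarrow> 'b"
  TMap :: "'b \<Rightarrow> 'o \<Rightarrow> 'o \<Rightarrow> 'm"
  TIso :: "'b \<Rightarrow> 'o \<Rightarrow> 'b \<Rightarrow> 'm"

definition tensor_functor :: "('o, 'm, 'b) tensoring \<Rightarrow> 'b \<Rightarrow> ('o, 'b, 'm) vfunctor" where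
  "tensor_functor T a = \<lparr>FObj = TObj T a, FMap = TMap T a\<rparr>"

locale tensored_v_category = closed_monoidal_category V + v_category V D
  for V :: "('o, 'm) closed_monoidal_category" (structure)
    and D :: "('o, 'm, 'b) vcategory"
    and T :: "('o, 'm, 'b) tensoring" +
  assumes tensor_adjunction: "a \<in> VObj D \<Longrightarrow>
    v_adjunction V (self_enriched V) D (tensor_functor T a) (representable V D a) (TIso T a)"

context
  fixes V :: "('o, 'm) closed_monoidal_category" (structure)
begin

text \<open>
  \<open>tensor_mate D T a v b\<close> is the bijection from \<open>V(1 \<rightarrow> D(TObj a v \<rightarrow> b))\<close> to \<open>V(v \<rightarrow> D(a \<rightarrow> b))\<close>
  obtained from \<open>TIso\<close> via \<open>V(1 \<rightarrow> [v, D(a \<rightarrow> b)]) \<cong> V(v 1 \<rightarrow> D(a \<rightarrow> b))\<close>; \<open>tensor_unmate\<close> is its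
  inverse.
\<close>

definition tensor_mate ::
  "('o, 'm, 'b) vcategory \<Rightarrow> ('o, 'm, 'b) tensoring \<Rightarrow> 'b \<Rightarrow> 'o \<Rightarrow> 'b \<Rightarrow> 'm \<Rightarrow> 'm" where
  "tensor_mate D T a v b f = \<i>\<n>\<v> (\<rho> v) \<Zsemi> unmate V v \<one> (VHom D a b) (f \<Zsemi> TIso T a v b)"

definition tensor_unmate ::
  "('o, 'm, 'b) vcategory \<Rightarrow> ('o, 'm, 'b) tensoring \<Rightarrow> 'b \<Rightarrow> 'o \<Rightarrow> 'b \<Rightarrow> 'm \<Rightarrow> 'm" where
  "tensor_unmate D T a v b g = Mate V v \<one> (VHom D a b) (\<rho> v \<Zsemi> g) \<Zsemi> \<i>\<n>\<v> (TIso T a v b)"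

definition tensor_unit ::
  "('o, 'm, 'b) vcategory \<Rightarrow> ('o, 'm, 'b) tensoring \<Rightarrow> 'b \<Rightarrow> 'o \<Rightarrow> 'm" where
  "tensor_unit D T a v = tensor_mate D T a v (TObj T a v) (VId D (TObj T a v))"

definition tensorator ::
  "('o, 'm, 'a) vcategory \<Rightarrow> ('o, 'm, 'a) tensoring
    \<Rightarrow> ('o, 'm, 'b) vcategory \<Rightarrow> ('o, 'm, 'b) tensoring
    \<Rightarrow> ('a, 'b, 'm) vfunctor \<Rightarrow> 'a \<Rightarrow> 'o \<Rightarrow> 'm" where
  "tensorator A T\<^sub>A D T\<^sub>D F c v =
     tensor_unmate D T\<^sub>D (FObj F c) v (FObj F (TObj T\<^sub>A c v))
       (tensor_unit A T\<^sub>A c v \<Zsemi> FMap F c (TObj T\<^sub>A c v))"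

end

locale tensored_v_functor =
  A: tensored_v_category V A T\<^sub>A + D: tensored_v_category V D T\<^sub>D + v_functor V A D F
  for V :: "('o, 'm) closed_monoidal_category" (structure)
    and A :: "('o, 'm, 'a) vcategory" and T\<^sub>A :: "('o, 'm, 'a) tensoring"
    and D :: "('o, 'm, 'b) vcategory" and T\<^sub>D :: "('o, 'm, 'b) tensoring"
    and F :: "('a, 'b, 'm) vfunctor" +
  assumes tensorator_iso: "\<lbrakk>c \<in> VObj A; v \<in> Obj V\<rbrakk> \<Longrightarrow>
    is_iso (underlying V D)
      (TObj T\<^sub>D (FObj F c) v, tensorator V A T\<^sub>A D T\<^sub>D F c v, FObj F (TObj T\<^sub>A c v))"


section \<open>The completion\<close>

datatype ('a, 'o) formal_tensor = Formal (base: 'a) (weight: 'o) (infix "\<triangleleft>" 75)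

context
  fixes V :: "('o, 'm) closed_monoidal_category" (structure)
    and C :: "('o, 'm, 'a) vcategory"
begin

definition completion_hom :: "('a, 'o) formal_tensor \<Rightarrow> ('a, 'o) formal_tensor \<Rightarrow> 'o" where
  "completion_hom x y = IHom V (weight x) (VHom C (base x) (base y) \<odot> weight y)"

text \<open>The identity at \<open>a \<triangleleft> u\<close> before passing to the mate: \<open>u \<cong> 1 u \<rightarrow> C(a \<rightarrow> a) u\<close>.\<close>

definition id_tensor :: "'a \<Rightarrow> 'o \<Rightarrow> 'm" where
  "id_tensor a u = \<i>\<n>\<v> (\<lambda>\<^sub>V u) \<Zsemi> (VId C a \<otimes> \<i>\<d> u)"

text \<open>
  With \<open>x = a \<triangleleft> u\<close>, \<open>y = b \<triangleleft> v\<close>, \<open>z = c \<triangleleft> w\<close>, \<open>X = [u, C(a \<rightarrow> b) v]\<close> and \<open>Y = [v, C(b \<rightarrow> c) w]\<close>,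
  the composite is the mate of
  \<open>u (X Y) \<cong> (u X) Y \<rightarrow> (C(a \<rightarrow> b) v) Y \<cong> C(a \<rightarrow> b) (v Y) \<rightarrow> C(a \<rightarrow> b) (C(b \<rightarrow> c) w)
    \<cong> (C(a \<rightarrow> b) C(b \<rightarrow> c)) w \<rightarrow> C(a \<rightarrow> c) w\<close>.
\<close>

definition completion :: "('o, 'm, ('a, 'o) formal_tensor) vcategory" where
  "completion = \<lparr>
     VObj = {a \<triangleleft> u | a u. a \<in> VObj C \<and> u \<in> Obj V},
     VHom = completion_hom,
     VId = (\<lambda>x. let a = base x; u = weight x in
       Mate V u \<one> (VHom C a a \<odot> u) (\<rho> u \<Zsemi> id_tensor a u)),
     VComp = (\<lambda>x y z.
       let a = base x; u = weight x; b = base y; v = weight y; c = base z; w = weight z;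
           X = completion_hom x y; Y = completion_hom y z in
       Mate V u (X \<odot> Y) (VHom C a c \<odot> w)
         (\<i>\<n>\<v> (\<alpha> u X Y)
          \<Zsemi> (\<epsilon> u (VHom C a b \<odot> v) \<otimes> \<i>\<d> Y)
          \<Zsemi> \<alpha> (VHom C a b) v Y
          \<Zsemi> (\<i>\<d> (VHom C a b) \<otimes> \<epsilon> v (VHom C b c \<odot> w))
          \<Zsemi> \<i>\<n>\<v> (\<alpha> (VHom C a b) (VHom C b c) w)
          \<Zsemi> (VComp C a b c \<otimes> \<i>\<d> w)))\<rparr>"

text \<open>
  The tensoring \<open>(a \<triangleleft> u, v) \<mapsto> a \<triangleleft> (u v)\<close>. The isomorphism
  \<open>[u v, C(a \<rightarrow> b) w] \<cong> [v, [u, C(a \<rightarrow> b) w]]\<close> is the canonical one (the double mate of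
  evaluation), and the functor action \<open>[v, w] \<rightarrow> [u v, C(a \<rightarrow> a) (u w)]\<close>, forced by naturality,
  is the mate of \<open>(u v) [v, w] \<cong> u (v [v, w]) \<rightarrow> u w \<rightarrow> C(a \<rightarrow> a) (u w)\<close>.
\<close>

definition completion_tensoring :: "('o, 'm, ('a, 'o) formal_tensor) tensoring" where
  "completion_tensoring = \<lparr>
     TObj = (\<lambda>x v. base x \<triangleleft> (weight x \<odot> v)),
     TMap = (\<lambda>x v w. let a = base x; u = weight x in
       Mate V (u \<odot> v) (IHom V v w) (VHom C a a \<odot> (u \<odot> w))
         (\<alpha> u v (IHom V v w) \<Zsemi> (\<i>\<d> u \<otimes> \<epsilon> v w) \<Zsemi> id_tensor a (u \<odot> w))),
     TIso = (\<lambda>x v y. let u = weight x; Z = VHom C (base x) (base y) \<odot> weight y;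
                         H = IHom V (u \<odot> v) Z in
       Mate V v H (IHom V u Z)
         (Mate V u (v \<odot> H) Z (\<i>\<n>\<v> (\<alpha> u v H) \<Zsemi> \<epsilon> (u \<odot> v) Z)))\<rparr>"

text \<open>\<open>\<I>\<close> acts on homs as the mate of \<open>1 C(a \<rightarrow> b) \<cong> C(a \<rightarrow> b) \<cong> C(a \<rightarrow> b) 1\<close>.\<close>

definition completion_incl :: "('a, ('a, 'o) formal_tensor, 'm) vfunctor" where
  "completion_incl = \<lparr>
     FObj = (\<lambda>a. a \<triangleleft> \<one>),
     FMap = (\<lambda>a b. Mate V \<one> (VHom C a b) (VHom C a b \<odot> \<one>)
       (\<lambda>\<^sub>V (VHom C a b) \<Zsemi> \<i>\<n>\<v> (\<rho> (VHom C a b))))\<rparr>"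

end

end

theory Submission
  imports Defs
begin

text \<open>
  The extension sends \<open>a \<triangleleft> u\<close> to the tensor of \<open>F a\<close> with \<open>u\<close>. By the universal property of the
  tensor, the map \<open>[u, C(a \<rightarrow> b) v] \<rightarrow> D(F a u \<rightarrow> F b v)\<close> is the one that corresponds to
  \<open>u [u, C(a \<rightarrow> b) v] \<rightarrow> C(a \<rightarrow> b) v \<rightarrow> D(F a \<rightarrow> F b) D(F b \<rightarrow> F b v) \<rightarrow> D(F a \<rightarrow> F b v)\<close>: evaluation, then \<open>F\<close>
  and the unit of the tensor, then composition. Functoriality, and the fact that the canonical
  map between \<open>(F a u) v\<close> and \<open>F a (u v)\<close> is invertible, follow by comparing both sides after
  the units. The unit at \<open>u = 1\<close> is the isomorphism from \<open>F\<close> to the restricted extension.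

  Associators are kept out of the calculations by replacing \<open>f : u v \<rightarrow> w\<close> with the natural family
  \<open>u (v x) \<rightarrow> w x\<close> that it induces, and likewise \<open>f : u \<rightarrow> w\<close> with \<open>u x \<rightarrow> w x\<close> and \<open>j : 1 \<rightarrow> w\<close> with
  \<open>x \<rightarrow> w x\<close>. In terms of these families the laws of enriched categories and of functors between
  them are strict, and evaluation at \<open>x = 1\<close> recovers \<open>f\<close>.
\<close>

section \<open>Categories and monoidal categories\<close>

text \<open>Replacing an object \<open>u\<close> by the functor \<open>u \<odot> _\<close> is the
  usual strictification: composition of functors is strictly associative, and the pentagon, the
  triangle and the unit coherences are needed chiefly where a definition is translated into
  families. As there is no braiding, the contravariant variable of a hom object cannot be treated
  through an opposite enriched category and its Yoneda lemma. Equations between arrows into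
  \<open>[u, v]\<close> or into \<open>D(F a u -> b)\<close> are instead tested directly, through
  the predicate \<open>detects\<close>. Yoneda survives in one place, \<open>act1_TIso\<close>:
  naturality in the second variable, applied to an identity, expresses \<open>TIso\<close> through
  the unit. From then on the tensors of \<open>D\<close> are handled through their units
  (uniqueness, \<open>detects_unit\<close>) and through \<open>lift\<close> (existence,
  \<open>act1_lift\<close>). The inverse of the tensorator is obtained in this way as well: it
  corresponds to the composite of the units for \<open>u\<close> and for \<open>v\<close>.\<close>

context category
begin

lemma hom_iff: "f \<in> hom V a b \<longleftrightarrow> f \<in> Arr V \<and> Dom V f = a \<and> Cod V f = b"
  by (auto simp: hom_def)

lemma Dom_Obj [simp]: "f \<in> Arr V \<Longrightarrow> Dom V f \<in> Obj V"
  and Cod_Obj [simp]: "f \<in> Arr V \<Longrightarrow> Cod V f \<in> Obj V"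
  by (auto intro: Dom_closed Cod_closed)

lemma Id_typing [simp]:
  assumes "a \<in> Obj V"
  shows "\<i>\<d> a \<in> Arr V" "Dom V (\<i>\<d> a) = a" "Cod V (\<i>\<d> a) = a"
  using Id_hom[OF assms] by (auto simp: hom_iff)

text \<open>
  The condition of composability is a single predicate so that checking a right-nested composite
  takes linear time: with the two conditions \<open>g \<in> Arr V\<close> and \<open>Cod V f = Dom V g\<close> the simplifier
  would visit the tail of the composite twice at every step.
\<close>

definition starts :: "'o \<Rightarrow> 'm \<Rightarrow> bool" where
  starts_iff [simp]: "starts a f \<longleftrightarrow> f \<in> Arr V \<and> Dom V f = a"

lemma Seq_typing [simp]:
  assumes "f \<in> Arr V" "starts (Cod V f) g"
  shows "f \<Zsemi> g \<in> Arr V" "Dom V (f \<Zsemi> g) = Dom V f" "Cod V (f \<Zsemi> g) = Cod V g"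
  using Seq_hom[of f "Dom V f" "Cod V f" g "Cod V g"] assms by (auto simp: hom_iff)

lemma starts_Seq [simp]:
  assumes "starts a f" "starts (Cod V f) g"
  shows "starts a (f \<Zsemi> g)"
  using assms by simp

lemma Id_Seq [simp]: "\<lbrakk>f \<in> Arr V; Dom V f = a\<rbrakk> \<Longrightarrow> \<i>\<d> a \<Zsemi> f = f"
  and Seq_Id [simp]: "\<lbrakk>f \<in> Arr V; Cod V f = b\<rbrakk> \<Longrightarrow> f \<Zsemi> \<i>\<d> b = f"
  by (auto intro: Id_left Id_right simp: hom_iff)

lemma Seq_Seq [simp]:
  "\<lbrakk>f \<in> Arr V; starts (Cod V f) g; starts (Cod V g) h\<rbrakk>
    \<Longrightarrow> (f \<Zsemi> g) \<Zsemi> h = f \<Zsemi> (g \<Zsemi> h)"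
  by (auto intro: Seq_assoc simp: hom_iff)

text \<open>Since simp nests composites to the right, a rule for \<open>f \<Zsemi> g\<close> no
  longer matches once an arrow \<open>k\<close> follows. \<open>THEN Seq_eq_Seq\<close> supplies the
  variant of a rule with such a tail; \<open>Seq_eq_Seq3\<close> does so for three factors.\<close>

lemma Seq_eq_Seq:
  "\<lbrakk>f \<Zsemi> g = r; f \<in> Arr V; starts (Cod V f) g; starts (Cod V g) k\<rbrakk>
    \<Longrightarrow> f \<Zsemi> (g \<Zsemi> k) = r \<Zsemi> k"
  by (metis Seq_Seq)

lemma Seq_eq_Seq3:
  "\<lbrakk>f \<Zsemi> (g \<Zsemi> h) = r; f \<in> Arr V; starts (Cod V f) g; starts (Cod V g) h; starts (Cod V h) k\<rbrakk>
    \<Longrightarrow> f \<Zsemi> (g \<Zsemi> (h \<Zsemi> k)) = r \<Zsemi> k"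
  by (metis Seq_Seq Seq_typing(3) starts_Seq starts_iff)

lemma inverse_arrows_inv:
  assumes "is_iso V f"
  shows "inverse_arrows V f (\<i>\<n>\<v> f)"
proof -
  obtain g where g: "inverse_arrows V f g"
    using assms by (auto simp: is_iso_def)
  moreover have "h = g" if "inverse_arrows V f h" for h
  proof -
    have "h = (g \<Zsemi> f) \<Zsemi> h"
      using g that by (auto simp: inverse_arrows_def hom_iff simp del: Seq_Seq)
    also have "\<dots> = g \<Zsemi> (f \<Zsemi> h)"
      using g that by (intro Seq_Seq) (auto simp: inverse_arrows_def hom_iff)
    also have "\<dots> = g"
      using g that by (auto simp: inverse_arrows_def hom_iff)
    finally show ?thesis .
  qed
  ultimately show ?thesis
    unfolding inv_arr_def by (rule theI)
qed

lemma iso_Arr [dest]: "is_iso V f \<Longrightarrow> f \<in> Arr V"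
  by (auto simp: is_iso_def inverse_arrows_def)

lemma inv_typing [simp]:
  assumes "is_iso V f"
  shows "\<i>\<n>\<v> f \<in> Arr V" "Dom V (\<i>\<n>\<v> f) = Cod V f" "Cod V (\<i>\<n>\<v> f) = Dom V f"
  using inverse_arrows_inv[OF assms] by (auto simp: inverse_arrows_def hom_iff)

lemma inv_Seq [simp]: "is_iso V f \<Longrightarrow> Cod V f = a \<Longrightarrow> \<i>\<n>\<v> f \<Zsemi> f = \<i>\<d> a"
  and Seq_inv [simp]: "is_iso V f \<Longrightarrow> Dom V f = a \<Longrightarrow> f \<Zsemi> \<i>\<n>\<v> f = \<i>\<d> a"
  by (auto dest: inverse_arrows_inv simp: inverse_arrows_def)

lemma inv_Seq_Seq [simp]: "\<lbrakk>is_iso V f; starts (Cod V f) g\<rbrakk> \<Longrightarrow> \<i>\<n>\<v> f \<Zsemi> (f \<Zsemi> g) = g"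
  and Seq_inv_Seq [simp]: "\<lbrakk>is_iso V f; starts (Dom V f) g\<rbrakk> \<Longrightarrow> f \<Zsemi> (\<i>\<n>\<v> f \<Zsemi> g) = g"
  by (auto simp: iso_Arr Seq_Seq[symmetric] simp del: Seq_Seq)

lemma iso_cancel_left:
  assumes "f \<Zsemi> g = f \<Zsemi> h" "is_iso V f" "g \<in> Arr V" "h \<in> Arr V" "Dom V g = Cod V f" "Dom V h = Cod V f"
  shows "g = h"
  using assms by (metis inv_Seq_Seq starts_iff)

lemma iso_cancel_right:
  assumes "g \<Zsemi> f = h \<Zsemi> f" "is_iso V f" "g \<in> Arr V" "h \<in> Arr V" "Cod V g = Dom V f" "Cod V h = Dom V f"
  shows "g = h"
proof -
  have "(g \<Zsemi> f) \<Zsemi> \<i>\<n>\<v> f = (h \<Zsemi> f) \<Zsemi> \<i>\<n>\<v> f"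
    using assms(1) by simp
  then show ?thesis
    using assms(2-) by (simp add: iso_Arr)
qed

lemma isoI:
  assumes "f \<in> Arr V" "g \<in> Arr V" "Dom V g = Cod V f" "Cod V g = Dom V f"
    "f \<Zsemi> g = \<i>\<d> (Dom V f)" "g \<Zsemi> f = \<i>\<d> (Cod V f)"
  shows "is_iso V f"
  using assms by (auto simp: is_iso_def inverse_arrows_def hom_iff)

lemma iso_inv: "is_iso V f \<Longrightarrow> is_iso V (\<i>\<n>\<v> f)"
  by (rule isoI[where g = f]) (auto simp: iso_Arr)

lemma iso_Seq: "\<lbrakk>is_iso V f; is_iso V g; Cod V f = Dom V g\<rbrakk> \<Longrightarrow> is_iso V (f \<Zsemi> g)"
  by (rule isoI[where g = "\<i>\<n>\<v> g \<Zsemi> \<i>\<n>\<v> f"]) (auto simp: iso_Arr)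

text \<open>Cancels \<open>f\<close> on the left and \<open>f'\<close> on the right of the square;
  this turns naturality of associators and unitors into naturality of their inverses.\<close>

lemma inv_slide:
  assumes "is_iso V f" "is_iso V f'" "f \<Zsemi> g = h \<Zsemi> f'" "g \<in> Arr V" "h \<in> Arr V"
    "Dom V g = Cod V f" "Cod V g = Cod V f'" "Dom V h = Dom V f" "Cod V h = Dom V f'"
  shows "g \<Zsemi> \<i>\<n>\<v> f' = \<i>\<n>\<v> f \<Zsemi> h"
proof -
  have "g \<Zsemi> \<i>\<n>\<v> f' = \<i>\<n>\<v> f \<Zsemi> ((f \<Zsemi> g) \<Zsemi> \<i>\<n>\<v> f')"
    using assms(1,2,4-) by (simp add: iso_Arr)
  also have "\<dots> = \<i>\<n>\<v> f \<Zsemi> h"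
    unfolding assms(3) using assms(1,2,4-) by (simp add: iso_Arr)
  finally show ?thesis .
qed

end

context monoidal_category
begin

lemma Unit_Obj [simp]: "\<one> \<in> Obj V"
  and TenO_Obj [simp]: "\<lbrakk>u \<in> Obj V; v \<in> Obj V\<rbrakk> \<Longrightarrow> u \<odot> v \<in> Obj V"
  by (auto intro: Unit_closed TenO_closed)

lemma TenA_typing [simp]:
  assumes "f \<in> Arr V" "g \<in> Arr V"
  shows "f \<otimes> g \<in> Arr V" "Dom V (f \<otimes> g) = Dom V f \<odot> Dom V g" "Cod V (f \<otimes> g) = Cod V f \<odot> Cod V g"
  using TenA_hom[of f "Dom V f" "Cod V f" g "Dom V g" "Cod V g"] assms by (auto simp: hom_iff)

lemma TenA_Seq:
  "\<lbrakk>f \<in> Arr V; f' \<in> Arr V; g \<in> Arr V; g' \<in> Arr V; Cod V f = Dom V f'; Cod V g = Dom V g'\<rbrakk>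
    \<Longrightarrow> (f \<otimes> g) \<Zsemi> (f' \<otimes> g') = (f \<Zsemi> f') \<otimes> (g \<Zsemi> g')"
  by (rule interchange[symmetric]) (auto simp: hom_iff)

lemma Assoc_typing [simp]:
  assumes "u \<in> Obj V" "v \<in> Obj V" "w \<in> Obj V"
  shows "\<alpha> u v w \<in> Arr V" "Dom V (\<alpha> u v w) = u \<odot> v \<odot> w" "Cod V (\<alpha> u v w) = u \<odot> (v \<odot> w)"
    "is_iso V (\<alpha> u v w)"
  using Assoc_hom[OF assms] Assoc_iso[OF assms] by (auto simp: hom_iff)

lemma LUnit_typing [simp]:
  assumes "u \<in> Obj V"
  shows "\<lambda>\<^sub>V u \<in> Arr V" "Dom V (\<lambda>\<^sub>V u) = \<one> \<odot> u" "Cod V (\<lambda>\<^sub>V u) = u" "is_iso V (\<lambda>\<^sub>V u)"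
  using LUnit_hom[OF assms] LUnit_iso[OF assms] by (auto simp: hom_iff)

lemma RUnit_typing [simp]:
  assumes "u \<in> Obj V"
  shows "\<rho> u \<in> Arr V" "Dom V (\<rho> u) = u \<odot> \<one>" "Cod V (\<rho> u) = u" "is_iso V (\<rho> u)"
  using RUnit_hom[OF assms] RUnit_iso[OF assms] by (auto simp: hom_iff)

section \<open>One-sided tensoring and the families of arrows\<close>

definition lact :: "'o \<Rightarrow> 'm \<Rightarrow> 'm" (infixr "\<rhd>" 65) where
  "u \<rhd> f = \<i>\<d> u \<otimes> f"

definition act0 :: "'m \<Rightarrow> 'o \<Rightarrow> 'm" where
  "act0 j x = \<i>\<n>\<v> (\<lambda>\<^sub>V x) \<Zsemi> (j \<otimes> \<i>\<d> x)"

definition act1 :: "'m \<Rightarrow> 'o \<Rightarrow> 'm" where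
  "act1 f x = f \<otimes> \<i>\<d> x"

definition act2 :: "'o \<Rightarrow> 'o \<Rightarrow> 'm \<Rightarrow> 'o \<Rightarrow> 'm" where
  "act2 u v f x = \<i>\<n>\<v> (\<alpha> u v x) \<Zsemi> (f \<otimes> \<i>\<d> x)"

lemma lact_typing [simp]:
  assumes "u \<in> Obj V" "f \<in> Arr V"
  shows "u \<rhd> f \<in> Arr V" "Dom V (u \<rhd> f) = u \<odot> Dom V f" "Cod V (u \<rhd> f) = u \<odot> Cod V f"
  using assms by (auto simp: lact_def)

lemma act0_typing [simp]:
  assumes "j \<in> Arr V" "Dom V j = \<one>" "x \<in> Obj V"
  shows "act0 j x \<in> Arr V" "Dom V (act0 j x) = x" "Cod V (act0 j x) = Cod V j \<odot> x"
  using assms by (auto simp: act0_def)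

lemma act1_typing [simp]:
  assumes "f \<in> Arr V" "x \<in> Obj V"
  shows "act1 f x \<in> Arr V" "Dom V (act1 f x) = Dom V f \<odot> x" "Cod V (act1 f x) = Cod V f \<odot> x"
  using assms by (auto simp: act1_def)

lemma act2_typing [simp]:
  assumes "f \<in> Arr V" "Dom V f = u \<odot> v" "u \<in> Obj V" "v \<in> Obj V" "x \<in> Obj V"
  shows "act2 u v f x \<in> Arr V" "Dom V (act2 u v f x) = u \<odot> (v \<odot> x)"
    "Cod V (act2 u v f x) = Cod V f \<odot> x"
  using assms by (auto simp: act2_def)

lemma lact_Seq [simp]:
  "\<lbrakk>u \<in> Obj V; f \<in> Arr V; starts (Cod V f) g\<rbrakk> \<Longrightarrow> u \<rhd> (f \<Zsemi> g) = (u \<rhd> f) \<Zsemi> (u \<rhd> g)"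
  by (simp add: lact_def TenA_Seq)

lemma lact_Id [simp]: "\<lbrakk>u \<in> Obj V; v \<in> Obj V\<rbrakk> \<Longrightarrow> u \<rhd> \<i>\<d> v = \<i>\<d> (u \<odot> v)"
  by (simp add: lact_def TenA_Id)

lemma act1_Seq [simp]:
  "\<lbrakk>x \<in> Obj V; f \<in> Arr V; starts (Cod V f) g\<rbrakk> \<Longrightarrow> act1 (f \<Zsemi> g) x = act1 f x \<Zsemi> act1 g x"
  by (simp add: act1_def TenA_Seq)

lemma act1_Id [simp]: "\<lbrakk>u \<in> Obj V; v \<in> Obj V\<rbrakk> \<Longrightarrow> act1 (\<i>\<d> u) v = \<i>\<d> (u \<odot> v)"
  by (simp add: act1_def TenA_Id)

lemma act0_Seq [simp]:
  "\<lbrakk>x \<in> Obj V; f \<in> Arr V; starts (Cod V f) g; Dom V f = \<one>\<rbrakk>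
    \<Longrightarrow> act0 (f \<Zsemi> g) x = act0 f x \<Zsemi> act1 g x"
  using act1_Seq[of x f g] by (simp add: act0_def act1_def)

lemma act2_Seq:
  "\<lbrakk>x \<in> Obj V; f \<in> Arr V; starts (Cod V f) g; Dom V f = u \<odot> v; u \<in> Obj V; v \<in> Obj V\<rbrakk>
    \<Longrightarrow> act2 u v (f \<Zsemi> g) x = act2 u v f x \<Zsemi> act1 g x"
  using act1_Seq[of x f g] by (simp add: act2_def act1_def)

text \<open>Of the two orders that the interchange law allows, this one acts on the right factor
  first. It removes two-sided tensors in favour of \<open>\<rhd>\<close> and
  \<open>act1\<close>.\<close>

lemma TenA_eq: "\<lbrakk>f \<in> Arr V; g \<in> Arr V\<rbrakk> \<Longrightarrow> f \<otimes> g = (Dom V f \<rhd> g) \<Zsemi> act1 f (Cod V g)"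
  by (simp add: lact_def act1_def TenA_Seq)

lemma iso_lact [simp]:
  assumes "is_iso V f" "u \<in> Obj V" shows "is_iso V (u \<rhd> f)"
proof (rule isoI[where g = "u \<rhd> \<i>\<n>\<v> f"])
qed (use assms iso_Arr[OF assms(1)] in \<open>simp_all flip: lact_Seq\<close>)

lemma iso_act1 [simp]:
  assumes "is_iso V f" "u \<in> Obj V" shows "is_iso V (act1 f u)"
proof (rule isoI[where g = "act1 (\<i>\<n>\<v> f) u"])
qed (use assms iso_Arr[OF assms(1)] in \<open>simp_all flip: act1_Seq\<close>)

lemma lact_inv [simp]:
  assumes "is_iso V f" "u \<in> Obj V"
  shows "(u \<rhd> f) \<Zsemi> (u \<rhd> \<i>\<n>\<v> f) = \<i>\<d> (u \<odot> Dom V f)" "(u \<rhd> \<i>\<n>\<v> f) \<Zsemi> (u \<rhd> f) = \<i>\<d> (u \<odot> Cod V f)"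
  using assms iso_Arr[OF assms(1)] by (simp_all flip: lact_Seq)

lemmas lact_inv_Seq [simp] = lact_inv[THEN Seq_eq_Seq]

lemma act1_inv [simp]:
  assumes "is_iso V f" "u \<in> Obj V"
  shows "act1 f u \<Zsemi> act1 (\<i>\<n>\<v> f) u = \<i>\<d> (Dom V f \<odot> u)" "act1 (\<i>\<n>\<v> f) u \<Zsemi> act1 f u = \<i>\<d> (Cod V f \<odot> u)"
  using assms iso_Arr[OF assms(1)] by (simp_all flip: act1_Seq)

lemmas act1_inv_Seq [simp] = act1_inv[THEN Seq_eq_Seq]

lemma Assoc_nat1:
  "\<lbrakk>f \<in> Arr V; v \<in> Obj V; w \<in> Obj V\<rbrakk>
    \<Longrightarrow> act1 (act1 f v) w \<Zsemi> \<alpha> (Cod V f) v w = \<alpha> (Dom V f) v w \<Zsemi> act1 f (v \<odot> w)"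
  using Assoc_natural[of f "Dom V f" "Cod V f" "\<i>\<d> v" v v "\<i>\<d> w" w w]
  by (simp add: hom_iff act1_def lact_def TenA_Id)

lemma Assoc_nat2:
  "\<lbrakk>f \<in> Arr V; u \<in> Obj V; w \<in> Obj V\<rbrakk>
    \<Longrightarrow> act1 (u \<rhd> f) w \<Zsemi> \<alpha> u (Cod V f) w = \<alpha> u (Dom V f) w \<Zsemi> (u \<rhd> act1 f w)"
  using Assoc_natural[of "\<i>\<d> u" u u f "Dom V f" "Cod V f" "\<i>\<d> w" w w]
  by (simp add: hom_iff act1_def lact_def TenA_Id)

lemma Assoc_nat3:
  "\<lbrakk>f \<in> Arr V; u \<in> Obj V; v \<in> Obj V; y = Cod V f\<rbrakk>
    \<Longrightarrow> (u \<odot> v \<rhd> f) \<Zsemi> \<alpha> u v y = \<alpha> u v (Dom V f) \<Zsemi> (u \<rhd> v \<rhd> f)"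
  using Assoc_natural[of "\<i>\<d> u" u u "\<i>\<d> v" v v f "Dom V f" "Cod V f"]
  by (simp add: hom_iff act1_def lact_def TenA_Id)

lemma Assoc_inv_nat1:
  "\<lbrakk>f \<in> Arr V; v \<in> Obj V; w \<in> Obj V\<rbrakk>
    \<Longrightarrow> act1 f (v \<odot> w) \<Zsemi> \<i>\<n>\<v> (\<alpha> (Cod V f) v w) = \<i>\<n>\<v> (\<alpha> (Dom V f) v w) \<Zsemi> act1 (act1 f v) w"
  by (rule inv_slide) (simp_all add: Assoc_nat1)

lemma Assoc_inv_nat2:
  "\<lbrakk>f \<in> Arr V; u \<in> Obj V; w \<in> Obj V\<rbrakk>
    \<Longrightarrow> (u \<rhd> act1 f w) \<Zsemi> \<i>\<n>\<v> (\<alpha> u (Cod V f) w) = \<i>\<n>\<v> (\<alpha> u (Dom V f) w) \<Zsemi> act1 (u \<rhd> f) w"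
  by (rule inv_slide) (simp_all add: Assoc_nat2)

lemma Assoc_inv_nat3:
  "\<lbrakk>f \<in> Arr V; u \<in> Obj V; v \<in> Obj V; y = Cod V f\<rbrakk>
    \<Longrightarrow> (u \<rhd> v \<rhd> f) \<Zsemi> \<i>\<n>\<v> (\<alpha> u v y) = \<i>\<n>\<v> (\<alpha> u v (Dom V f)) \<Zsemi> (u \<odot> v \<rhd> f)"
  by (rule inv_slide) (simp_all add: Assoc_nat3)

lemma LUnit_nat: "f \<in> Arr V \<Longrightarrow> (\<one> \<rhd> f) \<Zsemi> \<lambda>\<^sub>V (Cod V f) = \<lambda>\<^sub>V (Dom V f) \<Zsemi> f"
  using LUnit_natural[of f "Dom V f" "Cod V f"] by (simp add: hom_iff lact_def)

lemma LUnit_inv_nat: "f \<in> Arr V \<Longrightarrow> f \<Zsemi> \<i>\<n>\<v> (\<lambda>\<^sub>V (Cod V f)) = \<i>\<n>\<v> (\<lambda>\<^sub>V (Dom V f)) \<Zsemi> (\<one> \<rhd> f)"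
  by (rule inv_slide) (simp_all add: LUnit_nat)

lemma RUnit_nat: "f \<in> Arr V \<Longrightarrow> act1 f \<one> \<Zsemi> \<rho> (Cod V f) = \<rho> (Dom V f) \<Zsemi> f"
  using RUnit_natural[of f "Dom V f" "Cod V f"] by (simp add: hom_iff act1_def)

lemma act1_lact:
  "\<lbrakk>f \<in> Arr V; g \<in> Arr V; Cod V f = u; y = Dom V g\<rbrakk>
    \<Longrightarrow> act1 f y \<Zsemi> (u \<rhd> g) = (Dom V f \<rhd> g) \<Zsemi> act1 f (Cod V g)"
  by (auto simp: lact_def act1_def TenA_Seq)

lemma act0_lact:
  assumes "j \<in> Arr V" "g \<in> Arr V" "Dom V j = \<one>" "Cod V j = u" "y = Dom V g"
  shows "act0 j y \<Zsemi> (u \<rhd> g) = g \<Zsemi> act0 j (Cod V g)"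
  using assms Cod_Obj[OF assms(1)] LUnit_inv_nat[of g, THEN Seq_eq_Seq, of "act1 j (Cod V g)"]
  by (simp add: act0_def act1_lact flip: act1_def)

lemma act2_lact:
  assumes "f \<in> Arr V" "g \<in> Arr V" "Dom V f = u \<odot> v" "Cod V f = w" "y = Dom V g" "u \<in> Obj V" "v \<in> Obj V"
  shows "act2 u v f y \<Zsemi> (w \<rhd> g) = (u \<rhd> v \<rhd> g) \<Zsemi> act2 u v f (Cod V g)"
  using assms Cod_Obj[OF assms(1)] Assoc_inv_nat3[of g u v "Cod V g", THEN Seq_eq_Seq, of "act1 f (Cod V g)"]
  by (simp add: act2_def act1_lact flip: act1_def)

text \<open>As \<open>lact_Seq\<close> distributes \<open>\<rhd>\<close> over composites, an
  equation inside a right factor shows up in distributed form. This rule produces that form;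
  together with \<open>Seq_eq_Seq\<close> it closes a set of rewrite rules under inner factors and
  tails.\<close>

lemma lact_eq_lact:
  "\<lbrakk>f \<Zsemi> g = r; f \<in> Arr V; starts (Cod V f) g; w \<in> Obj V\<rbrakk> \<Longrightarrow> (w \<rhd> f) \<Zsemi> (w \<rhd> g) = w \<rhd> r"
  by (metis lact_Seq)

lemma lact_act1:
  "\<lbrakk>f \<in> Arr V; g \<in> Arr V; u = Dom V f; y = Cod V g\<rbrakk>
    \<Longrightarrow> (u \<rhd> g) \<Zsemi> act1 f y = act1 f (Dom V g) \<Zsemi> (Cod V f \<rhd> g)"
  by (simp add: act1_lact)

lemma lact_act2:
  "\<lbrakk>f \<in> Arr V; g \<in> Arr V; Dom V f = u \<odot> v; y = Cod V g; u \<in> Obj V; v \<in> Obj V\<rbrakk>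
    \<Longrightarrow> (u \<rhd> v \<rhd> g) \<Zsemi> act2 u v f y = act2 u v f (Dom V g) \<Zsemi> (Cod V f \<rhd> g)"
  by (simp add: act2_lact)

text \<open>
  Together these rewrite to a normal form in which the families \<open>act1\<close> and \<open>act2\<close> on outer factors
  come before arrows on inner factors, and the families \<open>act0\<close> come last.
\<close>

lemmas lact_act_base = act0_lact lact_act1 lact_act2 Assoc_nat3 Assoc_inv_nat3
lemmas lact_act_lact = lact_act_base[THEN lact_eq_lact]
lemmas lact_act_lact_lact = lact_act_lact[THEN lact_eq_lact]

lemmas lact_act = lact_act_base lact_act_base[THEN Seq_eq_Seq]
  lact_act_lact lact_act_lact[THEN Seq_eq_Seq]
  lact_act_lact_lact lact_act_lact_lact[THEN Seq_eq_Seq]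

section \<open>Coherence of associators and unitors\<close>

lemma pentagon':
  "\<lbrakk>u \<in> Obj V; v \<in> Obj V; w \<in> Obj V; x \<in> Obj V\<rbrakk>
    \<Longrightarrow> \<alpha> (u \<odot> v) w x \<Zsemi> \<alpha> u v (w \<odot> x) = act1 (\<alpha> u v w) x \<Zsemi> (\<alpha> u (v \<odot> w) x \<Zsemi> (u \<rhd> \<alpha> v w x))"
  using pentagon[of u v w x] by (simp add: act1_def lact_def)

lemma triangle': "\<lbrakk>u \<in> Obj V; v \<in> Obj V\<rbrakk> \<Longrightarrow> \<alpha> u \<one> v \<Zsemi> (u \<rhd> \<lambda>\<^sub>V v) = act1 (\<rho> u) v"
  using triangle[of u v] by (simp add: act1_def lact_def)

text \<open>Naturality of \<open>\<rho>\<close> identifies tensoring with \<one> on the right with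
  the identity functor, so it is faithful. This is why families may be compared at \<one>.\<close>

lemma act1_inject:
  assumes "act1 f \<one> = act1 g \<one>" "f \<in> Arr V" "g \<in> Arr V" "Dom V g = Dom V f" "Cod V g = Cod V f"
  shows "f = g"
proof (rule iso_cancel_left)
  show "\<rho> (Dom V f) \<Zsemi> f = \<rho> (Dom V f) \<Zsemi> g"
    using assms RUnit_nat[of f] RUnit_nat[of g] by simp
qed (use assms in auto)

lemma lact_Unit_inject:
  assumes "\<one> \<rhd> f = \<one> \<rhd> g" "f \<in> Arr V" "g \<in> Arr V" "Dom V g = Dom V f" "Cod V g = Cod V f"
  shows "f = g"
proof (rule iso_cancel_left)
  show "\<lambda>\<^sub>V (Dom V f) \<Zsemi> f = \<lambda>\<^sub>V (Dom V f) \<Zsemi> g"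
    using assms LUnit_nat[of f] LUnit_nat[of g] by simp
qed (use assms in auto)

text \<open>Kelly's derivation of this coherence from pentagon and triangle. By
  \<open>lact_Unit_inject\<close> it suffices to compare after \<open>\<one> \<rhd> _\<close>;
  behind two associators, the pentagon for \<open>\<one>\<close>, \<open>\<one>\<close>,
  \<open>u\<close>, \<open>v\<close> brings both sides to instances of the triangle.\<close>

lemma Assoc_LUnit:
  assumes "u \<in> Obj V" "v \<in> Obj V"
  shows "\<alpha> \<one> u v \<Zsemi> \<lambda>\<^sub>V (u \<odot> v) = act1 (\<lambda>\<^sub>V u) v"
proof (rule lact_Unit_inject)
  show "\<one> \<rhd> (\<alpha> \<one> u v \<Zsemi> \<lambda>\<^sub>V (u \<odot> v)) = \<one> \<rhd> act1 (\<lambda>\<^sub>V u) v"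
  proof (rule iso_cancel_left[of "\<alpha> \<one> (\<one> \<odot> u) v"], rule iso_cancel_left[of "act1 (\<alpha> \<one> \<one> u) v"])
    have "act1 (\<alpha> \<one> \<one> u) v \<Zsemi> (\<alpha> \<one> (\<one> \<odot> u) v \<Zsemi> (\<one> \<rhd> (\<alpha> \<one> u v \<Zsemi> \<lambda>\<^sub>V (u \<odot> v))))
      = \<alpha> (\<one> \<odot> \<one>) u v \<Zsemi> (\<alpha> \<one> \<one> (u \<odot> v) \<Zsemi> (\<one> \<rhd> \<lambda>\<^sub>V (u \<odot> v)))"
      using assms pentagon'[of \<one> \<one> u v, THEN Seq_eq_Seq, of "\<one> \<rhd> \<lambda>\<^sub>V (u \<odot> v)"] by simp
    also have "\<dots> = act1 (act1 (\<rho> \<one>) u) v \<Zsemi> \<alpha> \<one> u v"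
      using assms Assoc_nat1[of "\<rho> \<one>" u v] by (simp add: triangle')
    also have "\<dots> = act1 (\<alpha> \<one> \<one> u) v \<Zsemi> (act1 (\<one> \<rhd> \<lambda>\<^sub>V u) v \<Zsemi> \<alpha> \<one> u v)"
      using assms by (simp flip: triangle')
    also have "\<dots> = act1 (\<alpha> \<one> \<one> u) v \<Zsemi> (\<alpha> \<one> (\<one> \<odot> u) v \<Zsemi> (\<one> \<rhd> act1 (\<lambda>\<^sub>V u) v))"
      using assms Assoc_nat2[of "\<lambda>\<^sub>V u" \<one> v] by simp
    finally show "act1 (\<alpha> \<one> \<one> u) v \<Zsemi> (\<alpha> \<one> (\<one> \<odot> u) v \<Zsemi> (\<one> \<rhd> (\<alpha> \<one> u v \<Zsemi> \<lambda>\<^sub>V (u \<odot> v))))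
      = act1 (\<alpha> \<one> \<one> u) v \<Zsemi> (\<alpha> \<one> (\<one> \<odot> u) v \<Zsemi> (\<one> \<rhd> act1 (\<lambda>\<^sub>V u) v))" .
  qed (use assms in simp_all)
qed (use assms in simp_all)

lemma Assoc_inv_LUnit:
  assumes "u \<in> Obj V" "v \<in> Obj V"
  shows "\<i>\<n>\<v> (\<alpha> \<one> u v) \<Zsemi> act1 (\<lambda>\<^sub>V u) v = \<lambda>\<^sub>V (u \<odot> v)"
    and "act1 (\<i>\<n>\<v> (\<lambda>\<^sub>V u)) v \<Zsemi> \<alpha> \<one> u v = \<i>\<n>\<v> (\<lambda>\<^sub>V (u \<odot> v))"
proof -
  show "\<i>\<n>\<v> (\<alpha> \<one> u v) \<Zsemi> act1 (\<lambda>\<^sub>V u) v = \<lambda>\<^sub>V (u \<odot> v)"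
    using assms by (simp flip: Assoc_LUnit)
  show "act1 (\<i>\<n>\<v> (\<lambda>\<^sub>V u)) v \<Zsemi> \<alpha> \<one> u v = \<i>\<n>\<v> (\<lambda>\<^sub>V (u \<odot> v))"
    by (rule iso_cancel_right[of _ "\<lambda>\<^sub>V (u \<odot> v)"]) (use assms in \<open>simp_all add: Assoc_LUnit\<close>)
qed

lemma Assoc_inv_RUnit:
  assumes "u \<in> Obj V" "v \<in> Obj V"
  shows "\<i>\<n>\<v> (\<alpha> u \<one> v) \<Zsemi> act1 (\<rho> u) v = u \<rhd> \<lambda>\<^sub>V v"
    and "act1 (\<i>\<n>\<v> (\<rho> u)) v \<Zsemi> \<alpha> u \<one> v = u \<rhd> \<i>\<n>\<v> (\<lambda>\<^sub>V v)"
proof -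
  show "\<i>\<n>\<v> (\<alpha> u \<one> v) \<Zsemi> act1 (\<rho> u) v = u \<rhd> \<lambda>\<^sub>V v"
    using assms by (simp flip: triangle')
  show "act1 (\<i>\<n>\<v> (\<rho> u)) v \<Zsemi> \<alpha> u \<one> v = u \<rhd> \<i>\<n>\<v> (\<lambda>\<^sub>V v)"
    by (rule iso_cancel_right[of _ "u \<rhd> \<lambda>\<^sub>V v"]) (use assms in \<open>simp_all add: triangle'\<close>)
qed

text \<open>The left side is the prefix of a family nested in a right factor, the right side the
  prefix of two successive families; \<open>lact_act2_act2\<close> compares them through this
  equation.\<close>

lemma pentagon_inv:
  assumes "u \<in> Obj V" "v \<in> Obj V" "w \<in> Obj V" "x \<in> Obj V"
  shows "(u \<rhd> \<i>\<n>\<v> (\<alpha> v w x)) \<Zsemi> (\<i>\<n>\<v> (\<alpha> u (v \<odot> w) x) \<Zsemi> act1 (\<i>\<n>\<v> (\<alpha> u v w)) x)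
    = \<i>\<n>\<v> (\<alpha> u v (w \<odot> x)) \<Zsemi> \<i>\<n>\<v> (\<alpha> (u \<odot> v) w x)"
proof (rule iso_cancel_left[of "\<alpha> u v (w \<odot> x)"], rule iso_cancel_left[of "\<alpha> (u \<odot> v) w x"])
  show "\<alpha> (u \<odot> v) w x \<Zsemi> (\<alpha> u v (w \<odot> x) \<Zsemi> ((u \<rhd> \<i>\<n>\<v> (\<alpha> v w x)) \<Zsemi> (\<i>\<n>\<v> (\<alpha> u (v \<odot> w) x) \<Zsemi> act1 (\<i>\<n>\<v> (\<alpha> u v w)) x)))
    = \<alpha> (u \<odot> v) w x \<Zsemi> (\<alpha> u v (w \<odot> x) \<Zsemi> (\<i>\<n>\<v> (\<alpha> u v (w \<odot> x)) \<Zsemi> \<i>\<n>\<v> (\<alpha> (u \<odot> v) w x)))"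
    using assms pentagon'[of u v w x, THEN Seq_eq_Seq,
       of "(u \<rhd> \<i>\<n>\<v> (\<alpha> v w x)) \<Zsemi> (\<i>\<n>\<v> (\<alpha> u (v \<odot> w) x) \<Zsemi> act1 (\<i>\<n>\<v> (\<alpha> u v w)) x)"] by simp
qed (use assms in simp_all)

lemma act2_eq: "act2 u v f x = \<i>\<n>\<v> (\<alpha> u v x) \<Zsemi> act1 f x"
  by (simp add: act1_def act2_def)

lemma act0_eq: "act0 j x = \<i>\<n>\<v> (\<lambda>\<^sub>V x) \<Zsemi> act1 j x"
  by (simp add: act1_def act0_def)

lemma act2_inject:
  assumes "act2 u v f \<one> = act2 u v g \<one>" "f \<in> Arr V" "g \<in> Arr V" "Dom V f = u \<odot> v" "Dom V g = u \<odot> v"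
    "Cod V g = Cod V f" "u \<in> Obj V" "v \<in> Obj V"
  shows "f = g"
proof (rule act1_inject)
  show "act1 f \<one> = act1 g \<one>"
    by (rule iso_cancel_left[of "\<i>\<n>\<v> (\<alpha> u v \<one>)"])
      (use assms iso_inv in \<open>auto simp flip: act2_eq\<close>)
qed (use assms in auto)

lemma act0_inject:
  assumes "act0 f \<one> = act0 g \<one>" "f \<in> Arr V" "g \<in> Arr V" "Dom V f = \<one>" "Dom V g = \<one>"
    "Cod V g = Cod V f"
  shows "f = g"
proof (rule act1_inject)
  show "act1 f \<one> = act1 g \<one>"
    by (rule iso_cancel_left[of "\<i>\<n>\<v> (\<lambda>\<^sub>V \<one>)"])
      (use assms iso_inv in \<open>auto simp flip: act0_eq\<close>)
qed (use assms in auto)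

section \<open>Composites of families as single arrows tensored with \<open>x\<close>\<close>

lemma act2_act1_lact:
  assumes "f \<in> Arr V" "Dom V f = v \<odot> t" "g \<in> Arr V" "Dom V g = u \<odot> Cod V f"
    "u \<in> Obj V" "v \<in> Obj V" "t \<in> Obj V" "x \<in> Obj V" "w = Cod V f"
  shows "(u \<rhd> act2 v t f x) \<Zsemi> act2 u w g x
    = (u \<rhd> \<i>\<n>\<v> (\<alpha> v t x)) \<Zsemi> (\<i>\<n>\<v> (\<alpha> u (v \<odot> t) x) \<Zsemi> act1 ((u \<rhd> f) \<Zsemi> g) x)"
  using assms Assoc_inv_nat2[of f u x, THEN Seq_eq_Seq, of "act1 g x"] by (simp add: act2_eq)

text \<open>Both bracketings of a threefold product fuse with the same isomorphisms in front, here
  and in \<open>lact_act2_act2\<close>. Hence associativity of arrows up to \<open>\<alpha>\<close>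
  amounts to strict associativity of their families.\<close>

lemma act2_act2:
  assumes "f \<in> Arr V" "Dom V f = u \<odot> v" "g \<in> Arr V" "Dom V g = Cod V f \<odot> t"
    "u \<in> Obj V" "v \<in> Obj V" "t \<in> Obj V" "x \<in> Obj V" "w = Cod V f"
  shows "act2 u v f (t \<odot> x) \<Zsemi> act2 w t g x
    = \<i>\<n>\<v> (\<alpha> u v (t \<odot> x)) \<Zsemi> (\<i>\<n>\<v> (\<alpha> (u \<odot> v) t x) \<Zsemi> act1 (act1 f t \<Zsemi> g) x)"
  using assms Assoc_inv_nat1[of f t x, THEN Seq_eq_Seq, of "act1 g x"] by (simp add: act2_eq)

lemma act2_lact_Seq:
  assumes "h \<in> Arr V" "g \<in> Arr V" "Dom V h = v" "Cod V h = w" "Dom V g = u \<odot> w" "u \<in> Obj V" "x \<in> Obj V"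
  shows "act2 u v ((u \<rhd> h) \<Zsemi> g) x = (u \<rhd> act1 h x) \<Zsemi> act2 u w g x"
  using assms Dom_Obj[OF assms(1)] Cod_Obj[OF assms(1)] Assoc_inv_nat2[of h u x, THEN Seq_eq_Seq, of "act1 g x"]
  by (simp add: act2_eq)

lemma act2_act1_Seq:
  assumes "h \<in> Arr V" "g \<in> Arr V" "Dom V h = u" "Cod V h = w" "Dom V g = w \<odot> v" "v \<in> Obj V" "x \<in> Obj V"
  shows "act2 u v (act1 h v \<Zsemi> g) x = act1 h (v \<odot> x) \<Zsemi> act2 w v g x"
  using assms Dom_Obj[OF assms(1)] Cod_Obj[OF assms(1)] Assoc_inv_nat1[of h v x, THEN Seq_eq_Seq, of "act1 g x"]
  by (simp add: act2_eq)

lemma lact_act2_act2: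
  assumes "h \<in> Arr V" "Dom V h = v \<odot> t" "k \<in> Arr V" "Dom V k = u \<odot> Cod V h"
    "u \<in> Obj V" "v \<in> Obj V" "t \<in> Obj V" "x \<in> Obj V" "w = Cod V h"
  shows "(u \<rhd> act2 v t h x) \<Zsemi> act2 u w k x
    = \<i>\<n>\<v> (\<alpha> u v (t \<odot> x)) \<Zsemi> (\<i>\<n>\<v> (\<alpha> (u \<odot> v) t x) \<Zsemi> act1 (\<alpha> u v t \<Zsemi> ((u \<rhd> h) \<Zsemi> k)) x)"
  using assms pentagon_inv[of u v t x, THEN Seq_eq_Seq3, of "act1 (\<alpha> u v t \<Zsemi> ((u \<rhd> h) \<Zsemi> k)) x"]
  by (simp add: act2_act1_lact)

text \<open>For the left unit law: when \<open>act1 j c \<Zsemi> m\<close> is the unitor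
  \<open>\<lambda>\<^sub>V c\<close>, the right side is an identity by
  \<open>inv_LUnit_act1_LUnit\<close>. The next lemma serves the right unit law in the same
  way.\<close>

lemma act0_act2:
  assumes "j \<in> Arr V" "Dom V j = \<one>" "m \<in> Arr V" "Dom V m = Cod V j \<odot> c" "c \<in> Obj V"
    "w = Cod V j" "x \<in> Obj V"
  shows "act0 j (c \<odot> x) \<Zsemi> act2 w c m x
    = \<i>\<n>\<v> (\<lambda>\<^sub>V (c \<odot> x)) \<Zsemi> (\<i>\<n>\<v> (\<alpha> \<one> c x) \<Zsemi> act1 (act1 j c \<Zsemi> m) x)"
  using assms Assoc_inv_nat1[of j c x, THEN Seq_eq_Seq, of "act1 m x"]
  by (simp add: act2_eq act0_eq)

lemma lact_act0_act2:
  assumes "j \<in> Arr V" "Dom V j = \<one>" "m \<in> Arr V" "Dom V m = c \<odot> Cod V j" "c \<in> Obj V"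
    "w = Cod V j" "x \<in> Obj V"
  shows "(c \<rhd> act0 j x) \<Zsemi> act2 c w m x
    = (c \<rhd> \<i>\<n>\<v> (\<lambda>\<^sub>V x)) \<Zsemi> (\<i>\<n>\<v> (\<alpha> c \<one> x) \<Zsemi> act1 ((c \<rhd> j) \<Zsemi> m) x)"
  using assms Assoc_inv_nat2[of j c x, THEN Seq_eq_Seq, of "act1 m x"]
  by (simp add: act2_eq act0_eq)

lemma inv_LUnit_act1_LUnit:
  "\<lbrakk>c \<in> Obj V; x \<in> Obj V\<rbrakk> \<Longrightarrow> \<i>\<n>\<v> (\<lambda>\<^sub>V (c \<odot> x)) \<Zsemi> (\<i>\<n>\<v> (\<alpha> \<one> c x) \<Zsemi> act1 (\<lambda>\<^sub>V c) x) = \<i>\<d> (c \<odot> x)"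
  by (simp add: Assoc_inv_LUnit)

lemma inv_LUnit_act1_RUnit:
  "\<lbrakk>c \<in> Obj V; x \<in> Obj V\<rbrakk> \<Longrightarrow> (c \<rhd> \<i>\<n>\<v> (\<lambda>\<^sub>V x)) \<Zsemi> (\<i>\<n>\<v> (\<alpha> c \<one> x) \<Zsemi> act1 (\<rho> c) x) = \<i>\<d> (c \<odot> x)"
  by (simp add: Assoc_inv_RUnit)

lemma pentagon_inv1:
  assumes "u \<in> Obj V" "v \<in> Obj V" "w \<in> Obj V" "x \<in> Obj V"
  shows "\<i>\<n>\<v> (\<alpha> (u \<odot> v) w x) \<Zsemi> act1 (\<alpha> u v w) x
    = \<alpha> u v (w \<odot> x) \<Zsemi> ((u \<rhd> \<i>\<n>\<v> (\<alpha> v w x)) \<Zsemi> \<i>\<n>\<v> (\<alpha> u (v \<odot> w) x))"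
  using assms arg_cong[OF pentagon_inv[OF assms], of "\<lambda>f. \<alpha> u v (w \<odot> x) \<Zsemi> (f \<Zsemi> act1 (\<alpha> u v w) x)"]
  by simp

lemma pentagon_inv2:
  assumes "u \<in> Obj V" "v \<in> Obj V" "w \<in> Obj V" "x \<in> Obj V"
  shows "\<i>\<n>\<v> (\<alpha> u (v \<odot> w) x) \<Zsemi> (act1 (\<i>\<n>\<v> (\<alpha> u v w)) x \<Zsemi> \<alpha> (u \<odot> v) w x)
    = (u \<rhd> \<alpha> v w x) \<Zsemi> \<i>\<n>\<v> (\<alpha> u v (w \<odot> x))"
  using assms arg_cong[OF pentagon_inv[OF assms], of "\<lambda>f. (u \<rhd> \<alpha> v w x) \<Zsemi> (f \<Zsemi> \<alpha> (u \<odot> v) w x)"]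
  by simp

text \<open>
  \<open>e x : u (H x) \<rightarrow> \<dots>\<close> detects \<open>H\<close> if an arrow into \<open>H\<close> is determined by what \<open>e\<close> makes of it. The two
  instances are evaluation, for \<open>H = [u, v]\<close>, and composition with the unit of a tensor.
\<close>

definition detects :: "'o \<Rightarrow> 'o \<Rightarrow> ('o \<Rightarrow> 'm) \<Rightarrow> bool" where
  "detects u H e \<longleftrightarrow> u \<in> Obj V \<and> H \<in> Obj V \<and> e \<one> \<in> Arr V \<and> Dom V (e \<one>) = u \<odot> (H \<odot> \<one>)
    \<and> (\<forall>h h'. h \<in> Arr V \<longrightarrow> h' \<in> Arr V \<longrightarrow> Dom V h' = Dom V h \<longrightarrow> Cod V h = H \<longrightarrow> Cod V h' = H
      \<longrightarrow> (u \<rhd> act1 h \<one>) \<Zsemi> e \<one> = (u \<rhd> act1 h' \<one>) \<Zsemi> e \<one> \<longrightarrow> h = h')"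

text \<open>\<open>p\<close> stands for the associators and unitors that separate a family from
  \<open>act1\<close> of its arrow. Being invertible it cancels, so equations of families can be fed
  in as they are.\<close>

lemma detectsD:
  assumes "detects u H e" "(u \<rhd> (p \<Zsemi> act1 l \<one>)) \<Zsemi> e \<one> = (u \<rhd> (p \<Zsemi> act1 r \<one>)) \<Zsemi> e \<one>"
    "is_iso V p" "Cod V p = w \<odot> \<one>" "l \<in> Arr V" "r \<in> Arr V" "Dom V l = w" "Dom V r = w"
    "Cod V l = H" "Cod V r = H"
  shows "l = r"
proof -
  have "(u \<rhd> p) \<Zsemi> ((u \<rhd> act1 l \<one>) \<Zsemi> e \<one>) = (u \<rhd> p) \<Zsemi> ((u \<rhd> act1 r \<one>) \<Zsemi> e \<one>)"
    using assms iso_Arr[OF assms(3)] by (simp add: detects_def)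
  then have "(u \<rhd> act1 l \<one>) \<Zsemi> e \<one> = (u \<rhd> act1 r \<one>) \<Zsemi> e \<one>"
    by (rule iso_cancel_left) (use assms iso_Arr[OF assms(3)] in \<open>simp_all add: detects_def\<close>)
  then show ?thesis
    using assms by (simp add: detects_def)
qed

lemma detects_iso:
  assumes e: "detects u H e" and k: "is_iso V (k \<one>)" "Dom V (k \<one>) = Cod V (e \<one>)"
  shows "detects u H (\<lambda>x. e x \<Zsemi> k x)"
  unfolding detects_def
proof (intro conjI allI impI)
  fix h h'
  assume h: "h \<in> Arr V" "h' \<in> Arr V" "Dom V h' = Dom V h" "Cod V h = H" "Cod V h' = H"
    and "(u \<rhd> act1 h \<one>) \<Zsemi> (e \<one> \<Zsemi> k \<one>) = (u \<rhd> act1 h' \<one>) \<Zsemi> (e \<one> \<Zsemi> k \<one>)"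
  then have "((u \<rhd> act1 h \<one>) \<Zsemi> e \<one>) \<Zsemi> k \<one> = ((u \<rhd> act1 h' \<one>) \<Zsemi> e \<one>) \<Zsemi> k \<one>"
    using e k iso_Arr[OF k(1)] by (simp add: detects_def)
  then have "(u \<rhd> act1 h \<one>) \<Zsemi> e \<one> = (u \<rhd> act1 h' \<one>) \<Zsemi> e \<one>"
    by (rule iso_cancel_right) (use e k h in \<open>simp_all add: detects_def\<close>)
  then show "h = h'"
    using e h by (simp add: detects_def)
qed (use e k iso_Arr[OF k(1)] in \<open>simp_all add: detects_def\<close>)

section \<open>Enriched categories and functors\<close>

abbreviation id_act :: "('o, 'm, 'a) vcategory \<Rightarrow> 'a \<Rightarrow> 'o \<Rightarrow> 'm" where
  "id_act C a x \<equiv> act0 (VId C a) x"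

abbreviation comp_act :: "('o, 'm, 'a) vcategory \<Rightarrow> 'a \<Rightarrow> 'a \<Rightarrow> 'a \<Rightarrow> 'o \<Rightarrow> 'm" where
  "comp_act C a b c x \<equiv> act2 (VHom C a b) (VHom C b c) (VComp C a b c) x"

text \<open>Arrows into an internal hom are known only through evaluation. The axioms are therefore
  required after \<open>e\<close> and in strict form: the fusion lemmas restore associators and
  unitors, and \<open>detects\<close> removes \<open>e\<close>.\<close>

lemma v_categoryI:
  fixes C :: "('o, 'm, 'a) vcategory"
  assumes H: "\<And>a b. \<lbrakk>a \<in> VObj C; b \<in> VObj C\<rbrakk> \<Longrightarrow> VHom C a b \<in> Obj V"
    and I: "\<And>a. a \<in> VObj C \<Longrightarrow> VId C a \<in> hom V \<one> (VHom C a a)"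
    and K: "\<And>a b c. \<lbrakk>a \<in> VObj C; b \<in> VObj C; c \<in> VObj C\<rbrakk>
      \<Longrightarrow> VComp C a b c \<in> hom V (VHom C a b \<odot> VHom C b c) (VHom C a c)"
    and det: "\<And>a b. \<lbrakk>a \<in> VObj C; b \<in> VObj C\<rbrakk> \<Longrightarrow> detects (s a) (VHom C a b) (e a b)"
    and assoc: "\<And>a b c d x. \<lbrakk>a \<in> VObj C; b \<in> VObj C; c \<in> VObj C; d \<in> VObj C; x \<in> Obj V\<rbrakk>
      \<Longrightarrow> (s a \<rhd> (comp_act C a b c (VHom C c d \<odot> x) \<Zsemi> comp_act C a c d x)) \<Zsemi> e a d x
        = (s a \<rhd> ((VHom C a b \<rhd> comp_act C b c d x) \<Zsemi> comp_act C a b d x)) \<Zsemi> e a d x"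
    and left: "\<And>a b x. \<lbrakk>a \<in> VObj C; b \<in> VObj C; x \<in> Obj V\<rbrakk>
      \<Longrightarrow> (s a \<rhd> (id_act C a (VHom C a b \<odot> x) \<Zsemi> comp_act C a a b x)) \<Zsemi> e a b x = e a b x"
    and right: "\<And>a b x. \<lbrakk>a \<in> VObj C; b \<in> VObj C; x \<in> Obj V\<rbrakk>
      \<Longrightarrow> (s a \<rhd> ((VHom C a b \<rhd> id_act C b x) \<Zsemi> comp_act C a b b x)) \<Zsemi> e a b x = e a b x"
  shows "v_category V C"
proof
  fix a b c d
  assume abcd: "a \<in> VObj C" "b \<in> VObj C" "c \<in> VObj C" "d \<in> VObj C"
  show "VHom C a b \<in> Obj V" "VId C a \<in> hom V \<one> (VHom C a a)"
    "VComp C a b c \<in> hom V (VHom C a b \<odot> VHom C b c) (VHom C a c)"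
    by (simp_all add: H I K abcd)
  note K' [simp] = K[unfolded hom_iff, THEN conjunct1] K[unfolded hom_iff, THEN conjunct2, THEN conjunct1]
    K[unfolded hom_iff, THEN conjunct2, THEN conjunct2]
  note I' [simp] = I[unfolded hom_iff, THEN conjunct1] I[unfolded hom_iff, THEN conjunct2, THEN conjunct1]
    I[unfolded hom_iff, THEN conjunct2, THEN conjunct2]
  note H [simp] abcd [simp]
  let ?u = "VHom C a b" and ?v = "VHom C b c" and ?t = "VHom C c d"
  have "act1 (VComp C a b c) ?t \<Zsemi> VComp C a c d = \<alpha> ?u ?v ?t \<Zsemi> ((?u \<rhd> VComp C b c d) \<Zsemi> VComp C a b d)"
  proof (rule detectsD[OF det])
    show "(s a \<rhd> ((\<i>\<n>\<v> (\<alpha> ?u ?v (?t \<odot> \<one>)) \<Zsemi> \<i>\<n>\<v> (\<alpha> (?u \<odot> ?v) ?t \<one>))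
          \<Zsemi> act1 (act1 (VComp C a b c) ?t \<Zsemi> VComp C a c d) \<one>)) \<Zsemi> e a d \<one>
      = (s a \<rhd> ((\<i>\<n>\<v> (\<alpha> ?u ?v (?t \<odot> \<one>)) \<Zsemi> \<i>\<n>\<v> (\<alpha> (?u \<odot> ?v) ?t \<one>))
          \<Zsemi> act1 (\<alpha> ?u ?v ?t \<Zsemi> ((?u \<rhd> VComp C b c d) \<Zsemi> VComp C a b d)) \<one>)) \<Zsemi> e a d \<one>"
      using assoc[of a b c d \<one>]
      by (simp add: act2_act2 lact_act2_act2 del: lact_Seq act1_Seq)
  qed (simp_all add: iso_inv iso_Seq)
  then show "(VComp C a b c \<otimes> \<i>\<d> (VHom C c d)) \<Zsemi> VComp C a c d
        = \<alpha> (VHom C a b) (VHom C b c) (VHom C c d)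
            \<Zsemi> (\<i>\<d> (VHom C a b) \<otimes> VComp C b c d) \<Zsemi> VComp C a b d"
    by (simp add: act1_def lact_def)
  have "act1 (VId C a) ?u \<Zsemi> VComp C a a b = \<lambda>\<^sub>V ?u"
  proof (rule detectsD[OF det])
    show "(s a \<rhd> ((\<i>\<n>\<v> (\<lambda>\<^sub>V (?u \<odot> \<one>)) \<Zsemi> \<i>\<n>\<v> (\<alpha> \<one> ?u \<one>))
          \<Zsemi> act1 (act1 (VId C a) ?u \<Zsemi> VComp C a a b) \<one>)) \<Zsemi> e a b \<one>
      = (s a \<rhd> ((\<i>\<n>\<v> (\<lambda>\<^sub>V (?u \<odot> \<one>)) \<Zsemi> \<i>\<n>\<v> (\<alpha> \<one> ?u \<one>)) \<Zsemi> act1 (\<lambda>\<^sub>V ?u) \<one>)) \<Zsemi> e a b \<one>"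
      using left[of a b \<one>] det[of a b]
      by (simp add: act0_act2 inv_LUnit_act1_LUnit detects_def del: lact_Seq act1_Seq)
  qed (simp_all add: iso_inv iso_Seq)
  then show "(VId C a \<otimes> \<i>\<d> (VHom C a b)) \<Zsemi> VComp C a a b = \<lambda>\<^sub>V (VHom C a b)"
    unfolding act1_def .
  have "(?u \<rhd> VId C b) \<Zsemi> VComp C a b b = \<rho> ?u"
  proof (rule detectsD[OF det])
    show "(s a \<rhd> (((?u \<rhd> \<i>\<n>\<v> (\<lambda>\<^sub>V \<one>)) \<Zsemi> \<i>\<n>\<v> (\<alpha> ?u \<one> \<one>))
          \<Zsemi> act1 ((?u \<rhd> VId C b) \<Zsemi> VComp C a b b) \<one>)) \<Zsemi> e a b \<one>
      = (s a \<rhd> (((?u \<rhd> \<i>\<n>\<v> (\<lambda>\<^sub>V \<one>)) \<Zsemi> \<i>\<n>\<v> (\<alpha> ?u \<one> \<one>)) \<Zsemi> act1 (\<rho> ?u) \<one>)) \<Zsemi> e a b \<one>"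
      using right[of a b \<one>] det[of a b]
      by (simp add: lact_act0_act2 inv_LUnit_act1_RUnit detects_def del: lact_Seq act1_Seq)
  qed (simp_all add: iso_inv iso_Seq)
  then show "(\<i>\<d> (VHom C a b) \<otimes> VId C b) \<Zsemi> VComp C a b b = \<rho> (VHom C a b)"
    unfolding lact_def .
qed

end

context v_category
begin

lemma VHom_Obj [simp]: "\<lbrakk>a \<in> VObj C; b \<in> VObj C\<rbrakk> \<Longrightarrow> VHom C a b \<in> Obj V"
  by (rule VHom_closed)

lemma VId_typing [simp]:
  assumes "a \<in> VObj C"
  shows "VId C a \<in> Arr V" "Dom V (VId C a) = \<one>" "Cod V (VId C a) = VHom C a a"
  using VId_hom[OF assms] by (auto simp: hom_iff)

lemma VComp_typing [simp]:
  assumes "a \<in> VObj C" "b \<in> VObj C" "c \<in> VObj C"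
  shows "VComp C a b c \<in> Arr V" "Dom V (VComp C a b c) = VHom C a b \<odot> VHom C b c"
    "Cod V (VComp C a b c) = VHom C a c"
  using VComp_hom[OF assms] by (auto simp: hom_iff)

lemma comp_act_assoc:
  assumes "a \<in> VObj C" "b \<in> VObj C" "c \<in> VObj C" "d \<in> VObj C" "x \<in> Obj V"
  shows "comp_act C a b c (VHom C c d \<odot> x) \<Zsemi> comp_act C a c d x
        = (VHom C a b \<rhd> comp_act C b c d x) \<Zsemi> comp_act C a b d x"
proof -
  have "act1 (VComp C a b c) (VHom C c d) \<Zsemi> VComp C a c d =
     \<alpha> (VHom C a b) (VHom C b c) (VHom C c d) \<Zsemi> ((VHom C a b \<rhd> VComp C b c d) \<Zsemi> VComp C a b d)"
    using VComp_assoc[of a b c d] assms by (simp add: act1_def lact_def)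
  then show ?thesis
    using assms by (simp add: act2_act2 lact_act2_act2 del: act1_Seq)
qed

lemma id_act_comp_act:
  assumes "a \<in> VObj C" "b \<in> VObj C" "x \<in> Obj V"
  shows "id_act C a (VHom C a b \<odot> x) \<Zsemi> comp_act C a a b x = \<i>\<d> (VHom C a b \<odot> x)"
  using VComp_VId_left[OF assms(1,2), folded act1_def] assms
  by (simp add: act0_act2 inv_LUnit_act1_LUnit del: act1_Seq)

lemma lact_id_act_comp_act:
  assumes "a \<in> VObj C" "b \<in> VObj C" "x \<in> Obj V"
  shows "(VHom C a b \<rhd> id_act C b x) \<Zsemi> comp_act C a b b x = \<i>\<d> (VHom C a b \<odot> x)"
  using VComp_VId_right[OF assms(1,2), folded lact_def] assms
  by (simp add: lact_act0_act2 inv_LUnit_act1_RUnit del: act1_Seq)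

text \<open>Associativity is used from right to left: composing the outer factors first agrees with
  the normal form of \<open>lact_act\<close>.\<close>

lemmas v_cat_base = comp_act_assoc[symmetric] id_act_comp_act lact_id_act_comp_act
lemmas v_cat_lact = v_cat_base[THEN lact_eq_lact]

lemmas v_cat_simps = v_cat_base v_cat_base[THEN Seq_eq_Seq] v_cat_lact v_cat_lact[THEN Seq_eq_Seq]

end

context monoidal_category
begin

lemma act2_comp_act_FMap:
  assumes "v_functor V C D F" "a \<in> VObj C" "b \<in> VObj C" "c \<in> VObj C" "x \<in> Obj V"
  shows "comp_act C a b c x \<Zsemi> act1 (FMap F a c) x
    = act2 (VHom C a b) (VHom C b c) (VComp C a b c \<Zsemi> FMap F a c) x" (is ?t1)
  and "(VHom C a b \<rhd> act1 (FMap F b c) x) \<Zsemi> (act1 (FMap F a b) (VHom D (FObj F b) (FObj F c) \<odot> x)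
      \<Zsemi> comp_act D (FObj F a) (FObj F b) (FObj F c) x)
    = act2 (VHom C a b) (VHom C b c)
      ((FMap F a b \<otimes> FMap F b c) \<Zsemi> VComp D (FObj F a) (FObj F b) (FObj F c)) x" (is ?t2)
proof -
  interpret v_functor V C D F
    by fact
  show ?t1
    using assms FMap_hom by (simp add: act2_Seq hom_iff)
  show ?t2
    using assms FObj_closed FMap_hom
    by (simp add: hom_iff TenA_eq act2_lact_Seq act2_act1_Seq)
qed

text \<open>Counterpart of \<open>v_categoryI\<close>: both functor laws are equations of arrows
  into hom objects of \<open>D\<close>, so these are the objects to detect.\<close>

lemma v_functorI:
  assumes C: "v_category V C" and D: "v_category V D"
    and O: "\<And>a. a \<in> VObj C \<Longrightarrow> FObj F a \<in> VObj D"
    and M: "\<And>a b. \<lbrakk>a \<in> VObj C; b \<in> VObj C\<rbrakk>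
      \<Longrightarrow> FMap F a b \<in> hom V (VHom C a b) (VHom D (FObj F a) (FObj F b))"
    and det: "\<And>a b. \<lbrakk>a \<in> VObj C; b \<in> VObj C\<rbrakk>
      \<Longrightarrow> detects (s a) (VHom D (FObj F a) (FObj F b)) (e a b)"
    and comp: "\<And>a b c x. \<lbrakk>a \<in> VObj C; b \<in> VObj C; c \<in> VObj C; x \<in> Obj V\<rbrakk>
      \<Longrightarrow> (s a \<rhd> (comp_act C a b c x \<Zsemi> act1 (FMap F a c) x)) \<Zsemi> e a c x
        = (s a \<rhd> ((VHom C a b \<rhd> act1 (FMap F b c) x)
            \<Zsemi> (act1 (FMap F a b) (VHom D (FObj F b) (FObj F c) \<odot> x)
              \<Zsemi> comp_act D (FObj F a) (FObj F b) (FObj F c) x))) \<Zsemi> e a c x"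
    and ident: "\<And>a x. \<lbrakk>a \<in> VObj C; x \<in> Obj V\<rbrakk>
      \<Longrightarrow> (s a \<rhd> (id_act C a x \<Zsemi> act1 (FMap F a a) x)) \<Zsemi> e a a x = (s a \<rhd> id_act D (FObj F a) x) \<Zsemi> e a a x"
  shows "v_functor V C D F"
proof -
  interpret C: v_category V C
    by (rule C)
  interpret D: v_category V D
    by (rule D)
  note M' [simp] = M[unfolded hom_iff, THEN conjunct1] M[unfolded hom_iff, THEN conjunct2, THEN conjunct1]
    M[unfolded hom_iff, THEN conjunct2, THEN conjunct2]
  note O [simp]
  show ?thesis
  proof
    fix a b c
    assume abc [simp]: "a \<in> VObj C" "b \<in> VObj C" "c \<in> VObj C"
    show "FObj F a \<in> VObj D" "FMap F a b \<in> hom V (VHom C a b) (VHom D (FObj F a) (FObj F b))"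
      by (simp_all add: M)
    let ?u = "VHom C a b" and ?v = "VHom C b c"
    show "VComp C a b c \<Zsemi> FMap F a c
        = (FMap F a b \<otimes> FMap F b c) \<Zsemi> VComp D (FObj F a) (FObj F b) (FObj F c)" (is "?l = ?r")
    proof (rule detectsD[OF det])
      have "act2 ?u ?v ?l \<one> = comp_act C a b c \<one> \<Zsemi> act1 (FMap F a c) \<one>"
        by (simp add: act2_Seq)
      moreover have "act2 ?u ?v ?r \<one> = (VHom C a b \<rhd> act1 (FMap F b c) \<one>)
          \<Zsemi> (act1 (FMap F a b) (VHom D (FObj F b) (FObj F c) \<odot> \<one>)
            \<Zsemi> comp_act D (FObj F a) (FObj F b) (FObj F c) \<one>)"
        by (simp add: TenA_eq act2_lact_Seq act2_act1_Seq)
      ultimately have "(s a \<rhd> act2 ?u ?v ?l \<one>) \<Zsemi> e a c \<one> = (s a \<rhd> act2 ?u ?v ?r \<one>) \<Zsemi> e a c \<one>"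
        using comp[of a b c \<one>] by simp
      then show "(s a \<rhd> (\<i>\<n>\<v> (\<alpha> ?u ?v \<one>) \<Zsemi> act1 ?l \<one>)) \<Zsemi> e a c \<one>
        = (s a \<rhd> (\<i>\<n>\<v> (\<alpha> ?u ?v \<one>) \<Zsemi> act1 ?r \<one>)) \<Zsemi> e a c \<one>"
        unfolding act2_eq .
    qed (simp_all add: iso_inv)
    show "VId C a \<Zsemi> FMap F a a = VId D (FObj F a)"
    proof (rule detectsD[OF det])
      show "(s a \<rhd> (\<i>\<n>\<v> (\<lambda>\<^sub>V \<one>) \<Zsemi> act1 (VId C a \<Zsemi> FMap F a a) \<one>)) \<Zsemi> e a a \<one>
        = (s a \<rhd> (\<i>\<n>\<v> (\<lambda>\<^sub>V \<one>) \<Zsemi> act1 (VId D (FObj F a)) \<one>)) \<Zsemi> e a a \<one>"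
        using ident[of a \<one>] unfolding act0_eq[symmetric] by (simp del: lact_Seq)
    qed (simp_all add: iso_inv)
  qed
qed

end

context v_functor
begin

lemma FObj_VObj [simp]: "a \<in> VObj C \<Longrightarrow> FObj F a \<in> VObj D"
  by (rule FObj_closed)

lemma FMap_typing [simp]:
  assumes "a \<in> VObj C" "b \<in> VObj C"
  shows "FMap F a b \<in> Arr V" "Dom V (FMap F a b) = VHom C a b"
    "Cod V (FMap F a b) = VHom D (FObj F a) (FObj F b)"
  using FMap_hom[OF assms] by (auto simp: C.hom_iff)

lemma comp_act_FMap:
  assumes "a \<in> VObj C" "b \<in> VObj C" "c \<in> VObj C" "x \<in> Obj V"
  shows "C.comp_act C a b c x \<Zsemi> C.act1 (FMap F a c) x
    = (VHom C a b \<rhd> C.act1 (FMap F b c) x) \<Zsemi> (C.act1 (FMap F a b) (VHom D (FObj F b) (FObj F c) \<odot> x)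
      \<Zsemi> C.comp_act D (FObj F a) (FObj F b) (FObj F c) x)"
  using C.act2_comp_act_FMap[OF v_functor_axioms assms] FMap_VComp assms by simp

lemma id_act_FMap:
  assumes "a \<in> VObj C" "x \<in> Obj V"
  shows "C.id_act C a x \<Zsemi> C.act1 (FMap F a a) x = C.id_act D (FObj F a) x"
  using C.act0_Seq[of x "VId C a" "FMap F a a"] assms by (simp add: FMap_VId)

lemmas v_fun_simps = comp_act_FMap id_act_FMap
  comp_act_FMap[THEN C.Seq_eq_Seq] id_act_FMap[THEN C.Seq_eq_Seq]

end

lemma v_functor_vfunctor_comp:
  assumes "v_functor V A B F" "v_functor V B C G"
  shows "v_functor V A C (vfunctor_comp V F G)"
proof -
  interpret F: v_functor V A B F
    by fact
  interpret G: v_functor V B C G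
    by fact
  show ?thesis
  proof
    fix a b c
    assume abc [simp]: "a \<in> VObj A" "b \<in> VObj A" "c \<in> VObj A"
    have "Seq V (VComp A a b c) (Seq V (FMap F a c) (FMap G (FObj F a) (FObj F c)))
      = Seq V (Seq V (VComp A a b c) (FMap F a c)) (FMap G (FObj F a) (FObj F c))"
      by simp
    also have "\<dots> = Seq V (TenA V (FMap F a b) (FMap F b c))
        (Seq V (VComp B (FObj F a) (FObj F b) (FObj F c)) (FMap G (FObj F a) (FObj F c)))"
      by (subst F.FMap_VComp) simp_all
    also have "\<dots> = Seq V (Seq V (TenA V (FMap F a b) (FMap F b c))
        (TenA V (FMap G (FObj F a) (FObj F b)) (FMap G (FObj F b) (FObj F c))))
        (VComp C (FObj G (FObj F a)) (FObj G (FObj F b)) (FObj G (FObj F c)))"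
      by (subst G.FMap_VComp) simp_all
    finally show "Seq V (VComp A a b c) (FMap (vfunctor_comp V F G) a c) =
       Seq V (TenA V (FMap (vfunctor_comp V F G) a b) (FMap (vfunctor_comp V F G) b c))
        (VComp C (FObj (vfunctor_comp V F G) a) (FObj (vfunctor_comp V F G) b)
          (FObj (vfunctor_comp V F G) c))"
      by (simp add: vfunctor_comp_def F.C.TenA_Seq)
    have "Seq V (VId A a) (Seq V (FMap F a a) (FMap G (FObj F a) (FObj F a)))
      = Seq V (Seq V (VId A a) (FMap F a a)) (FMap G (FObj F a) (FObj F a))"
      by simp
    then show "Seq V (VId A a) (FMap (vfunctor_comp V F G) a a) = VId C (FObj (vfunctor_comp V F G) a)"
      by (simp add: vfunctor_comp_def F.FMap_VId G.FMap_VId del: F.C.Seq_Seq)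
  qed (simp_all add: vfunctor_comp_def F.C.hom_iff)
qed

section \<open>The self-enrichment\<close>

context closed_monoidal_category
begin

lemma IHom_Obj [simp]: "\<lbrakk>u \<in> Obj V; v \<in> Obj V\<rbrakk> \<Longrightarrow> IHom V u v \<in> Obj V"
  by (rule IHom_closed)

lemma Mate_typing [simp]:
  assumes "f \<in> Arr V" "Dom V f = u \<odot> w" "Cod V f = v" "u \<in> Obj V" "w \<in> Obj V"
  shows "Mate V u w v f \<in> Arr V" "Dom V (Mate V u w v f) = w" "Cod V (Mate V u w v f) = IHom V u v"
  using bij_betwE[OF Mate_bij[of u w v]] Cod_Obj[OF assms(1)] assms by (auto simp: hom_iff)

lemma Mate_inject:
  assumes "Mate V u w v f = Mate V u w v g" "f \<in> Arr V" "Dom V f = u \<odot> w" "Cod V f = v"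
    "g \<in> Arr V" "Dom V g = u \<odot> w" "Cod V g = v" "u \<in> Obj V" "w \<in> Obj V"
  shows "f = g"
  using bij_betw_imp_inj_on[OF Mate_bij[of u w v]] assms Cod_Obj[of f]
  by (auto simp: hom_iff inj_on_def)

lemma unmate_typing [simp]:
  assumes "h \<in> Arr V" "Dom V h = w" "Cod V h = IHom V u v" "u \<in> Obj V" "v \<in> Obj V"
  shows "unmate V u w v h \<in> Arr V" "Dom V (unmate V u w v h) = u \<odot> w" "Cod V (unmate V u w v h) = v"
    and Mate_unmate: "Mate V u w v (unmate V u w v h) = h"
proof -
  have w: "w \<in> Obj V"
    using Dom_Obj[OF assms(1)] assms(2) by simp
  then have h: "h \<in> Mate V u w v ` hom V (u \<odot> w) v"
    using bij_betw_imp_surj_on[OF Mate_bij[of u w v]] assms by (auto simp: hom_iff)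
  show "unmate V u w v h \<in> Arr V" "Dom V (unmate V u w v h) = u \<odot> w" "Cod V (unmate V u w v h) = v"
    using inv_into_into[OF h] by (simp_all add: unmate_def hom_iff)
  show "Mate V u w v (unmate V u w v h) = h"
    using f_inv_into_f[OF h] by (simp add: unmate_def)
qed

lemma ev_typing [simp]:
  assumes "u \<in> Obj V" "v \<in> Obj V"
  shows "\<epsilon> u v \<in> Arr V" "Dom V (\<epsilon> u v) = u \<odot> IHom V u v" "Cod V (\<epsilon> u v) = v"
    and Mate_ev: "Mate V u (IHom V u v) v (\<epsilon> u v) = \<i>\<d> (IHom V u v)"
  using assms by (simp_all add: ev_def Mate_unmate)

text \<open>\<open>Mate_natural\<close> at the evaluation, whose mate is the identity. It lets the
  bijection be handled through \<open>\<epsilon>\<close> alone.\<close>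

lemma Mate_lact_ev:
  assumes "h \<in> Arr V" "Dom V h = w" "Cod V h = IHom V u v" "u \<in> Obj V" "v \<in> Obj V"
  shows "Mate V u w v ((u \<rhd> h) \<Zsemi> \<epsilon> u v) = h"
  using Mate_natural[of u v h w "IHom V u v" "\<epsilon> u v"] assms
  by (simp add: hom_iff lact_def Mate_ev)

lemma lact_Mate_ev:
  assumes "f \<in> Arr V" "Dom V f = u \<odot> w" "Cod V f = v" "u \<in> Obj V" "w \<in> Obj V"
  shows "(u \<rhd> Mate V u w v f) \<Zsemi> \<epsilon> u v = f"
  by (rule Mate_inject[of u w v]) (use Cod_Obj[OF assms(1)] assms in \<open>simp_all add: Mate_lact_ev\<close>)

lemma lact_unmate:
  assumes "h \<in> Arr V" "Dom V h = w" "Cod V h = IHom V u v" "u \<in> Obj V" "v \<in> Obj V"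
  shows "unmate V u w v h = (u \<rhd> h) \<Zsemi> \<epsilon> u v"
proof (rule Mate_inject)
  show "Mate V u w v (unmate V u w v h) = Mate V u w v ((u \<rhd> h) \<Zsemi> \<epsilon> u v)"
    using assms by (simp add: Mate_lact_ev Mate_unmate)
qed (use assms Dom_Obj[of h] in simp_all)

abbreviation ev_act :: "'o \<Rightarrow> 'o \<Rightarrow> 'o \<Rightarrow> 'm" where
  "ev_act u v x \<equiv> act2 u (IHom V u v) (\<epsilon> u v) x"

lemma lact_act1_ev_act:
  assumes "h \<in> Arr V" "Dom V h = w" "Cod V h = IHom V u v" "u \<in> Obj V" "v \<in> Obj V" "x \<in> Obj V"
  shows "(u \<rhd> act1 h x) \<Zsemi> ev_act u v x = act2 u w ((u \<rhd> h) \<Zsemi> \<epsilon> u v) x"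
  using assms Dom_Obj[of h] by (simp add: act2_lact_Seq)

lemma act1_Mate_ev_act:
  assumes "f \<in> Arr V" "Dom V f = u \<odot> w" "Cod V f = v" "u \<in> Obj V" "w \<in> Obj V" "x \<in> Obj V"
  shows "(u \<rhd> act1 (Mate V u w v f) x) \<Zsemi> ev_act u v x = act2 u w f x"
  using assms Cod_Obj[of f] by (simp add: lact_act1_ev_act lact_Mate_ev)

text \<open>The unitor put in front of \<open>g\<close>, in order to form a mate with domain \<one>,
  cancels by the triangle. Identities of the self-enrichment and of the completion have this
  shape.\<close>

lemma act0_Mate_ev_act:
  assumes "g \<in> Arr V" "Dom V g = u" "Cod V g = v" "x \<in> Obj V"
  shows "(u \<rhd> act0 (Mate V u \<one> v (\<rho> u \<Zsemi> g)) x) \<Zsemi> ev_act u v x = act1 g x"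
proof -
  have "u \<in> Obj V" "v \<in> Obj V"
    using Dom_Obj[OF assms(1)] Cod_Obj[OF assms(1)] assms(2,3) by simp_all
  then show ?thesis
    using assms Assoc_inv_RUnit(1)[of u x, THEN Seq_eq_Seq, of "act1 g x"]
    by (simp add: act0_eq act1_Mate_ev_act act2_Seq) (simp add: act2_eq)
qed

text \<open>The corresponding rule for composition: both enrichments define it as the mate of an
  arrow that starts with this inverse associator. The pentagon moves it in front of the
  family.\<close>

lemma act2_Mate_ev_act:
  assumes "f \<in> Arr V" "Dom V f = u \<odot> p \<odot> q" "Cod V f = v" "u \<in> Obj V" "p \<in> Obj V" "q \<in> Obj V" "x \<in> Obj V"
  shows "(u \<rhd> act2 p q (Mate V u (p \<odot> q) v (\<i>\<n>\<v> (\<alpha> u p q) \<Zsemi> f)) x) \<Zsemi> ev_act u v x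
    = \<i>\<n>\<v> (\<alpha> u p (q \<odot> x)) \<Zsemi> act2 (u \<odot> p) q f x"
proof -
  have "v \<in> Obj V"
    using Cod_Obj[OF assms(1)] assms(3) by simp
  then show ?thesis
    using assms pentagon_inv[of u p q x, THEN Seq_eq_Seq3, of "act1 f x"]
    by (simp add: act2_eq[of p q] act1_Mate_ev_act) (simp add: act2_eq)
qed

text \<open>By \<open>Mate_lact_ev\<close> an arrow is the mate of what evaluation makes of
  it.\<close>

lemma detects_ev_act:
  assumes "u \<in> Obj V" "v \<in> Obj V"
  shows "detects u (IHom V u v) (ev_act u v)"
  unfolding detects_def
proof (intro conjI allI impI)
  fix h h'
  assume h: "h \<in> Arr V" "h' \<in> Arr V" "Dom V h' = Dom V h" "Cod V h = IHom V u v" "Cod V h' = IHom V u v"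
    and "(u \<rhd> act1 h \<one>) \<Zsemi> ev_act u v \<one> = (u \<rhd> act1 h' \<one>) \<Zsemi> ev_act u v \<one>"
  then have "act2 u (Dom V h) ((u \<rhd> h) \<Zsemi> \<epsilon> u v) \<one> = act2 u (Dom V h) ((u \<rhd> h') \<Zsemi> \<epsilon> u v) \<one>"
    using assms by (simp add: lact_act1_ev_act)
  then have "(u \<rhd> h) \<Zsemi> \<epsilon> u v = (u \<rhd> h') \<Zsemi> \<epsilon> u v"
    by (rule act2_inject) (use h assms in simp_all)
  then show "h = h'"
    using Mate_lact_ev[of h "Dom V h" u v] Mate_lact_ev[of h' "Dom V h" u v] h assms by metis
qed (use assms in simp_all)

lemma self_enriched_simps [simp]:
  "VObj (self_enriched V) = Obj V" "VHom (self_enriched V) u v = IHom V u v"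
  by (simp_all add: self_enriched_def)

lemma self_enriched_typing [simp]:
  shows "u \<in> Obj V \<Longrightarrow> VId (self_enriched V) u \<in> Arr V"
    "u \<in> Obj V \<Longrightarrow> Dom V (VId (self_enriched V) u) = \<one>"
    "u \<in> Obj V \<Longrightarrow> Cod V (VId (self_enriched V) u) = IHom V u u"
    "\<lbrakk>u \<in> Obj V; v \<in> Obj V; w \<in> Obj V\<rbrakk> \<Longrightarrow> VComp (self_enriched V) u v w \<in> Arr V"
    "\<lbrakk>u \<in> Obj V; v \<in> Obj V; w \<in> Obj V\<rbrakk>
      \<Longrightarrow> Dom V (VComp (self_enriched V) u v w) = IHom V u v \<odot> IHom V v w"
    "\<lbrakk>u \<in> Obj V; v \<in> Obj V; w \<in> Obj V\<rbrakk> \<Longrightarrow> Cod V (VComp (self_enriched V) u v w) = IHom V u w"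
  by (simp_all add: self_enriched_def flip: act1_def)

lemma id_act_self_enriched:
  assumes "u \<in> Obj V" "x \<in> Obj V"
  shows "(u \<rhd> id_act (self_enriched V) u x) \<Zsemi> ev_act u u x = \<i>\<d> (u \<odot> x)"
  using act0_Mate_ev_act[of "\<i>\<d> u" u u x] assms by (simp add: self_enriched_def)

lemma comp_act_self_enriched:
  assumes "u \<in> Obj V" "v \<in> Obj V" "w \<in> Obj V" "x \<in> Obj V"
  shows "(u \<rhd> act2 (IHom V u v) (IHom V v w) (VComp (self_enriched V) u v w) x) \<Zsemi> ev_act u w x
    = ev_act u v (IHom V v w \<odot> x) \<Zsemi> ev_act v w x"
  using act2_Mate_ev_act[of "act1 (\<epsilon> u v) (IHom V v w) \<Zsemi> \<epsilon> v w" u "IHom V u v" "IHom V v w" w x] assms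
  by (simp add: self_enriched_def act2_act1_Seq flip: act1_def) (simp add: act2_eq)

lemmas self_enriched_act = id_act_self_enriched comp_act_self_enriched
  id_act_self_enriched[THEN Seq_eq_Seq] comp_act_self_enriched[THEN Seq_eq_Seq]

lemma v_category_self_enriched: "v_category V (self_enriched V)"
  \<comment> \<open>Through evaluation a composite acts by successive evaluations, so both sides of
    each law simplify to the same iterated evaluation.\<close>
  by (rule v_categoryI[where s = "\<lambda>u. u" and e = ev_act])
    (simp_all add: hom_iff detects_ev_act self_enriched_act lact_act)

text \<open>The action is defined as the mate of composition, so evaluating it gives composition
  back, and functoriality becomes associativity and unitality of \<open>D\<close>.\<close>

lemma v_functor_representable:
  assumes "v_category V D" "a \<in> VObj D"
  shows "v_functor V D (self_enriched V) (representable V D a)"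
    and "\<And>b c x. \<lbrakk>b \<in> VObj D; c \<in> VObj D; x \<in> Obj V\<rbrakk>
      \<Longrightarrow> (VHom D a b \<rhd> act1 (FMap (representable V D a) b c) x) \<Zsemi> ev_act (VHom D a b) (VHom D a c) x
        = comp_act D a b c x"
proof -
  interpret D: v_category V D
    by fact
  show *: "(VHom D a b \<rhd> act1 (FMap (representable V D a) b c) x) \<Zsemi> ev_act (VHom D a b) (VHom D a c) x
        = comp_act D a b c x" if "b \<in> VObj D" "c \<in> VObj D" "x \<in> Obj V" for b c x
    using that assms by (simp add: representable_def act1_Mate_ev_act)
  have FObj [simp]: "FObj (representable V D a) b = VHom D a b" for b
    by (simp add: representable_def)
  have FMap [simp]: "FMap (representable V D a) b c \<in> Arr V" "Dom V (FMap (representable V D a) b c) = VHom D b c"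
    "Cod V (FMap (representable V D a) b c) = IHom V (VHom D a b) (VHom D a c)"
     if "b \<in> VObj D" "c \<in> VObj D" for b c
    using that assms by (simp_all add: representable_def)
  show "v_functor V D (self_enriched V) (representable V D a)"
    by (rule v_functorI[where s = "VHom D a" and e = "\<lambda>b c. ev_act (VHom D a b) (VHom D a c)"])
     (use assms in \<open>simp_all add: hom_iff detects_ev_act self_enriched_act lact_act * *[THEN Seq_eq_Seq]
       v_category_self_enriched D.v_cat_simps\<close>)
qed

end

section \<open>The completion\<close>

locale closed_v_category = closed_monoidal_category V + v_category V C
  for V :: "('o, 'm) closed_monoidal_category" (structure)
    and C :: "('o, 'm, 'a) vcategory"
begin

text \<open>Evaluation \<open>u [u, C(a \<rightarrow> b) v] \<rightarrow> C(a \<rightarrow> b) v\<close> as a family \<open>u ([u, C(a \<rightarrow> b) v] x) \<rightarrow> C(a \<rightarrow> b) (v x)\<close>.\<close>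

definition tenev :: "'o \<Rightarrow> 'a \<Rightarrow> 'a \<Rightarrow> 'o \<Rightarrow> 'o \<Rightarrow> 'm" where
  "tenev u a b v x = ev_act u (VHom C a b \<odot> v) x \<Zsemi> \<alpha> (VHom C a b) v x"

lemma tenev_typing [simp]:
  assumes "a \<in> VObj C" "b \<in> VObj C" "u \<in> Obj V" "v \<in> Obj V" "x \<in> Obj V"
  shows "tenev u a b v x \<in> Arr V"
    "Dom V (tenev u a b v x) = u \<odot> (IHom V u (VHom C a b \<odot> v) \<odot> x)"
    "Cod V (tenev u a b v x) = VHom C a b \<odot> (v \<odot> x)"
  using assms by (simp_all add: tenev_def)

lemma lact_tenev:
  assumes "g \<in> Arr V" "y = Cod V g" "H = IHom V u (VHom C a b \<odot> v)"
    "a \<in> VObj C" "b \<in> VObj C" "u \<in> Obj V" "v \<in> Obj V"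
  shows "(u \<rhd> H \<rhd> g) \<Zsemi> tenev u a b v y = tenev u a b v (Dom V g) \<Zsemi> (VHom C a b \<rhd> v \<rhd> g)"
  using assms by (simp add: tenev_def lact_act)

lemma detects_tenev:
  assumes "a \<in> VObj C" "b \<in> VObj C" "u \<in> Obj V" "v \<in> Obj V"
  shows "detects u (IHom V u (VHom C a b \<odot> v)) (tenev u a b v)"
  unfolding tenev_def[abs_def] by (rule detects_iso[OF detects_ev_act]) (use assms in simp_all)

lemma completion_simps [simp]:
  "x \<in> VObj (completion V C) \<longleftrightarrow> base x \<in> VObj C \<and> weight x \<in> Obj V"
  "VHom (completion V C) x y = IHom V (weight x) (VHom C (base x) (base y) \<odot> weight y)"
  by (cases x; force simp: completion_def completion_hom_def)+

lemma id_tensor_typing [simp]: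
  assumes "a \<in> VObj C" "u \<in> Obj V"
  shows "id_tensor V C a u \<in> Arr V" "Dom V (id_tensor V C a u) = u" "Cod V (id_tensor V C a u) = VHom C a a \<odot> u"
  using assms by (simp_all add: id_tensor_def)

text \<open>By \<open>Assoc_inv_LUnit\<close>, inserting a unit before \<open>u\<close> and then
  tensoring with \<open>x\<close> is inserting one before \<open>u \<odot> x\<close>.\<close>

lemma act1_id_tensor:
  assumes "a \<in> VObj C" "u \<in> Obj V" "x \<in> Obj V"
  shows "act1 (id_tensor V C a u) x \<Zsemi> \<alpha> (VHom C a a) u x = id_act C a (u \<odot> x)"
  using assms Assoc_nat1[of "VId C a" u x] Assoc_inv_LUnit(2)[of u x, THEN Seq_eq_Seq, of "act1 (VId C a) (u \<odot> x)"]
  by (simp add: id_tensor_def act0_eq flip: act1_def)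

lemma completion_typing [simp]:
  shows "\<lbrakk>base x \<in> VObj C; weight x \<in> Obj V\<rbrakk> \<Longrightarrow> VId (completion V C) x \<in> Arr V"
    "\<lbrakk>base x \<in> VObj C; weight x \<in> Obj V\<rbrakk> \<Longrightarrow> Dom V (VId (completion V C) x) = \<one>"
    "\<lbrakk>base x \<in> VObj C; weight x \<in> Obj V\<rbrakk>
      \<Longrightarrow> Cod V (VId (completion V C) x) = IHom V (weight x) (VHom C (base x) (base x) \<odot> weight x)"
    "\<lbrakk>base x \<in> VObj C; weight x \<in> Obj V; base y \<in> VObj C; weight y \<in> Obj V; base z \<in> VObj C; weight z \<in> Obj V\<rbrakk>
      \<Longrightarrow> VComp (completion V C) x y z \<in> Arr V"
    "\<lbrakk>base x \<in> VObj C; weight x \<in> Obj V; base y \<in> VObj C; weight y \<in> Obj V; base z \<in> VObj C; weight z \<in> Obj V\<rbrakk>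
      \<Longrightarrow> Dom V (VComp (completion V C) x y z) = IHom V (weight x) (VHom C (base x) (base y) \<odot> weight y)
        \<odot> IHom V (weight y) (VHom C (base y) (base z) \<odot> weight z)"
    "\<lbrakk>base x \<in> VObj C; weight x \<in> Obj V; base y \<in> VObj C; weight y \<in> Obj V; base z \<in> VObj C; weight z \<in> Obj V\<rbrakk>
      \<Longrightarrow> Cod V (VComp (completion V C) x y z) = IHom V (weight x) (VHom C (base x) (base z) \<odot> weight z)"
  by (simp_all add: completion_def completion_hom_def Let_def)

lemma id_act_completion:
  assumes "base x \<in> VObj C" "weight x \<in> Obj V" "p \<in> Obj V" "a = base x" "u = weight x"
  shows "(u \<rhd> id_act (completion V C) x p) \<Zsemi> tenev u a a u p = id_act C a (u \<odot> p)"
  using assms act0_Mate_ev_act[of "id_tensor V C a u" u "VHom C a a \<odot> u" p,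
    THEN Seq_eq_Seq, of "\<alpha> (VHom C a a) u p"]
  by (simp add: completion_def tenev_def act1_id_tensor Let_def)

text \<open>Two pentagons absorb the associators of the definition: the first where the factor
  \<open>C(a -> b)\<close> is split off, the second where two hom objects are composed.
  Associativity of the completion thereby reduces to that of \<open>C\<close>.\<close>

lemma comp_act_completion:
  assumes "base x \<in> VObj C" "weight x \<in> Obj V" "base y \<in> VObj C" "weight y \<in> Obj V"
    "base z \<in> VObj C" "weight z \<in> Obj V" "p \<in> Obj V"
    "a = base x" "u = weight x" "b = base y" "v = weight y" "c = base z" "w = weight z"
    "X = IHom V u (VHom C a b \<odot> v)" "Y = IHom V v (VHom C b c \<odot> w)"
  shows "(u \<rhd> act2 X Y (VComp (completion V C) x y z) p) \<Zsemi> tenev u a c w p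
    = tenev u a b v (Y \<odot> p) \<Zsemi> ((VHom C a b \<rhd> tenev v b c w p) \<Zsemi> comp_act C a b c (w \<odot> p))"
proof -
  let ?C = "VHom C a b" and ?D = "VHom C b c" and ?m = "VComp C a b c"
  note XY = assms(14,15)
  have [simp]: "a \<in> VObj C" "b \<in> VObj C" "c \<in> VObj C" "u \<in> Obj V" "v \<in> Obj V" "w \<in> Obj V" "p \<in> Obj V"
    using assms(1-13) by simp_all
  have [simp]: "X \<in> Obj V" "Y \<in> Obj V"
    using XY by simp_all
  have e [simp]: "\<epsilon> u (?C \<odot> v) \<in> Arr V" "Dom V (\<epsilon> u (?C \<odot> v)) = u \<odot> X" "Cod V (\<epsilon> u (?C \<odot> v)) = ?C \<odot> v"
    "\<epsilon> v (?D \<odot> w) \<in> Arr V" "Dom V (\<epsilon> v (?D \<odot> w)) = v \<odot> Y" "Cod V (\<epsilon> v (?D \<odot> w)) = ?D \<odot> w"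
    using XY by simp_all
  \<comment> \<open>\<open>r\<close> is the part behind the first inner associator, and
    \<open>f\<close> the arrow that \<open>act2_Mate_ev_act\<close> expects. Naming them lets each
    pentagon act on its own piece.\<close>
  define r where "r = (?C \<rhd> \<epsilon> v (?D \<odot> w)) \<Zsemi> (\<i>\<n>\<v> (\<alpha> ?C ?D w) \<Zsemi> act1 ?m w)"
  have r [simp]: "r \<in> Arr V" "Dom V r = ?C \<odot> (v \<odot> Y)" "Cod V r = VHom C a c \<odot> w"
    by (simp_all add: r_def)
  define f where "f = act1 (\<epsilon> u (?C \<odot> v)) Y \<Zsemi> (\<alpha> ?C v Y \<Zsemi> r)"
  have f [simp]: "f \<in> Arr V" "Dom V f = u \<odot> X \<odot> Y" "Cod V f = VHom C a c \<odot> w"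
    by (simp_all add: f_def)
  have K: "VComp (completion V C) x y z = Mate V u (X \<odot> Y) (VHom C a c \<odot> w) (\<i>\<n>\<v> (\<alpha> u X Y) \<Zsemi> f)"
    unfolding f_def r_def unfolding XY unfolding assms(8-13)
    using assms(1-7) by (simp add: completion_def completion_hom_def Let_def flip: act1_def lact_def)
  have 1: "\<i>\<n>\<v> (\<alpha> (?C \<odot> v) Y p) \<Zsemi> (act1 (\<alpha> ?C v Y) p \<Zsemi> (act1 r p \<Zsemi> \<alpha> (VHom C a c) w p))
    = \<alpha> ?C v (Y \<odot> p) \<Zsemi> ((?C \<rhd> \<i>\<n>\<v> (\<alpha> v Y p)) \<Zsemi> (\<i>\<n>\<v> (\<alpha> ?C (v \<odot> Y) p)
      \<Zsemi> (act1 r p \<Zsemi> \<alpha> (VHom C a c) w p)))"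
    by (simp add: pentagon_inv1[THEN Seq_eq_Seq])
  have 2: "\<i>\<n>\<v> (\<alpha> ?C (v \<odot> Y) p) \<Zsemi> (act1 r p \<Zsemi> \<alpha> (VHom C a c) w p)
    = (?C \<rhd> act1 (\<epsilon> v (?D \<odot> w)) p) \<Zsemi> (\<i>\<n>\<v> (\<alpha> ?C (?D \<odot> w) p) \<Zsemi> (act1 (\<i>\<n>\<v> (\<alpha> ?C ?D w)) p
      \<Zsemi> (\<alpha> (?C \<odot> ?D) w p \<Zsemi> act1 ?m (w \<odot> p))))"
    using Assoc_inv_nat2[of "\<epsilon> v (?D \<odot> w)" ?C p, THEN Seq_eq_Seq] Assoc_nat1[of ?m w p]
    by (simp add: r_def)
  also have "\<dots> = (?C \<rhd> act1 (\<epsilon> v (?D \<odot> w)) p) \<Zsemi> ((?C \<rhd> \<alpha> ?D w p) \<Zsemi> (\<i>\<n>\<v> (\<alpha> ?C ?D (w \<odot> p))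
      \<Zsemi> act1 ?m (w \<odot> p)))"
    by (simp add: pentagon_inv2[THEN Seq_eq_Seq3])
  finally have 2: "\<i>\<n>\<v> (\<alpha> ?C (v \<odot> Y) p) \<Zsemi> (act1 r p \<Zsemi> \<alpha> (VHom C a c) w p) = \<dots>" .
  have "(u \<rhd> act2 X Y (VComp (completion V C) x y z) p) \<Zsemi> tenev u a c w p
    = (\<i>\<n>\<v> (\<alpha> u X (Y \<odot> p)) \<Zsemi> act2 (u \<odot> X) Y f p) \<Zsemi> \<alpha> (VHom C a c) w p"
    using act2_Mate_ev_act[OF f(1,2,3), THEN Seq_eq_Seq, of p "\<alpha> (VHom C a c) w p"]
    by (simp add: tenev_def K)
  also have "\<dots> = \<i>\<n>\<v> (\<alpha> u X (Y \<odot> p)) \<Zsemi> (act1 (\<epsilon> u (?C \<odot> v)) (Y \<odot> p)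
    \<Zsemi> (\<i>\<n>\<v> (\<alpha> (?C \<odot> v) Y p) \<Zsemi> (act1 (\<alpha> ?C v Y) p \<Zsemi> (act1 r p \<Zsemi> \<alpha> (VHom C a c) w p))))"
    unfolding f_def by (simp add: act2_act1_Seq) (simp add: act2_eq)
  also have "\<dots> = tenev u a b v (Y \<odot> p) \<Zsemi> ((?C \<rhd> tenev v b c w p) \<Zsemi> comp_act C a b c (w \<odot> p))"
    unfolding 1 2 by (simp add: tenev_def act2_eq flip: XY)
  finally show ?thesis .
qed

lemmas completion_base = lact_tenev id_act_completion comp_act_completion
lemmas completion_lact = completion_base[THEN lact_eq_lact]
lemmas completion_act = completion_base completion_base[THEN Seq_eq_Seq]
  completion_lact completion_lact[THEN Seq_eq_Seq]

lemma v_category_completion: "v_category V (completion V C)"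
  by (rule v_categoryI[where s = weight and e = "\<lambda>x y. tenev (weight x) (base x) (base y) (weight y)"])
    (simp_all add: hom_iff detects_tenev completion_act lact_act v_cat_simps)

section \<open>Currying of internal homs\<close>

lemma IHom_IHom_inject:
  assumes "(u \<rhd> v \<rhd> (p \<Zsemi> act1 l \<one>)) \<Zsemi> ((u \<rhd> ev_act v (IHom V u z) \<one>) \<Zsemi> ev_act u z \<one>)
      = (u \<rhd> v \<rhd> (p \<Zsemi> act1 r \<one>)) \<Zsemi> ((u \<rhd> ev_act v (IHom V u z) \<one>) \<Zsemi> ev_act u z \<one>)"
    "is_iso V p" "Cod V p = w \<odot> \<one>" "l \<in> Arr V" "r \<in> Arr V" "Dom V l = w" "Dom V r = w"
    "Cod V l = IHom V v (IHom V u z)" "Cod V r = IHom V v (IHom V u z)"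
    "u \<in> Obj V" "v \<in> Obj V" "z \<in> Obj V"
  shows "l = r"
proof -
  have p: "p \<in> Arr V" and w [simp]: "w \<in> Obj V"
    using assms(2) Dom_Obj[of l] assms(4,6) by auto
  have "(u \<rhd> v \<rhd> p) \<Zsemi> ((u \<rhd> v \<rhd> act1 l \<one>) \<Zsemi> ((u \<rhd> ev_act v (IHom V u z) \<one>) \<Zsemi> ev_act u z \<one>))
      = (u \<rhd> v \<rhd> p) \<Zsemi> ((u \<rhd> v \<rhd> act1 r \<one>) \<Zsemi> ((u \<rhd> ev_act v (IHom V u z) \<one>) \<Zsemi> ev_act u z \<one>))"
    using assms p by simp
  then have *: "(u \<rhd> v \<rhd> act1 l \<one>) \<Zsemi> ((u \<rhd> ev_act v (IHom V u z) \<one>) \<Zsemi> ev_act u z \<one>)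
      = (u \<rhd> v \<rhd> act1 r \<one>) \<Zsemi> ((u \<rhd> ev_act v (IHom V u z) \<one>) \<Zsemi> ev_act u z \<one>)"
    by (rule iso_cancel_left) (use assms p in simp_all)
  \<comment> \<open>Two detections in a row: evaluation of \<open>[u, z]\<close> shows that these
    arrows agree, and their mates with respect to \<open>v\<close> are \<open>l\<close> and
    \<open>r\<close>.\<close>
  have "(v \<rhd> l) \<Zsemi> \<epsilon> v (IHom V u z) = (v \<rhd> r) \<Zsemi> \<epsilon> v (IHom V u z)"
  proof (rule detectsD[OF detects_ev_act])
    have eq: "(u \<rhd> act2 v w ((v \<rhd> h) \<Zsemi> \<epsilon> v (IHom V u z)) \<one>) \<Zsemi> ev_act u z \<one>
      = (u \<rhd> v \<rhd> act1 h \<one>) \<Zsemi> ((u \<rhd> ev_act v (IHom V u z) \<one>) \<Zsemi> ev_act u z \<one>)"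
      if "h \<in> Arr V" "Dom V h = w" "Cod V h = IHom V v (IHom V u z)" for h
      using that assms by (simp add: act2_lact_Seq)
    show "(u \<rhd> (\<i>\<n>\<v> (\<alpha> v w \<one>) \<Zsemi> act1 ((v \<rhd> l) \<Zsemi> \<epsilon> v (IHom V u z)) \<one>)) \<Zsemi> ev_act u z \<one>
      = (u \<rhd> (\<i>\<n>\<v> (\<alpha> v w \<one>) \<Zsemi> act1 ((v \<rhd> r) \<Zsemi> \<epsilon> v (IHom V u z)) \<one>)) \<Zsemi> ev_act u z \<one>"
      using assms * unfolding act2_eq[symmetric, of v w] by (simp add: eq del: lact_Seq)
  qed (use assms in \<open>simp_all add: iso_inv\<close>)
  then have "Mate V v w (IHom V u z) ((v \<rhd> l) \<Zsemi> \<epsilon> v (IHom V u z))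
    = Mate V v w (IHom V u z) ((v \<rhd> r) \<Zsemi> \<epsilon> v (IHom V u z))"
    by simp
  then show ?thesis
    using assms by (simp add: Mate_lact_ev)
qed

text \<open>The value of \<open>TIso\<close> for \<open>completion_tensoring\<close>, with the
  formal tensors replaced by the three objects on which it depends.\<close>

definition ihom_curry :: "'o \<Rightarrow> 'o \<Rightarrow> 'o \<Rightarrow> 'm" where
  "ihom_curry u v z = Mate V v (IHom V (u \<odot> v) z) (IHom V u z)
     (Mate V u (v \<odot> IHom V (u \<odot> v) z) z (\<i>\<n>\<v> (\<alpha> u v (IHom V (u \<odot> v) z)) \<Zsemi> \<epsilon> (u \<odot> v) z))"

definition ihom_uncurry :: "'o \<Rightarrow> 'o \<Rightarrow> 'o \<Rightarrow> 'm" where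
  "ihom_uncurry u v z = Mate V (u \<odot> v) (IHom V v (IHom V u z)) z
     (\<alpha> u v (IHom V v (IHom V u z)) \<Zsemi> ((u \<rhd> \<epsilon> v (IHom V u z)) \<Zsemi> \<epsilon> u z))"

lemma curry_typing [simp]:
  assumes "u \<in> Obj V" "v \<in> Obj V" "z \<in> Obj V"
  shows "ihom_curry u v z \<in> Arr V" "Dom V (ihom_curry u v z) = IHom V (u \<odot> v) z"
    "Cod V (ihom_curry u v z) = IHom V v (IHom V u z)"
    "ihom_uncurry u v z \<in> Arr V" "Cod V (ihom_uncurry u v z) = IHom V (u \<odot> v) z"
    "Dom V (ihom_uncurry u v z) = IHom V v (IHom V u z)"
  using assms by (simp_all add: ihom_curry_def ihom_uncurry_def)

lemma act1_curry:
  assumes "u \<in> Obj V" "v \<in> Obj V" "z \<in> Obj V" "x \<in> Obj V"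
  shows "(u \<rhd> v \<rhd> act1 (ihom_curry u v z) x) \<Zsemi> ((u \<rhd> ev_act v (IHom V u z) x) \<Zsemi> ev_act u z x)
    = \<i>\<n>\<v> (\<alpha> u v (IHom V (u \<odot> v) z \<odot> x)) \<Zsemi> ev_act (u \<odot> v) z x"
proof -
  let ?H = "IHom V (u \<odot> v) z"
  let ?g = "Mate V u (v \<odot> ?H) z (\<i>\<n>\<v> (\<alpha> u v ?H) \<Zsemi> \<epsilon> (u \<odot> v) z)"
  have "(u \<rhd> v \<rhd> act1 (ihom_curry u v z) x) \<Zsemi> (u \<rhd> ev_act v (IHom V u z) x) = u \<rhd> act2 v ?H ?g x"
    using assms act1_Mate_ev_act[of ?g v ?H "IHom V u z" x] unfolding ihom_curry_def
    by (intro lact_eq_lact) simp_all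
  from this[THEN Seq_eq_Seq, of "ev_act u z x"] show ?thesis
    using assms act2_Mate_ev_act[of "\<epsilon> (u \<odot> v) z" u v ?H z x] by simp
qed

lemma act1_uncurry:
  assumes "u \<in> Obj V" "v \<in> Obj V" "z \<in> Obj V" "x \<in> Obj V"
  shows "(u \<odot> v \<rhd> act1 (ihom_uncurry u v z) x) \<Zsemi> ev_act (u \<odot> v) z x
    = \<alpha> u v (IHom V v (IHom V u z) \<odot> x) \<Zsemi> ((u \<rhd> ev_act v (IHom V u z) x) \<Zsemi> ev_act u z x)"
  using assms
    Assoc_inv_nat2[of "\<epsilon> v (IHom V u z)" u x, THEN Seq_eq_Seq, of "act1 (\<epsilon> u z) x"]
  by (simp add: ihom_uncurry_def act1_Mate_ev_act)
    (simp add: act2_eq pentagon_inv1[THEN Seq_eq_Seq])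

text \<open>Each composite is compared with an identity after the evaluations that fit its target:
  one for \<open>[u v, z]\<close>, two for \<open>[v, [u, z]]\<close>. There currying and uncurrying
  contribute only \<open>\<alpha>\<close> and its inverse.\<close>

lemma iso_curry:
  assumes [simp]: "u \<in> Obj V" "v \<in> Obj V" "z \<in> Obj V"
  shows "is_iso V (ihom_curry u v z)"
proof (rule isoI[of _ "ihom_uncurry u v z"])
  let ?H = "IHom V (u \<odot> v) z" and ?K = "IHom V v (IHom V u z)"
  have "ihom_curry u v z \<Zsemi> ihom_uncurry u v z = \<i>\<d> ?H"
  \<comment> \<open>No associator has to be absorbed here, so the isomorphism \<open>p\<close> of
    \<open>detectsD\<close> is an identity.\<close>
  proof (rule detectsD[OF detects_ev_act])
    show "(u \<odot> v \<rhd> (\<i>\<d> (?H \<odot> \<one>) \<Zsemi> act1 (ihom_curry u v z \<Zsemi> ihom_uncurry u v z) \<one>)) \<Zsemi> ev_act (u \<odot> v) z \<one>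
      = (u \<odot> v \<rhd> (\<i>\<d> (?H \<odot> \<one>) \<Zsemi> act1 (\<i>\<d> ?H) \<one>)) \<Zsemi> ev_act (u \<odot> v) z \<one>"
      by (simp add: act1_uncurry act1_curry lact_act)
  qed (simp_all add: isoI[of "\<i>\<d> x" "\<i>\<d> x" for x])
  then show "ihom_curry u v z \<Zsemi> ihom_uncurry u v z = \<i>\<d> (Dom V (ihom_curry u v z))"
    by simp
  have "ihom_uncurry u v z \<Zsemi> ihom_curry u v z = \<i>\<d> ?K"
  proof (rule IHom_IHom_inject)
    show "(u \<rhd> v \<rhd> (\<i>\<d> (?K \<odot> \<one>) \<Zsemi> act1 (ihom_uncurry u v z \<Zsemi> ihom_curry u v z) \<one>))
        \<Zsemi> ((u \<rhd> ev_act v (IHom V u z) \<one>) \<Zsemi> ev_act u z \<one>)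
      = (u \<rhd> v \<rhd> (\<i>\<d> (?K \<odot> \<one>) \<Zsemi> act1 (\<i>\<d> ?K) \<one>))
        \<Zsemi> ((u \<rhd> ev_act v (IHom V u z) \<one>) \<Zsemi> ev_act u z \<one>)"
      by (simp add: act1_uncurry act1_curry lact_act)
  qed (simp_all add: isoI[of "\<i>\<d> x" "\<i>\<d> x" for x])
  then show "ihom_uncurry u v z \<Zsemi> ihom_curry u v z = \<i>\<d> (Cod V (ihom_curry u v z))"
    by simp
qed simp_all

lemma curry_tenev:
  assumes "a \<in> VObj C" "b \<in> VObj C" "u \<in> Obj V" "v \<in> Obj V" "w \<in> Obj V" "x \<in> Obj V"
    "z = VHom C a b \<odot> w"
  shows "(u \<rhd> v \<rhd> act1 (ihom_curry u v z) x) \<Zsemi> ((u \<rhd> ev_act v (IHom V u z) x) \<Zsemi> tenev u a b w x)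
    = \<i>\<n>\<v> (\<alpha> u v (IHom V (u \<odot> v) z \<odot> x)) \<Zsemi> tenev (u \<odot> v) a b w x"
  using assms act1_curry[of u v z x, THEN Seq_eq_Seq3, of "\<alpha> (VHom C a b) w x"]
  by (simp add: tenev_def)

section \<open>The tensoring of the completion\<close>

lemma completion_tensoring_simps [simp]:
  "base (TObj (completion_tensoring V C) x v) = base x"
  "weight (TObj (completion_tensoring V C) x v) = weight x \<odot> v"
  "TIso (completion_tensoring V C) x v y = ihom_curry (weight x) v (VHom C (base x) (base y) \<odot> weight y)"
  by (simp_all add: completion_tensoring_def ihom_curry_def Let_def)

lemma TMap_typing [simp]:
  assumes "base x \<in> VObj C" "weight x \<in> Obj V" "v \<in> Obj V" "w \<in> Obj V"
  shows "TMap (completion_tensoring V C) x v w \<in> Arr V"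
    "Dom V (TMap (completion_tensoring V C) x v w) = IHom V v w"
    "Cod V (TMap (completion_tensoring V C) x v w)
      = IHom V (weight x \<odot> v) (VHom C (base x) (base x) \<odot> (weight x \<odot> w))"
  using assms by (simp_all add: completion_tensoring_def Let_def flip: lact_def)

text \<open>\<open>act1_id_tensor\<close> turns the inserted identity into a family, and a pentagon
  nests the evaluation of \<open>[v, w]\<close> under \<open>weight x\<close>.\<close>

lemma act1_TMap:
  assumes "base x \<in> VObj C" "weight x \<in> Obj V" "v \<in> Obj V" "w \<in> Obj V" "p \<in> Obj V"
  shows "(weight x \<odot> v \<rhd> act1 (TMap (completion_tensoring V C) x v w) p)
      \<Zsemi> tenev (weight x \<odot> v) (base x) (base x) (weight x \<odot> w) p
    = \<alpha> (weight x) v (IHom V v w \<odot> p) \<Zsemi> ((weight x \<rhd> ev_act v w p)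
      \<Zsemi> (\<i>\<n>\<v> (\<alpha> (weight x) w p) \<Zsemi> id_act C (base x) (weight x \<odot> w \<odot> p)))"
proof -
  let ?a = "base x" and ?u = "weight x" and ?H = "IHom V v w"
  let ?j = "id_tensor V C ?a (?u \<odot> w)" and ?A = "\<alpha> (VHom C ?a ?a) (?u \<odot> w) p"
  let ?f = "\<alpha> ?u v ?H \<Zsemi> ((?u \<rhd> \<epsilon> v w) \<Zsemi> ?j)"
  have T: "TMap (completion_tensoring V C) x v w
    = Mate V (?u \<odot> v) ?H (VHom C ?a ?a \<odot> (?u \<odot> w)) ?f"
    using assms by (simp add: completion_tensoring_def Let_def flip: lact_def)
  have f: "?f \<in> Arr V" "Dom V ?f = ?u \<odot> v \<odot> ?H" "Cod V ?f = VHom C ?a ?a \<odot> (?u \<odot> w)"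
    using assms by simp_all
  have "(?u \<odot> v \<rhd> act1 (TMap (completion_tensoring V C) x v w) p) \<Zsemi> tenev (?u \<odot> v) ?a ?a (?u \<odot> w) p
    = act2 (?u \<odot> v) ?H ?f p \<Zsemi> ?A"
    using act1_Mate_ev_act[OF f, THEN Seq_eq_Seq, of p ?A] assms by (simp add: tenev_def T)
  also have "\<dots> = \<i>\<n>\<v> (\<alpha> (?u \<odot> v) ?H p) \<Zsemi> (act1 (\<alpha> ?u v ?H) p \<Zsemi> (act1 (?u \<rhd> \<epsilon> v w) p
      \<Zsemi> id_act C ?a (?u \<odot> w \<odot> p)))"
    using assms by (simp add: act2_eq act1_id_tensor)
  also have "\<dots> = \<alpha> ?u v (?H \<odot> p) \<Zsemi> ((?u \<rhd> ev_act v w p)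
      \<Zsemi> (\<i>\<n>\<v> (\<alpha> ?u w p) \<Zsemi> id_act C ?a (?u \<odot> w \<odot> p)))"
    using assms Assoc_inv_nat2[of "\<epsilon> v w" ?u p, THEN Seq_eq_Seq, of "id_act C ?a (?u \<odot> w \<odot> p)"]
    by (simp add: pentagon_inv1[THEN Seq_eq_Seq] act2_eq)
  finally show ?thesis .
qed

lemmas TMap_act = act1_TMap act1_TMap[THEN Seq_eq_Seq] act1_TMap[THEN lact_eq_lact]
  act1_TMap[THEN lact_eq_lact, THEN Seq_eq_Seq]

lemmas curry_act = curry_tenev curry_tenev[THEN Seq_eq_Seq3]

lemma tensor_functor_completion_simps [simp]:
  "FObj (tensor_functor (completion_tensoring V C) x) v = TObj (completion_tensoring V C) x v"
  "FMap (tensor_functor (completion_tensoring V C) x) v w = TMap (completion_tensoring V C) x v w"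
  by (simp_all add: tensor_functor_def)

lemma v_functor_tensor_completion:
  assumes "x \<in> VObj (completion V C)"
  shows "v_functor V (self_enriched V) (completion V C) (tensor_functor (completion_tensoring V C) x)"
  by (rule v_functorI[where s = "\<lambda>v. weight x \<odot> v"
        and e = "\<lambda>v w. tenev (weight x \<odot> v) (base x) (base x) (weight x \<odot> w)"])
    (use assms in \<open>simp_all add: v_category_self_enriched v_category_completion hom_iff detects_tenev
      TMap_act completion_act lact_act v_cat_simps self_enriched_act self_enriched_act[THEN lact_eq_lact]
      self_enriched_act(1,2)[THEN lact_eq_lact, THEN Seq_eq_Seq]\<close>)

text \<open>Tested by two evaluations. On the left, the identity that \<open>TMap\<close> inserts is
  absorbed by composition in \<open>C\<close>; up to associators, what remains on both sides is the
  evaluation of \<open>[v, w]\<close> followed by that of \<open>[u w, z]\<close>.\<close>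

lemma completion_adj_natural_left:
  assumes [simp]: "base x \<in> VObj C" "weight x \<in> Obj V" "base y \<in> VObj C" "weight y \<in> Obj V"
    and [simp]: "v \<in> Obj V" "w \<in> Obj V"
  shows "act1 (TMap (completion_tensoring V C) x v w) (IHom V (weight x \<odot> w) (VHom C (base x) (base y) \<odot> weight y))
      \<Zsemi> (VComp (completion V C) (TObj (completion_tensoring V C) x v) (TObj (completion_tensoring V C) x w) y
        \<Zsemi> ihom_curry (weight x) v (VHom C (base x) (base y) \<odot> weight y))
    = (IHom V v w \<rhd> ihom_curry (weight x) w (VHom C (base x) (base y) \<odot> weight y))
      \<Zsemi> VComp (self_enriched V) v w (IHom V (weight x) (VHom C (base x) (base y) \<odot> weight y))"
    (is "?l = ?r")
proof (rule IHom_IHom_inject)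
  let ?a = "base x" and ?u = "weight x" and ?b = "base y" and ?t = "weight y"
  let ?Z = "VHom C ?a ?b \<odot> ?t"
  let ?H = "IHom V v w" and ?K = "IHom V (?u \<odot> w) ?Z"
  \<comment> \<open>\<open>?E\<close> ends in \<open>tenev\<close> rather than
    \<open>ev_act\<close>, since the rules for the completion compute with \<open>tenev\<close>; the
    additional associator is cancelled in the last step.\<close>
  let ?E = "(?u \<rhd> ev_act v (IHom V ?u ?Z) \<one>) \<Zsemi> tenev ?u ?a ?b ?t \<one>"
  have "act2 ?H ?K ?l \<one> = act1 (TMap (completion_tensoring V C) x v w) (?K \<odot> \<one>)
     \<Zsemi> (act2 (IHom V (?u \<odot> v) (VHom C ?a ?a \<odot> (?u \<odot> w))) ?K
         (VComp (completion V C) (TObj (completion_tensoring V C) x v) (TObj (completion_tensoring V C) x w) y) \<one>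
     \<Zsemi> act1 (ihom_curry ?u v ?Z) \<one>)"
    by (simp add: act2_act1_Seq) (simp add: act2_Seq)
  moreover have "act2 ?H ?K ?r \<one> = (?H \<rhd> act1 (ihom_curry ?u w ?Z) \<one>)
     \<Zsemi> act2 ?H (IHom V w (IHom V ?u ?Z)) (VComp (self_enriched V) v w (IHom V ?u ?Z)) \<one>"
    by (simp add: act2_lact_Seq)
  ultimately have "(?u \<rhd> v \<rhd> act2 ?H ?K ?l \<one>) \<Zsemi> ?E = (?u \<rhd> v \<rhd> act2 ?H ?K ?r \<one>) \<Zsemi> ?E"
    by (simp add: curry_act TMap_act completion_act lact_act v_cat_simps self_enriched_act
      self_enriched_act(1,2)[THEN lact_eq_lact]
      self_enriched_act(1,2)[THEN lact_eq_lact, THEN Seq_eq_Seq])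
  then have "((?u \<rhd> v \<rhd> act2 ?H ?K ?l \<one>) \<Zsemi> ((?u \<rhd> ev_act v (IHom V ?u ?Z) \<one>) \<Zsemi> ev_act ?u ?Z \<one>))
      \<Zsemi> \<alpha> (VHom C ?a ?b) ?t \<one>
    = ((?u \<rhd> v \<rhd> act2 ?H ?K ?r \<one>) \<Zsemi> ((?u \<rhd> ev_act v (IHom V ?u ?Z) \<one>) \<Zsemi> ev_act ?u ?Z \<one>))
      \<Zsemi> \<alpha> (VHom C ?a ?b) ?t \<one>"
    by (simp add: tenev_def)
  then show "(?u \<rhd> v \<rhd> (\<i>\<n>\<v> (\<alpha> ?H ?K \<one>) \<Zsemi> act1 ?l \<one>)) \<Zsemi> ((?u \<rhd> ev_act v (IHom V ?u ?Z) \<one>) \<Zsemi> ev_act ?u ?Z \<one>)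
    = (?u \<rhd> v \<rhd> (\<i>\<n>\<v> (\<alpha> ?H ?K \<one>) \<Zsemi> act1 ?r \<one>)) \<Zsemi> ((?u \<rhd> ev_act v (IHom V ?u ?Z) \<one>) \<Zsemi> ev_act ?u ?Z \<one>)"
    unfolding act2_eq[symmetric, of ?H ?K] by (rule iso_cancel_right) simp_all
qed (simp_all add: iso_inv)

text \<open>\<open>R_ev\<close> turns the action of the representable back into composition of the
  completion. Both sides are then evaluation at the weight \<open>u v\<close>, evaluation at
  \<open>weight y\<close> and composition in \<open>C\<close>.\<close>

lemma completion_adj_natural_right:
  assumes [simp]: "base x \<in> VObj C" "weight x \<in> Obj V" "base y \<in> VObj C" "weight y \<in> Obj V"
      "base z \<in> VObj C" "weight z \<in> Obj V"
    and [simp]: "v \<in> Obj V"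
  shows "VComp (completion V C) (TObj (completion_tensoring V C) x v) y z
      \<Zsemi> ihom_curry (weight x) v (VHom C (base x) (base z) \<odot> weight z)
    = (IHom V (weight x \<odot> v) (VHom C (base x) (base y) \<odot> weight y) \<rhd> FMap (representable V (completion V C) x) y z)
      \<Zsemi> (act1 (ihom_curry (weight x) v (VHom C (base x) (base y) \<odot> weight y))
          (IHom V (IHom V (weight x) (VHom C (base x) (base y) \<odot> weight y))
             (IHom V (weight x) (VHom C (base x) (base z) \<odot> weight z)))
      \<Zsemi> VComp (self_enriched V) v (IHom V (weight x) (VHom C (base x) (base y) \<odot> weight y))
          (IHom V (weight x) (VHom C (base x) (base z) \<odot> weight z)))"
    (is "?l = ?r")
proof -
  let ?a = "base x" and ?u = "weight x" and ?b = "base y" and ?s = "weight y" and ?c = "base z" and ?t = "weight z"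
  let ?Y = "VHom C ?a ?b \<odot> ?s" and ?Z = "VHom C ?a ?c \<odot> ?t" and ?H = "IHom V (?u \<odot> v) (VHom C ?a ?b \<odot> ?s)"
    and ?K = "IHom V ?s (VHom C ?b ?c \<odot> ?t)"
  let ?R = "FMap (representable V (completion V C) x) y z"
  let ?E = "(?u \<rhd> ev_act v (IHom V ?u ?Z) \<one>) \<Zsemi> tenev ?u ?a ?c ?t \<one>"
  interpret R: v_functor V "completion V C" "self_enriched V" "representable V (completion V C) x"
    by (rule v_functor_representable) (simp_all add: v_category_completion)
  have [simp]: "FObj (representable V (completion V C) x) z = IHom V ?u (VHom C ?a (base z) \<odot> weight z)" for z
    by (simp add: representable_def)
  have R [simp]: "?R \<in> Arr V" "Dom V ?R = ?K" "Cod V ?R = IHom V (IHom V ?u ?Y) (IHom V ?u ?Z)"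
    by simp_all
  note R_ev = v_functor_representable(2)[OF v_category_completion, of x y z, simplified]
  show ?thesis
  proof (rule IHom_IHom_inject)
    have "act2 ?H ?K ?l \<one> = act2 ?H ?K (VComp (completion V C) (TObj (completion_tensoring V C) x v) y z) \<one>
       \<Zsemi> act1 (ihom_curry ?u v ?Z) \<one>"
      by (simp add: act2_Seq)
    moreover have "act2 ?H ?K ?r \<one> = (?H \<rhd> act1 ?R \<one>) \<Zsemi> (act1 (ihom_curry ?u v ?Y) (IHom V (IHom V ?u ?Y) (IHom V ?u ?Z) \<odot> \<one>)
       \<Zsemi> act2 (IHom V v (IHom V ?u ?Y)) (IHom V (IHom V ?u ?Y) (IHom V ?u ?Z))
          (VComp (self_enriched V) v (IHom V ?u ?Y) (IHom V ?u ?Z)) \<one>)"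
      by (simp add: act2_lact_Seq act2_act1_Seq)
    ultimately have "(?u \<rhd> v \<rhd> act2 ?H ?K ?l \<one>) \<Zsemi> ?E = (?u \<rhd> v \<rhd> act2 ?H ?K ?r \<one>) \<Zsemi> ?E"
      by (simp add: curry_act completion_act lact_act v_cat_simps self_enriched_act
        self_enriched_act(1,2)[THEN lact_eq_lact]
        self_enriched_act(1,2)[THEN lact_eq_lact, THEN Seq_eq_Seq]
        R_ev R_ev[THEN Seq_eq_Seq] R_ev[THEN lact_eq_lact] R_ev[THEN lact_eq_lact, THEN Seq_eq_Seq])
    then have "((?u \<rhd> v \<rhd> act2 ?H ?K ?l \<one>) \<Zsemi> ((?u \<rhd> ev_act v (IHom V ?u ?Z) \<one>) \<Zsemi> ev_act ?u ?Z \<one>))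
        \<Zsemi> \<alpha> (VHom C ?a ?c) ?t \<one>
      = ((?u \<rhd> v \<rhd> act2 ?H ?K ?r \<one>) \<Zsemi> ((?u \<rhd> ev_act v (IHom V ?u ?Z) \<one>) \<Zsemi> ev_act ?u ?Z \<one>))
        \<Zsemi> \<alpha> (VHom C ?a ?c) ?t \<one>"
      by (simp add: tenev_def)
    then show "(?u \<rhd> v \<rhd> (\<i>\<n>\<v> (\<alpha> ?H ?K \<one>) \<Zsemi> act1 ?l \<one>)) \<Zsemi> ((?u \<rhd> ev_act v (IHom V ?u ?Z) \<one>) \<Zsemi> ev_act ?u ?Z \<one>)
      = (?u \<rhd> v \<rhd> (\<i>\<n>\<v> (\<alpha> ?H ?K \<one>) \<Zsemi> act1 ?r \<one>)) \<Zsemi> ((?u \<rhd> ev_act v (IHom V ?u ?Z) \<one>) \<Zsemi> ev_act ?u ?Z \<one>)"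
      unfolding act2_eq[symmetric, of ?H ?K] by (rule iso_cancel_right) simp_all
  qed (simp_all add: iso_inv)
qed

lemma tensored_v_category_completion: "tensored_v_category V (completion V C) (completion_tensoring V C)"
proof (intro tensored_v_category.intro tensored_v_category_axioms.intro closed_monoidal_category_axioms
    v_category_completion)
  fix x
  assume x: "x \<in> VObj (completion V C)"
  then have [simp]: "base x \<in> VObj C" "weight x \<in> Obj V"
    by simp_all
  have R: "v_functor V (completion V C) (self_enriched V) (representable V (completion V C) x)"
    by (rule v_functor_representable) (simp_all add: v_category_completion)
  have [simp]: "FObj (representable V (completion V C) x) z
    = IHom V (weight x) (VHom C (base x) (base z) \<odot> weight z)" for z
    by (simp add: representable_def)
  have [simp]: "FMap (representable V (completion V C) x) y z \<in> Arr V"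
    "Dom V (FMap (representable V (completion V C) x) y z)
      = IHom V (weight y) (VHom C (base y) (base z) \<odot> weight z)"
    "Cod V (FMap (representable V (completion V C) x) y z)
      = IHom V (IHom V (weight x) (VHom C (base x) (base y) \<odot> weight y))
         (IHom V (weight x) (VHom C (base x) (base z) \<odot> weight z))"
    if "y \<in> VObj (completion V C)" "z \<in> VObj (completion V C)" for y z
    using v_functor.FMap_typing[OF R that] by simp_all
  show "v_adjunction V (self_enriched V) (completion V C) (tensor_functor (completion_tensoring V C) x)
    (representable V (completion V C) x) (TIso (completion_tensoring V C) x)"
  proof (intro v_adjunction.intro v_functor_tensor_completion[OF x] R, unfold_locales)
    fix v w y z
    assume "v \<in> VObj (self_enriched V)" "w \<in> VObj (self_enriched V)"
      and "y \<in> VObj (completion V C)" "z \<in> VObj (completion V C)"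
    then have [simp]: "v \<in> Obj V" "w \<in> Obj V"
      "base y \<in> VObj C" "weight y \<in> Obj V" "base z \<in> VObj C" "weight z \<in> Obj V"
      by simp_all
    show "(FMap (tensor_functor (completion_tensoring V C) x) v w \<otimes>
          \<i>\<d> (VHom (completion V C) (FObj (tensor_functor (completion_tensoring V C) x) w) y))
        \<Zsemi> VComp (completion V C) (FObj (tensor_functor (completion_tensoring V C) x) v)
           (FObj (tensor_functor (completion_tensoring V C) x) w) y
        \<Zsemi> TIso (completion_tensoring V C) x v y
      = (\<i>\<d> (VHom (self_enriched V) v w) \<otimes> TIso (completion_tensoring V C) x w y)
        \<Zsemi> VComp (self_enriched V) v w (FObj (representable V (completion V C) x) y)"
      using completion_adj_natural_left[of x y v w] by (simp flip: act1_def lact_def)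
    show "VComp (completion V C) (FObj (tensor_functor (completion_tensoring V C) x) v) y z
        \<Zsemi> TIso (completion_tensoring V C) x v z
      = (TIso (completion_tensoring V C) x v y \<otimes> FMap (representable V (completion V C) x) y z)
        \<Zsemi> VComp (self_enriched V) v (FObj (representable V (completion V C) x) y)
            (FObj (representable V (completion V C) x) z)"
      using completion_adj_natural_right[of x y z v] by (simp add: TenA_eq)
  qed (simp_all add: hom_iff iso_curry)
qed

end

section \<open>The universal property of tensors\<close>

context monoidal_category
begin

text \<open>\<open>tensor_mate\<close> and \<open>postcomp\<close> begin with an inverse right
  unitor. The triangle trades it for the left unitor inside \<open>act0\<close>, which brings them
  into the form of families.\<close>

lemma act1_inv_RUnit_lact:
  assumes "h \<in> Arr V" "Dom V h = \<one>" "Cod V h = H" "e \<in> Arr V" "Dom V e = v \<odot> H" "v \<in> Obj V" "x \<in> Obj V"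
  shows "act1 (\<i>\<n>\<v> (\<rho> v)) x \<Zsemi> (act1 (v \<rhd> h) x \<Zsemi> act1 e x) = (v \<rhd> act0 h x) \<Zsemi> act2 v H e x"
proof -
  have H: "H \<in> Obj V"
    using Cod_Obj[OF assms(1)] assms(3) by simp
  have "(v \<rhd> \<i>\<n>\<v> (\<lambda>\<^sub>V x)) \<Zsemi> \<i>\<n>\<v> (\<alpha> v \<one> x) = act1 (\<i>\<n>\<v> (\<rho> v)) x"
    using assms by (simp flip: Assoc_inv_RUnit(2))
  from this[THEN Seq_eq_Seq, of "act1 (v \<rhd> h) x \<Zsemi> act1 e x"] show ?thesis
    using assms H Assoc_inv_nat2[of h v x, THEN Seq_eq_Seq, of "act1 e x"]
    by (simp add: act0_eq act2_eq)
qed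

end

context tensored_v_category
begin

lemma TObj_VObj [simp]: "\<lbrakk>a \<in> VObj D; v \<in> Obj V\<rbrakk> \<Longrightarrow> TObj T a v \<in> VObj D"
  using v_functor.FObj_closed[OF v_adjunction.axioms(1)[OF tensor_adjunction[of a]], of v]
  by (simp add: tensor_functor_def)

lemma TIso_typing [simp]:
  assumes "a \<in> VObj D" "v \<in> Obj V" "b \<in> VObj D"
  shows "TIso T a v b \<in> Arr V" "Dom V (TIso T a v b) = VHom D (TObj T a v) b"
    "Cod V (TIso T a v b) = IHom V v (VHom D a b)" "is_iso V (TIso T a v b)"
  using v_adjunction.adj_hom[OF tensor_adjunction[OF assms(1)], of v b]
    v_adjunction.adj_iso[OF tensor_adjunction[OF assms(1)], of v b] assms
  by (simp_all add: hom_iff tensor_functor_def representable_def)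

abbreviation unit :: "'b \<Rightarrow> 'o \<Rightarrow> 'm" where
  "unit a v \<equiv> tensor_unit V D T a v"

lemma unit_eq:
  assumes "a \<in> VObj D" "v \<in> Obj V"
  shows "unit a v = \<i>\<n>\<v> (\<rho> v) \<Zsemi> ((v \<rhd> (VId D (TObj T a v) \<Zsemi> TIso T a v (TObj T a v)))
    \<Zsemi> \<epsilon> v (VHom D a (TObj T a v)))"
  using assms by (simp add: tensor_unit_def tensor_mate_def lact_unmate)

lemma unit_typing [simp]:
  assumes "a \<in> VObj D" "v \<in> Obj V"
  shows "unit a v \<in> Arr V" "Dom V (unit a v) = v" "Cod V (unit a v) = VHom D a (TObj T a v)"
  using assms by (simp_all add: unit_eq)

lemma act1_unit:
  assumes "a \<in> VObj D" "v \<in> Obj V" "x \<in> Obj V"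
  shows "act1 (unit a v) x
    = (v \<rhd> (id_act D (TObj T a v) x \<Zsemi> act1 (TIso T a v (TObj T a v)) x)) \<Zsemi> ev_act v (VHom D a (TObj T a v)) x"
  using assms act1_inv_RUnit_lact[of "VId D (TObj T a v) \<Zsemi> TIso T a v (TObj T a v)"
    "IHom V v (VHom D a (TObj T a v))" "\<epsilon> v (VHom D a (TObj T a v))" v x]
  by (simp add: unit_eq)

text \<open>The Yoneda argument: by naturality in the second variable, \<open>TIso\<close> is
  determined by its value on the identity of \<open>TObj T a v\<close>, and that value is the
  unit.\<close>

lemma act1_TIso:
  assumes [simp]: "a \<in> VObj D" "v \<in> Obj V" "b \<in> VObj D" "x \<in> Obj V"
  shows "(v \<rhd> act1 (TIso T a v b) x) \<Zsemi> ev_act v (VHom D a b) x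
    = act1 (unit a v) (VHom D (TObj T a v) b \<odot> x) \<Zsemi> comp_act D a (TObj T a v) b x"
proof -
  let ?t = "TObj T a v" and ?\<phi> = "TIso T a v"
  let ?H = "VHom D ?t b" and ?R = "FMap (representable V D a) ?t b"
  interpret adj: v_adjunction V "self_enriched V" D "tensor_functor T a" "representable V D a" "TIso T a"
    by (rule tensor_adjunction) simp
  have [simp]: "FObj (representable V D a) c = VHom D a c" "FObj (tensor_functor T a) v = ?t" for c
    by (simp_all add: representable_def tensor_functor_def)
  have R [simp]: "?R \<in> Arr V" "Dom V ?R = ?H" "Cod V ?R = IHom V (VHom D a ?t) (VHom D a b)"
    using adj.R.FMap_typing[of ?t b] by simp_all
  note R_ev = v_functor_representable(2)[OF v_category_axioms, of a ?t b]
  have "VComp D ?t ?t b \<Zsemi> ?\<phi> b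
    = (VHom D ?t ?t \<rhd> ?R) \<Zsemi> (act1 (?\<phi> ?t) (IHom V (VHom D a ?t) (VHom D a b))
       \<Zsemi> VComp (self_enriched V) v (VHom D a ?t) (VHom D a b))"
    using adj.adj_natural_right[of v ?t b] by (simp add: TenA_eq)
  then have "act2 (VHom D ?t ?t) ?H (VComp D ?t ?t b \<Zsemi> ?\<phi> b) x
    = act2 (VHom D ?t ?t) ?H ((VHom D ?t ?t \<rhd> ?R) \<Zsemi> (act1 (?\<phi> ?t) (IHom V (VHom D a ?t) (VHom D a b))
       \<Zsemi> VComp (self_enriched V) v (VHom D a ?t) (VHom D a b))) x"
    by simp
  moreover have "act2 (VHom D ?t ?t) ?H (VComp D ?t ?t b \<Zsemi> ?\<phi> b) x
    = comp_act D ?t ?t b x \<Zsemi> act1 (?\<phi> b) x"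
    by (simp add: act2_Seq)
  ultimately have nat: "comp_act D ?t ?t b x \<Zsemi> act1 (?\<phi> b) x
    = (VHom D ?t ?t \<rhd> act1 ?R x) \<Zsemi> (act1 (?\<phi> ?t) (IHom V (VHom D a ?t) (VHom D a b) \<odot> x)
       \<Zsemi> act2 (IHom V v (VHom D a ?t)) (IHom V (VHom D a ?t) (VHom D a b))
          (VComp (self_enriched V) v (VHom D a ?t) (VHom D a b)) x)"
    by (simp add: act2_lact_Seq act2_act1_Seq)
  \<comment> \<open>The identity of \<open>?t\<close> is inserted on the left; \<open>nat\<close>
    then moves \<open>?\<phi>\<close> from the composite onto that identity.\<close>
  have "act1 (?\<phi> b) x = id_act D ?t (?H \<odot> x) \<Zsemi> (comp_act D ?t ?t b x \<Zsemi> act1 (?\<phi> b) x)"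
    by (simp add: v_cat_simps)
  also have "\<dots> = id_act D ?t (?H \<odot> x) \<Zsemi> (act1 (?\<phi> ?t) (?H \<odot> x) \<Zsemi>
      ((IHom V v (VHom D a ?t) \<rhd> act1 ?R x)
       \<Zsemi> act2 (IHom V v (VHom D a ?t)) (IHom V (VHom D a ?t) (VHom D a b))
          (VComp (self_enriched V) v (VHom D a ?t) (VHom D a b)) x))"
    unfolding nat by (simp add: lact_act1[THEN Seq_eq_Seq])
  finally have eq: "act1 (?\<phi> b) x = \<dots>" .
  have "(v \<rhd> act1 (?\<phi> b) x) \<Zsemi> ev_act v (VHom D a b) x
    = (v \<rhd> id_act D ?t (?H \<odot> x)) \<Zsemi> ((v \<rhd> act1 (?\<phi> ?t) (?H \<odot> x)) \<Zsemi> (ev_act v (VHom D a ?t) (?H \<odot> x)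
       \<Zsemi> comp_act D a ?t b x))"
    unfolding eq by (simp add: self_enriched_act lact_act2[THEN Seq_eq_Seq] R_ev)
  then show ?thesis
    by (simp add: act1_unit)
qed

text \<open>By \<open>act1_TIso\<close> this family is \<open>TIso\<close> followed by evaluation:
  evaluation detects, and \<open>TIso\<close> is invertible. It is the uniqueness half of the
  universal property of the tensor.\<close>

lemma detects_unit:
  assumes "a \<in> VObj D" "v \<in> Obj V" "b \<in> VObj D"
  shows "detects v (VHom D (TObj T a v) b)
    (\<lambda>x. act1 (unit a v) (VHom D (TObj T a v) b \<odot> x) \<Zsemi> comp_act D a (TObj T a v) b x)"
proof -
  let ?t = "TObj T a v"
  have "h = h'"
    if h: "h \<in> Arr V" "h' \<in> Arr V" "Dom V h' = Dom V h" "Cod V h = VHom D ?t b" "Cod V h' = VHom D ?t b"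
      and eq: "(v \<rhd> act1 h \<one>) \<Zsemi> (act1 (unit a v) (VHom D ?t b \<odot> \<one>) \<Zsemi> comp_act D a ?t b \<one>)
        = (v \<rhd> act1 h' \<one>) \<Zsemi> (act1 (unit a v) (VHom D ?t b \<odot> \<one>) \<Zsemi> comp_act D a ?t b \<one>)" for h h'
  proof -
    have "h \<Zsemi> TIso T a v b = h' \<Zsemi> TIso T a v b"
    proof (rule detectsD[OF detects_ev_act])
      show "(v \<rhd> (\<i>\<d> (Dom V h \<odot> \<one>) \<Zsemi> act1 (h \<Zsemi> TIso T a v b) \<one>)) \<Zsemi> ev_act v (VHom D a b) \<one>
        = (v \<rhd> (\<i>\<d> (Dom V h \<odot> \<one>) \<Zsemi> act1 (h' \<Zsemi> TIso T a v b) \<one>)) \<Zsemi> ev_act v (VHom D a b) \<one>"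
        using h assms eq by (simp add: act1_TIso)
    qed (use h assms in \<open>simp_all add: isoI[of "\<i>\<d> x" "\<i>\<d> x" for x]\<close>)
    then show "h = h'"
      by (rule iso_cancel_right) (use h assms in simp_all)
  qed
  then show ?thesis
    using assms by (simp add: detects_def)
qed

text \<open>The arrow \<open>w \<rightarrow> D(TObj T a v \<rightarrow> b)\<close> that corresponds to \<open>g : v w \<rightarrow> D(a \<rightarrow> b)\<close>.\<close>

definition lift :: "'b \<Rightarrow> 'o \<Rightarrow> 'b \<Rightarrow> 'o \<Rightarrow> 'm \<Rightarrow> 'm" where
  "lift a v b w g = Mate V v w (VHom D a b) g \<Zsemi> \<i>\<n>\<v> (TIso T a v b)"

lemma lift_typing [simp]:
  assumes "a \<in> VObj D" "v \<in> Obj V" "b \<in> VObj D" "g \<in> Arr V" "Dom V g = v \<odot> w" "Cod V g = VHom D a b"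
    "w \<in> Obj V"
  shows "lift a v b w g \<in> Arr V" "Dom V (lift a v b w g) = w" "Cod V (lift a v b w g) = VHom D (TObj T a v) b"
  using assms by (simp_all add: lift_def)

text \<open>The existence half: by \<open>act1_TIso\<close> the unit exposes \<open>TIso\<close>,
  which cancels its inverse in \<open>lift\<close>, and the mate that is left evaluates to
  \<open>g\<close>.\<close>

lemma act1_lift:
  assumes "a \<in> VObj D" "v \<in> Obj V" "b \<in> VObj D" "g \<in> Arr V" "Dom V g = v \<odot> w" "Cod V g = VHom D a b"
    "w \<in> Obj V" "x \<in> Obj V"
  shows "(v \<rhd> act1 (lift a v b w g) x) \<Zsemi> (act1 (unit a v) (VHom D (TObj T a v) b \<odot> x)
      \<Zsemi> comp_act D a (TObj T a v) b x) = act2 v w g x"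
proof -
  have "(v \<rhd> act1 (lift a v b w g) x) \<Zsemi> ((v \<rhd> act1 (TIso T a v b) x) \<Zsemi> ev_act v (VHom D a b) x)
    = (v \<rhd> act1 (Mate V v w (VHom D a b) g) x) \<Zsemi> ev_act v (VHom D a b) x"
    using assms act1_inv(2)[THEN lact_eq_lact, THEN Seq_eq_Seq, of "TIso T a v b" x v "ev_act v (VHom D a b) x"]
    by (simp add: lift_def)
  also have "\<dots> = act2 v w g x"
    using assms by (simp add: act1_Mate_ev_act)
  finally show ?thesis
    using assms by (simp add: act1_TIso)
qed

text \<open>Uniqueness for arrows of the underlying category, with the unit moved to the front as
  the normal form has it.\<close>

lemma act2_unit_inject:
  assumes "a \<in> VObj D" "v \<in> Obj V" "b \<in> VObj D"
    and "f \<in> Arr V" "g \<in> Arr V" "Dom V f = \<one>" "Dom V g = \<one>"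
      "Cod V f = VHom D (TObj T a v) b" "Cod V g = VHom D (TObj T a v) b"
    and "act1 (unit a v) \<one> \<Zsemi> ((VHom D a (TObj T a v) \<rhd> act0 f \<one>) \<Zsemi> comp_act D a (TObj T a v) b \<one>)
      = act1 (unit a v) \<one> \<Zsemi> ((VHom D a (TObj T a v) \<rhd> act0 g \<one>) \<Zsemi> comp_act D a (TObj T a v) b \<one>)"
  shows "f = g"
proof (rule detectsD[OF detects_unit[of a v b]])
  show "(v \<rhd> (\<i>\<n>\<v> (\<lambda>\<^sub>V \<one>) \<Zsemi> act1 f \<one>)) \<Zsemi> (act1 (unit a v) (VHom D (TObj T a v) b \<odot> \<one>) \<Zsemi> comp_act D a (TObj T a v) b \<one>)
    = (v \<rhd> (\<i>\<n>\<v> (\<lambda>\<^sub>V \<one>) \<Zsemi> act1 g \<one>)) \<Zsemi> (act1 (unit a v) (VHom D (TObj T a v) b \<odot> \<one>) \<Zsemi> comp_act D a (TObj T a v) b \<one>)"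
    unfolding act0_eq[symmetric] using assms by (simp add: lact_act1[THEN Seq_eq_Seq])
qed (use assms in \<open>simp_all add: iso_inv\<close>)

lemma tensor_unmate_lift:
  assumes "a \<in> VObj D" "v \<in> Obj V" "b \<in> VObj D" "g \<in> Arr V" "Dom V g = v" "Cod V g = VHom D a b"
  shows "tensor_unmate V D T a v b g = lift a v b \<one> (\<rho> v \<Zsemi> g)"
  by (simp add: tensor_unmate_def lift_def)

text \<open>Existence in the same setting: the unitor that makes \<open>g\<close> start at
  \<open>v \<odot> \<one>\<close> cancels by the triangle. Through \<open>tensor_unmate_lift\<close>
  it applies to the tensorator.\<close>

lemma act0_lift:
  assumes "a \<in> VObj D" "v \<in> Obj V" "b \<in> VObj D" "g \<in> Arr V" "Dom V g = v" "Cod V g = VHom D a b"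
    "x \<in> Obj V"
  shows "act1 (unit a v) x \<Zsemi> ((VHom D a (TObj T a v) \<rhd> act0 (lift a v b \<one> (\<rho> v \<Zsemi> g)) x)
      \<Zsemi> comp_act D a (TObj T a v) b x) = act1 g x"
proof -
  have "act1 (unit a v) x \<Zsemi> ((VHom D a (TObj T a v) \<rhd> act0 (lift a v b \<one> (\<rho> v \<Zsemi> g)) x)
      \<Zsemi> comp_act D a (TObj T a v) b x)
    = (v \<rhd> act0 (lift a v b \<one> (\<rho> v \<Zsemi> g)) x)
      \<Zsemi> (act1 (unit a v) (VHom D (TObj T a v) b \<odot> x) \<Zsemi> comp_act D a (TObj T a v) b x)"
    using assms by (simp add: lact_act1[THEN Seq_eq_Seq])
  also have "\<dots> = (v \<rhd> \<i>\<n>\<v> (\<lambda>\<^sub>V x)) \<Zsemi> act2 v \<one> (\<rho> v \<Zsemi> g) x"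
    using assms by (simp add: act0_eq act1_lift)
  also have "\<dots> = act1 g x"
    using assms Assoc_inv_RUnit(1)[of v x, THEN Seq_eq_Seq, of "act1 g x"]
    by (simp add: act2_eq)
  finally show ?thesis .
qed

end

section \<open>The extension of a functor to the completion\<close>

locale tensored_extension = closed_v_category V C + D: tensored_v_category V D T + F: v_functor V C D F
  for V :: "('o, 'm) closed_monoidal_category" (structure)
    and C :: "('o, 'm, 'a) vcategory"
    and D :: "('o, 'm, 'b) vcategory"
    and T :: "('o, 'm, 'b) tensoring"
    and F :: "('a, 'b, 'm) vfunctor"
begin

abbreviation ext_obj :: "'a \<Rightarrow> 'o \<Rightarrow> 'b" where
  "ext_obj a u \<equiv> TObj T (FObj F a) u"

definition ext_arr :: "'a \<Rightarrow> 'o \<Rightarrow> 'a \<Rightarrow> 'o \<Rightarrow> 'm" where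
  "ext_arr a u b v = D.lift (FObj F a) u (ext_obj b v) (IHom V u (VHom C a b \<odot> v))
     (\<epsilon> u (VHom C a b \<odot> v) \<Zsemi> (act1 (FMap F a b) v
       \<Zsemi> ((VHom D (FObj F a) (FObj F b) \<rhd> D.unit (FObj F b) v)
         \<Zsemi> VComp D (FObj F a) (FObj F b) (ext_obj b v))))"

definition extension :: "(('a, 'o) formal_tensor, 'b, 'm) vfunctor" where
  "extension = \<lparr>FObj = \<lambda>x. ext_obj (base x) (weight x),
     FMap = \<lambda>x y. ext_arr (base x) (weight x) (base y) (weight y)\<rparr>"

abbreviation ext_unit :: "'a \<Rightarrow> 'o \<Rightarrow> 'm" where
  "ext_unit a u \<equiv> D.unit (FObj F a) u"

lemma ext_arr_typing [simp]:
  assumes "a \<in> VObj C" "u \<in> Obj V" "b \<in> VObj C" "v \<in> Obj V"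
  shows "ext_arr a u b v \<in> Arr V" "Dom V (ext_arr a u b v) = IHom V u (VHom C a b \<odot> v)"
    "Cod V (ext_arr a u b v) = VHom D (ext_obj a u) (ext_obj b v)"
  using assms by (simp_all add: ext_arr_def)

text \<open>\<open>act1_lift\<close> returns the defining arrow, and sliding two associators splits
  it into its factors. By \<open>detects_unit\<close> the equation characterises
  \<open>ext_arr\<close>.\<close>

lemma act1_ext_arr:
  assumes [simp]: "a \<in> VObj C" "u \<in> Obj V" "b \<in> VObj C" "v \<in> Obj V" "x \<in> Obj V"
  shows "(u \<rhd> act1 (ext_arr a u b v) x) \<Zsemi> (act1 (ext_unit a u) (VHom D (ext_obj a u) (ext_obj b v) \<odot> x)
      \<Zsemi> comp_act D (FObj F a) (ext_obj a u) (ext_obj b v) x)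
    = tenev u a b v x \<Zsemi> (act1 (FMap F a b) (v \<odot> x) \<Zsemi> ((VHom D (FObj F a) (FObj F b) \<rhd> act1 (ext_unit b v) x)
      \<Zsemi> comp_act D (FObj F a) (FObj F b) (ext_obj b v) x))"
proof -
  let ?D = "VHom D (FObj F a) (FObj F b)" and ?H = "IHom V u (VHom C a b \<odot> v)"
  let ?m = "VComp D (FObj F a) (FObj F b) (ext_obj b v)"
  let ?r = "act1 (FMap F a b) v \<Zsemi> ((?D \<rhd> ext_unit b v) \<Zsemi> ?m)"
  have "\<alpha> (VHom C a b) v x \<Zsemi> (act1 (FMap F a b) (v \<odot> x) \<Zsemi> ((?D \<rhd> act1 (ext_unit b v) x)
      \<Zsemi> comp_act D (FObj F a) (FObj F b) (ext_obj b v) x)) = act1 ?r x"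
    using Assoc_nat1[of "FMap F a b" v x, symmetric, THEN Seq_eq_Seq]
      Assoc_inv_nat2[of "ext_unit b v" ?D x, THEN Seq_eq_Seq, of "act1 ?m x"]
    by (simp add: act2_eq)
  then show ?thesis
    using D.act1_lift[of "FObj F a" u "ext_obj b v" "\<epsilon> u (VHom C a b \<odot> v) \<Zsemi> ?r" ?H x]
    by (simp add: ext_arr_def[symmetric] tenev_def act2_Seq)
qed

lemma unit_act1_ext_arr:
  assumes "a \<in> VObj C" "u \<in> Obj V" "b \<in> VObj C" "v \<in> Obj V" "x \<in> Obj V" "H = IHom V u (VHom C a b \<odot> v)"
  shows "act1 (ext_unit a u) (H \<odot> x) \<Zsemi> ((VHom D (FObj F a) (ext_obj a u) \<rhd> act1 (ext_arr a u b v) x)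
      \<Zsemi> comp_act D (FObj F a) (ext_obj a u) (ext_obj b v) x)
    = tenev u a b v x \<Zsemi> (act1 (FMap F a b) (v \<odot> x) \<Zsemi> ((VHom D (FObj F a) (FObj F b) \<rhd> act1 (ext_unit b v) x)
      \<Zsemi> comp_act D (FObj F a) (FObj F b) (ext_obj b v) x))"
  using act1_ext_arr[OF assms(1-5)] assms by (simp add: lact_act1[THEN Seq_eq_Seq])

text \<open>\<open>D.v_cat_simps\<close> composes from the outside, so behind a further factor
  \<open>D(d -> F a)\<close> the left side of \<open>unit_act1_ext_arr\<close> no longer occurs.
  This is its reassociated form, which applies when \<open>ext_arr\<close> is met inside a
  composite.\<close>

lemma lact_unit_act1_ext_arr:
  assumes "a \<in> VObj C" "u \<in> Obj V" "b \<in> VObj C" "v \<in> Obj V" "x \<in> Obj V" "H = IHom V u (VHom C a b \<odot> v)"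
    "d \<in> VObj D"
  shows "(VHom D d (FObj F a) \<rhd> act1 (ext_unit a u) (H \<odot> x))
      \<Zsemi> (comp_act D d (FObj F a) (ext_obj a u) (H \<odot> x) \<Zsemi> ((VHom D d (ext_obj a u) \<rhd> act1 (ext_arr a u b v) x)
      \<Zsemi> comp_act D d (ext_obj a u) (ext_obj b v) x))
    = (VHom D d (FObj F a) \<rhd> tenev u a b v x) \<Zsemi> ((VHom D d (FObj F a) \<rhd> act1 (FMap F a b) (v \<odot> x))
      \<Zsemi> (comp_act D d (FObj F a) (FObj F b) (v \<odot> x)
      \<Zsemi> ((VHom D d (FObj F b) \<rhd> act1 (ext_unit b v) x) \<Zsemi> comp_act D d (FObj F b) (ext_obj b v) x)))"
proof -
  have "(VHom D d (FObj F a) \<rhd> (act1 (ext_unit a u) (H \<odot> x)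
        \<Zsemi> ((VHom D (FObj F a) (ext_obj a u) \<rhd> act1 (ext_arr a u b v) x)
          \<Zsemi> comp_act D (FObj F a) (ext_obj a u) (ext_obj b v) x)))
      \<Zsemi> comp_act D d (FObj F a) (ext_obj b v) x
    = (VHom D d (FObj F a) \<rhd> (tenev u a b v x \<Zsemi> (act1 (FMap F a b) (v \<odot> x)
        \<Zsemi> ((VHom D (FObj F a) (FObj F b) \<rhd> act1 (ext_unit b v) x)
          \<Zsemi> comp_act D (FObj F a) (FObj F b) (ext_obj b v) x))))
      \<Zsemi> comp_act D d (FObj F a) (ext_obj b v) x"
    unfolding unit_act1_ext_arr[OF assms(1-6)] ..
  then show ?thesis
    using assms by (simp add: lact_act D.v_cat_simps)
qed

lemma extension_simps [simp]:
  "FObj extension x = ext_obj (base x) (weight x)"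
  "FMap extension x y = ext_arr (base x) (weight x) (base y) (weight y)"
  by (simp_all add: extension_def)

lemma v_functor_extension: "v_functor V (completion V C) D extension"
proof (rule v_functorI[where s = weight and e = "\<lambda>x y p.
      act1 (ext_unit (base x) (weight x)) (VHom D (ext_obj (base x) (weight x)) (ext_obj (base y) (weight y)) \<odot> p)
      \<Zsemi> comp_act D (FObj F (base x)) (ext_obj (base x) (weight x)) (ext_obj (base y) (weight y)) p"])
  fix x y z p
  assume "x \<in> VObj (completion V C)" "y \<in> VObj (completion V C)" "z \<in> VObj (completion V C)"
    and [simp]: "p \<in> Obj V"
  then have [simp]: "base x \<in> VObj C" "weight x \<in> Obj V" "base y \<in> VObj C" "weight y \<in> Obj V"
    "base z \<in> VObj C" "weight z \<in> Obj V"
    by simp_all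
  let ?e = "\<lambda>x y p. act1 (ext_unit (base x) (weight x))
        (VHom D (ext_obj (base x) (weight x)) (ext_obj (base y) (weight y)) \<odot> p)
      \<Zsemi> comp_act D (FObj F (base x)) (ext_obj (base x) (weight x)) (ext_obj (base y) (weight y)) p"
  have "(weight x \<rhd> (comp_act (completion V C) x y z p \<Zsemi> act1 (FMap extension x z) p)) \<Zsemi> ?e x z p
    = (weight x \<rhd> (comp_act (completion V C) x y z p)) \<Zsemi> ((weight x \<rhd> act1 (FMap extension x z) p) \<Zsemi> ?e x z p)"
    by simp
  also have "\<dots> = tenev (weight x) (base x) (base y) (weight y) (VHom (completion V C) y z \<odot> p)
     \<Zsemi> ((VHom C (base x) (base y) \<rhd> tenev (weight y) (base y) (base z) (weight z) p)
       \<Zsemi> (comp_act C (base x) (base y) (base z) (weight z \<odot> p)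
     \<Zsemi> (act1 (FMap F (base x) (base z)) (weight z \<odot> p)
     \<Zsemi> ((VHom D (FObj F (base x)) (FObj F (base z)) \<rhd> act1 (ext_unit (base z) (weight z)) p)
     \<Zsemi> comp_act D (FObj F (base x)) (FObj F (base z)) (ext_obj (base z) (weight z)) p))))"
    by (simp add: act1_ext_arr completion_act)
  \<comment> \<open>Functoriality of \<open>F\<close> enters here: it replaces composition in
    \<open>C\<close> followed by \<open>F\<close> by \<open>F\<close> on both factors followed by
    composition in \<open>D\<close>.\<close>
  also have "\<dots> = (weight x \<rhd> ((VHom (completion V C) x y \<rhd> act1 (FMap extension y z) p)
            \<Zsemi> (act1 (FMap extension x y) (VHom D (FObj extension y) (FObj extension z) \<odot> p)
              \<Zsemi> comp_act D (FObj extension x) (FObj extension y) (FObj extension z) p))) \<Zsemi> ?e x z p"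
    by (simp add: lact_act completion_act D.v_cat_simps F.v_fun_simps unit_act1_ext_arr lact_unit_act1_ext_arr
      unit_act1_ext_arr[THEN Seq_eq_Seq3])
  finally show "(weight x \<rhd> (comp_act (completion V C) x y z p \<Zsemi> act1 (FMap extension x z) p)) \<Zsemi> ?e x z p
    = (weight x \<rhd> ((VHom (completion V C) x y \<rhd> act1 (FMap extension y z) p)
            \<Zsemi> (act1 (FMap extension x y) (VHom D (FObj extension y) (FObj extension z) \<odot> p)
              \<Zsemi> comp_act D (FObj extension x) (FObj extension y) (FObj extension z) p))) \<Zsemi> ?e x z p" .
  have "(weight x \<rhd> (id_act (completion V C) x p \<Zsemi> act1 (FMap extension x x) p)) \<Zsemi> ?e x x p
    = (weight x \<rhd> id_act (completion V C) x p) \<Zsemi> ((weight x \<rhd> act1 (FMap extension x x) p) \<Zsemi> ?e x x p)"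
    by simp
  also have "\<dots> = id_act C (base x) (weight x \<odot> p) \<Zsemi> (act1 (FMap F (base x) (base x)) (weight x \<odot> p)
     \<Zsemi> ((VHom D (FObj F (base x)) (FObj F (base x)) \<rhd> act1 (ext_unit (base x) (weight x)) p)
     \<Zsemi> comp_act D (FObj F (base x)) (FObj F (base x)) (ext_obj (base x) (weight x)) p))"
    by (simp add: act1_ext_arr completion_act)
  also have "\<dots> = (weight x \<rhd> id_act D (FObj extension x) p) \<Zsemi> ?e x x p"
    by (simp add: lact_act D.v_cat_simps F.v_fun_simps)
  finally show "(weight x \<rhd> (id_act (completion V C) x p \<Zsemi> act1 (FMap extension x x) p)) \<Zsemi> ?e x x p
    = (weight x \<rhd> id_act D (FObj extension x) p) \<Zsemi> ?e x x p" .
qed (simp_all add: v_category_completion D.v_category_axioms hom_iff D.detects_unit)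

end

section \<open>The tensorator of the extension\<close>

context v_category
begin

text \<open>The domain of \<open>g\<close> is left free so that one formula covers several uses:
  with \<open>g\<close> an action on homs it is a side of the naturality square, and with domain
  \<one> it is \<open>ucomp\<close>.\<close>

definition precomp :: "'a \<Rightarrow> 'a \<Rightarrow> 'a \<Rightarrow> 'm \<Rightarrow> 'm \<Rightarrow> 'm" where
  "precomp a b c j g = \<i>\<n>\<v> (\<lambda>\<^sub>V (Dom V g)) \<Zsemi> (j \<otimes> g) \<Zsemi> VComp C a b c"

definition postcomp :: "'a \<Rightarrow> 'a \<Rightarrow> 'a \<Rightarrow> 'm \<Rightarrow> 'm \<Rightarrow> 'm" where
  "postcomp a b c g j = \<i>\<n>\<v> (\<rho> (Dom V g)) \<Zsemi> (g \<otimes> j) \<Zsemi> VComp C a b c"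

lemma precomp_typing [simp]:
  assumes "a \<in> VObj C" "b \<in> VObj C" "c \<in> VObj C" "j \<in> Arr V" "Dom V j = \<one>" "Cod V j = VHom C a b"
    "g \<in> Arr V" "Cod V g = VHom C b c"
  shows "precomp a b c j g \<in> Arr V" "Dom V (precomp a b c j g) = Dom V g"
    "Cod V (precomp a b c j g) = VHom C a c"
  using assms by (simp_all add: precomp_def)

lemma postcomp_typing [simp]:
  assumes "a \<in> VObj C" "b \<in> VObj C" "c \<in> VObj C" "j \<in> Arr V" "Dom V j = \<one>" "Cod V j = VHom C b c"
    "g \<in> Arr V" "Cod V g = VHom C a b"
  shows "postcomp a b c g j \<in> Arr V" "Dom V (postcomp a b c g j) = Dom V g"
    "Cod V (postcomp a b c g j) = VHom C a c"
  using assms by (simp_all add: postcomp_def)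

lemma act1_precomp:
  assumes "a \<in> VObj C" "b \<in> VObj C" "c \<in> VObj C" "j \<in> Arr V" "Dom V j = \<one>" "Cod V j = VHom C a b"
    "g \<in> Arr V" "Cod V g = VHom C b c" "x \<in> Obj V"
  shows "act1 (precomp a b c j g) x
    = act1 g x \<Zsemi> (act0 j (VHom C b c \<odot> x) \<Zsemi> comp_act C a b c x)"
proof -
  let ?H = "VHom C b c" and ?u = "Dom V g"
  let ?k = "act1 (act1 j ?H) x \<Zsemi> act1 (VComp C a b c) x"
  have "act1 (\<i>\<n>\<v> (\<lambda>\<^sub>V ?u)) x = \<i>\<n>\<v> (\<lambda>\<^sub>V (?u \<odot> x)) \<Zsemi> \<i>\<n>\<v> (\<alpha> \<one> ?u x)"
    using assms by (simp flip: Assoc_inv_LUnit(2))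
  then have "act1 (precomp a b c j g) x
    = \<i>\<n>\<v> (\<lambda>\<^sub>V (?u \<odot> x)) \<Zsemi> (\<i>\<n>\<v> (\<alpha> \<one> ?u x) \<Zsemi> (act1 (\<one> \<rhd> g) x \<Zsemi> ?k))"
    using assms by (simp add: precomp_def TenA_eq)
  also have "\<dots> = \<i>\<n>\<v> (\<lambda>\<^sub>V (?u \<odot> x)) \<Zsemi> ((\<one> \<rhd> act1 g x) \<Zsemi> (\<i>\<n>\<v> (\<alpha> \<one> ?H x) \<Zsemi> ?k))"
    using assms Assoc_inv_nat2[of g \<one> x, THEN Seq_eq_Seq, of ?k] by simp
  also have "\<dots> = act1 g x \<Zsemi> (\<i>\<n>\<v> (\<lambda>\<^sub>V (?H \<odot> x)) \<Zsemi> (\<i>\<n>\<v> (\<alpha> \<one> ?H x) \<Zsemi> ?k))"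
    using assms LUnit_inv_nat[of "act1 g x", THEN Seq_eq_Seq, of "\<i>\<n>\<v> (\<alpha> \<one> ?H x) \<Zsemi> ?k"] by simp
  also have "\<i>\<n>\<v> (\<alpha> \<one> ?H x) \<Zsemi> ?k = act1 j (?H \<odot> x) \<Zsemi> comp_act C a b c x"
    using assms Assoc_inv_nat1[of j ?H x, THEN Seq_eq_Seq, of "act1 (VComp C a b c) x"] by (simp add: act2_eq)
  finally show ?thesis
    using assms by (simp add: act0_eq)
qed

lemma act1_postcomp:
  assumes "a \<in> VObj C" "b \<in> VObj C" "c \<in> VObj C" "j \<in> Arr V" "Dom V j = \<one>" "Cod V j = VHom C b c"
    "g \<in> Arr V" "Cod V g = VHom C a b" "x \<in> Obj V"
  shows "act1 (postcomp a b c g j) x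
    = act1 g x \<Zsemi> ((VHom C a b \<rhd> act0 j x) \<Zsemi> comp_act C a b c x)"
proof -
  have "postcomp a b c g j
    = \<i>\<n>\<v> (\<rho> (Dom V g)) \<Zsemi> ((Dom V g \<rhd> j) \<Zsemi> (act1 g (VHom C b c) \<Zsemi> VComp C a b c))"
    using assms by (simp add: postcomp_def TenA_eq)
  then have "act1 (postcomp a b c g j) x
    = (Dom V g \<rhd> act0 j x) \<Zsemi> act2 (Dom V g) (VHom C b c) (act1 g (VHom C b c) \<Zsemi> VComp C a b c) x"
    using assms act1_inv_RUnit_lact[of j "VHom C b c" "act1 g (VHom C b c) \<Zsemi> VComp C a b c" "Dom V g" x]
    by simp
  also have "\<dots> = act1 g x \<Zsemi> ((VHom C a b \<rhd> act0 j x) \<Zsemi> comp_act C a b c x)"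
    using assms by (simp add: act2_act1_Seq lact_act1[THEN Seq_eq_Seq])
  finally show ?thesis .
qed

lemma ucomp_eq_precomp: "Dom V g = \<one> \<Longrightarrow> ucomp V C a b c f g = precomp a b c f g"
  by (simp add: ucomp_def precomp_def)

lemma ucomp_typing [simp]:
  assumes "a \<in> VObj C" "b \<in> VObj C" "c \<in> VObj C" "f \<in> Arr V" "Dom V f = \<one>" "Cod V f = VHom C a b"
    "g \<in> Arr V" "Dom V g = \<one>" "Cod V g = VHom C b c"
  shows "ucomp V C a b c f g \<in> Arr V" "Dom V (ucomp V C a b c f g) = \<one>"
    "Cod V (ucomp V C a b c f g) = VHom C a c"
  using assms by (simp_all add: ucomp_eq_precomp)

lemma act0_ucomp:
  assumes "a \<in> VObj C" "b \<in> VObj C" "c \<in> VObj C" "f \<in> Arr V" "Dom V f = \<one>" "Cod V f = VHom C a b"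
    "g \<in> Arr V" "Dom V g = \<one>" "Cod V g = VHom C b c" "x \<in> Obj V"
  shows "act0 (ucomp V C a b c f g) x = act0 f x \<Zsemi> ((VHom C a b \<rhd> act0 g x) \<Zsemi> comp_act C a b c x)"
  using assms by (simp add: act0_lact[THEN Seq_eq_Seq])
    (simp add: ucomp_eq_precomp act0_eq[of "precomp a b c f g"] act0_eq[of g] act1_precomp)

end

context tensored_extension
begin

sublocale bar: tensored_v_category V "completion V C" "completion_tensoring V C"
  by (rule tensored_v_category_completion)

sublocale ext: v_functor V "completion V C" D extension
  by (rule v_functor_extension)

text \<open>The unit comes from \<open>TIso\<close> on the identity of the tensor. The two
  evaluations undo the currying, and of the identity in the completion only that of \<open>C\<close>
  is left.\<close>

lemma lact_act1_bar_unit: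
  assumes "base x \<in> VObj C" "weight x \<in> Obj V" "v \<in> Obj V" "p \<in> Obj V"
  shows "(weight x \<rhd> act1 (bar.unit x v) p) \<Zsemi> tenev (weight x) (base x) (base x) (weight x \<odot> v) p
    = \<i>\<n>\<v> (\<alpha> (weight x) v p) \<Zsemi> id_act C (base x) (weight x \<odot> v \<odot> p)"
  using assms by (simp add: bar.act1_unit curry_act lact_act completion_act)

context
  fixes a u v
  assumes a [simp]: "a \<in> VObj C" and u [simp]: "u \<in> Obj V" and v [simp]: "v \<in> Obj V"
begin

text \<open>
  \<open>mu\<close> is the tensorator and \<open>nu\<close> its inverse; \<open>theta\<close> and \<open>kappa\<close> are their mates.
\<close>

definition theta :: 'm where
  "theta = bar.unit (a \<triangleleft> u) v \<Zsemi> ext_arr a u a (u \<odot> v)"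

definition kappa :: 'm where
  "kappa = act1 (ext_unit a u) v \<Zsemi> ((VHom D (FObj F a) (ext_obj a u) \<rhd> D.unit (ext_obj a u) v)
    \<Zsemi> VComp D (FObj F a) (ext_obj a u) (TObj T (ext_obj a u) v))"

definition mu :: 'm where
  "mu = D.lift (ext_obj a u) v (ext_obj a (u \<odot> v)) \<one> (\<rho> v \<Zsemi> theta)"

definition nu :: 'm where
  "nu = D.lift (FObj F a) (u \<odot> v) (TObj T (ext_obj a u) v) \<one> (\<rho> (u \<odot> v) \<Zsemi> kappa)"

lemma theta_typing [simp]:
  "theta \<in> Arr V" "Dom V theta = v" "Cod V theta = VHom D (ext_obj a u) (ext_obj a (u \<odot> v))"
  by (simp_all add: theta_def)

lemma kappa_typing [simp]:
  "kappa \<in> Arr V" "Dom V kappa = u \<odot> v" "Cod V kappa = VHom D (FObj F a) (TObj T (ext_obj a u) v)"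
  by (simp_all add: kappa_def)

lemma mu_typing [simp]:
  "mu \<in> Arr V" "Dom V mu = \<one>" "Cod V mu = VHom D (TObj T (ext_obj a u) v) (ext_obj a (u \<odot> v))"
  "nu \<in> Arr V" "Dom V nu = \<one>" "Cod V nu = VHom D (ext_obj a (u \<odot> v)) (TObj T (ext_obj a u) v)"
  by (simp_all add: mu_def nu_def)

text \<open>The unit of the completion contributes only the identity of \<open>a\<close>, which
  \<open>F\<close> sends to the identity of \<open>F a\<close>; that one composes away, and the unit
  for \<open>u \<odot> v\<close> remains.\<close>

lemma unit_theta:
  assumes [simp]: "p \<in> Obj V"
  shows "act1 (ext_unit a u) (v \<odot> p) \<Zsemi> ((VHom D (FObj F a) (ext_obj a u) \<rhd> act1 theta p)
      \<Zsemi> comp_act D (FObj F a) (ext_obj a u) (ext_obj a (u \<odot> v)) p)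
    = \<i>\<n>\<v> (\<alpha> u v p) \<Zsemi> act1 (ext_unit a (u \<odot> v)) p"
proof -
  have "act1 (ext_unit a u) (v \<odot> p) \<Zsemi> ((VHom D (FObj F a) (ext_obj a u) \<rhd> act1 theta p)
      \<Zsemi> comp_act D (FObj F a) (ext_obj a u) (ext_obj a (u \<odot> v)) p)
    = (u \<rhd> act1 theta p) \<Zsemi> (act1 (ext_unit a u) (VHom D (ext_obj a u) (ext_obj a (u \<odot> v)) \<odot> p)
      \<Zsemi> comp_act D (FObj F a) (ext_obj a u) (ext_obj a (u \<odot> v)) p)"
    by (simp add: lact_act1[THEN Seq_eq_Seq])
  also have "\<dots> = (u \<rhd> act1 (bar.unit (a \<triangleleft> u) v) p) \<Zsemi> ((u \<rhd> act1 (ext_arr a u a (u \<odot> v)) p)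
      \<Zsemi> (act1 (ext_unit a u) (VHom D (ext_obj a u) (ext_obj a (u \<odot> v)) \<odot> p)
      \<Zsemi> comp_act D (FObj F a) (ext_obj a u) (ext_obj a (u \<odot> v)) p))"
    by (simp add: theta_def)
  also have "\<dots> = ((u \<rhd> act1 (bar.unit (a \<triangleleft> u) v) p) \<Zsemi> tenev u a a (u \<odot> v) p)
      \<Zsemi> (act1 (FMap F a a) (u \<odot> v \<odot> p) \<Zsemi> ((VHom D (FObj F a) (FObj F a) \<rhd> act1 (ext_unit a (u \<odot> v)) p)
      \<Zsemi> comp_act D (FObj F a) (FObj F a) (ext_obj a (u \<odot> v)) p))"
    by (simp add: act1_ext_arr)
  also have "\<dots> = (\<i>\<n>\<v> (\<alpha> u v p) \<Zsemi> id_act C a (u \<odot> v \<odot> p))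
      \<Zsemi> (act1 (FMap F a a) (u \<odot> v \<odot> p) \<Zsemi> ((VHom D (FObj F a) (FObj F a) \<rhd> act1 (ext_unit a (u \<odot> v)) p)
      \<Zsemi> comp_act D (FObj F a) (FObj F a) (ext_obj a (u \<odot> v)) p))"
    using lact_act1_bar_unit[of "a \<triangleleft> u" v p] by simp
  also have "\<dots> = \<i>\<n>\<v> (\<alpha> u v p) \<Zsemi> act1 (ext_unit a (u \<odot> v)) p"
    by (simp add: lact_act D.v_cat_simps F.v_fun_simps)
  finally show ?thesis .
qed

lemma unit_mu:
  assumes [simp]: "p \<in> Obj V"
  shows "act1 (D.unit (ext_obj a u) v) p \<Zsemi> ((VHom D (ext_obj a u) (TObj T (ext_obj a u) v) \<rhd> act0 mu p)
      \<Zsemi> comp_act D (ext_obj a u) (TObj T (ext_obj a u) v) (ext_obj a (u \<odot> v)) p) = act1 theta p"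
  by (simp add: mu_def D.act0_lift)

lemma unit_nu:
  assumes [simp]: "p \<in> Obj V"
  shows "act1 (ext_unit a (u \<odot> v)) p \<Zsemi> ((VHom D (FObj F a) (ext_obj a (u \<odot> v)) \<rhd> act0 nu p)
      \<Zsemi> comp_act D (FObj F a) (ext_obj a (u \<odot> v)) (TObj T (ext_obj a u) v) p)
    = \<alpha> u v p \<Zsemi> (act1 (ext_unit a u) (v \<odot> p)
      \<Zsemi> ((VHom D (FObj F a) (ext_obj a u) \<rhd> act1 (D.unit (ext_obj a u) v) p)
      \<Zsemi> comp_act D (FObj F a) (ext_obj a u) (TObj T (ext_obj a u) v) p))"
proof -
  have "act1 kappa p = \<alpha> u v p \<Zsemi> act2 u v kappa p"
    by (simp add: act2_eq)
  also have "act2 u v kappa p = act1 (ext_unit a u) (v \<odot> p)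
      \<Zsemi> ((VHom D (FObj F a) (ext_obj a u) \<rhd> act1 (D.unit (ext_obj a u) v) p)
      \<Zsemi> comp_act D (FObj F a) (ext_obj a u) (TObj T (ext_obj a u) v) p)"
    by (simp add: kappa_def act2_act1_Seq act2_lact_Seq)
  finally show ?thesis
    by (simp add: nu_def D.act0_lift)
qed

text \<open>After the unit for \<open>u \<odot> v\<close>, \<open>nu\<close> produces the two units
  of which \<open>kappa\<close> is made, \<open>mu\<close> turns the second of them into
  \<open>theta\<close>, and \<open>unit_theta\<close> returns the unit for
  \<open>u \<odot> v\<close>.\<close>

lemma nu_mu:
  "ucomp V D (ext_obj a (u \<odot> v)) (TObj T (ext_obj a u) v) (ext_obj a (u \<odot> v)) nu mu = VId D (ext_obj a (u \<odot> v))"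
proof (rule D.act2_unit_inject[of "FObj F a" "u \<odot> v"])
  \<comment> \<open>\<open>unit_mu\<close> is applied under the first hom factor and then
    reassociated, because \<open>D.v_cat_simps\<close> would otherwise hide its left side.\<close>
  have "(VHom D (FObj F a) (ext_obj a u) \<rhd> (act1 (D.unit (ext_obj a u) v) \<one>
      \<Zsemi> ((VHom D (ext_obj a u) (TObj T (ext_obj a u) v) \<rhd> act0 mu \<one>)
      \<Zsemi> comp_act D (ext_obj a u) (TObj T (ext_obj a u) v) (ext_obj a (u \<odot> v)) \<one>)))
      \<Zsemi> comp_act D (FObj F a) (ext_obj a u) (ext_obj a (u \<odot> v)) \<one>
    = (VHom D (FObj F a) (ext_obj a u) \<rhd> act1 theta \<one>)
      \<Zsemi> comp_act D (FObj F a) (ext_obj a u) (ext_obj a (u \<odot> v)) \<one>"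
    by (subst unit_mu) simp_all
  then have mu: "(VHom D (FObj F a) (ext_obj a u) \<rhd> act1 (D.unit (ext_obj a u) v) \<one>)
      \<Zsemi> (comp_act D (FObj F a) (ext_obj a u) (TObj T (ext_obj a u) v) \<one>
      \<Zsemi> ((VHom D (FObj F a) (TObj T (ext_obj a u) v) \<rhd> act0 mu \<one>)
      \<Zsemi> comp_act D (FObj F a) (TObj T (ext_obj a u) v) (ext_obj a (u \<odot> v)) \<one>))
    = (VHom D (FObj F a) (ext_obj a u) \<rhd> act1 theta \<one>)
      \<Zsemi> comp_act D (FObj F a) (ext_obj a u) (ext_obj a (u \<odot> v)) \<one>"
    by (simp add: lact_act D.v_cat_simps)
  show "act1 (ext_unit a (u \<odot> v)) \<one> \<Zsemi> ((VHom D (FObj F a) (ext_obj a (u \<odot> v)) \<rhd>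
        act0 (ucomp V D (ext_obj a (u \<odot> v)) (TObj T (ext_obj a u) v) (ext_obj a (u \<odot> v)) nu mu) \<one>)
      \<Zsemi> comp_act D (FObj F a) (ext_obj a (u \<odot> v)) (ext_obj a (u \<odot> v)) \<one>)
    = act1 (ext_unit a (u \<odot> v)) \<one> \<Zsemi> ((VHom D (FObj F a) (ext_obj a (u \<odot> v)) \<rhd>
        act0 (VId D (ext_obj a (u \<odot> v))) \<one>)
      \<Zsemi> comp_act D (FObj F a) (ext_obj a (u \<odot> v)) (ext_obj a (u \<odot> v)) \<one>)"
    by (simp add: D.act0_ucomp D.v_cat_simps lact_act2 lact_act2[THEN Seq_eq_Seq]
      unit_nu unit_nu[THEN Seq_eq_Seq3] mu unit_theta)
qed simp_all

lemma mu_nu: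
  "ucomp V D (TObj T (ext_obj a u) v) (ext_obj a (u \<odot> v)) (TObj T (ext_obj a u) v) mu nu
    = VId D (TObj T (ext_obj a u) v)"
proof (rule D.act2_unit_inject[of "ext_obj a u" v])
  \<comment> \<open>The source is an iterated tensor, so a second detection is needed: removing the
    unit for \<open>v\<close> leaves this equation of arrows out of \<open>v\<close>, which is
    tested after the unit for \<open>u\<close>.\<close>
  have "D.postcomp (ext_obj a u) (ext_obj a (u \<odot> v)) (TObj T (ext_obj a u) v) theta nu = D.unit (ext_obj a u) v"
    (is "?l = ?r")
  proof (rule detectsD[OF D.detects_unit[of "FObj F a" u]])
    show "(u \<rhd> (\<i>\<d> (v \<odot> \<one>) \<Zsemi> act1 ?l \<one>)) \<Zsemi> (act1 (ext_unit a u) (VHom D (ext_obj a u) (TObj T (ext_obj a u) v) \<odot> \<one>)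
        \<Zsemi> comp_act D (FObj F a) (ext_obj a u) (TObj T (ext_obj a u) v) \<one>)
      = (u \<rhd> (\<i>\<d> (v \<odot> \<one>) \<Zsemi> act1 ?r \<one>)) \<Zsemi> (act1 (ext_unit a u) (VHom D (ext_obj a u) (TObj T (ext_obj a u) v) \<odot> \<one>)
        \<Zsemi> comp_act D (FObj F a) (ext_obj a u) (TObj T (ext_obj a u) v) \<one>)"
      by (simp add: D.act1_postcomp D.v_cat_simps lact_act unit_theta unit_theta[THEN Seq_eq_Seq3] unit_nu)
  qed (simp_all add: isoI[of "\<i>\<d> x" "\<i>\<d> x" for x])
  then have nu: "act1 theta \<one> \<Zsemi> ((VHom D (ext_obj a u) (ext_obj a (u \<odot> v)) \<rhd> act0 nu \<one>)
      \<Zsemi> comp_act D (ext_obj a u) (ext_obj a (u \<odot> v)) (TObj T (ext_obj a u) v) \<one>) = act1 (D.unit (ext_obj a u) v) \<one>"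
    using D.act1_postcomp[of "ext_obj a u" "ext_obj a (u \<odot> v)" "TObj T (ext_obj a u) v" nu theta \<one>] by simp
  show "act1 (D.unit (ext_obj a u) v) \<one> \<Zsemi> ((VHom D (ext_obj a u) (TObj T (ext_obj a u) v) \<rhd>
        act0 (ucomp V D (TObj T (ext_obj a u) v) (ext_obj a (u \<odot> v)) (TObj T (ext_obj a u) v) mu nu) \<one>)
      \<Zsemi> comp_act D (ext_obj a u) (TObj T (ext_obj a u) v) (TObj T (ext_obj a u) v) \<one>)
    = act1 (D.unit (ext_obj a u) v) \<one> \<Zsemi> ((VHom D (ext_obj a u) (TObj T (ext_obj a u) v) \<rhd>
        act0 (VId D (TObj T (ext_obj a u) v)) \<one>)
      \<Zsemi> comp_act D (ext_obj a u) (TObj T (ext_obj a u) v) (TObj T (ext_obj a u) v) \<one>)"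
    by (simp add: D.act0_ucomp D.v_cat_simps lact_act2 lact_act2[THEN Seq_eq_Seq]
      unit_mu unit_mu[THEN Seq_eq_Seq3] nu)
qed simp_all

lemma tensorator_extension:
  "tensorator V (completion V C) (completion_tensoring V C) D T extension (a \<triangleleft> u) v = mu"
  by (simp add: tensorator_def mu_def theta_def D.tensor_unmate_lift)

end

lemma tensored_v_functor_extension:
  "tensored_v_functor V (completion V C) (completion_tensoring V C) D T extension"
proof
  fix c v
  assume "c \<in> VObj (completion V C)" and v [simp]: "v \<in> Obj V"
  then obtain a u where c: "c = a \<triangleleft> u" and [simp]: "a \<in> VObj C" "u \<in> Obj V"
    by (cases c) auto
  have "inverse_arrows (underlying V D) (TObj T (ext_obj a u) v, mu a u v, ext_obj a (u \<odot> v))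
     (ext_obj a (u \<odot> v), nu a u v, TObj T (ext_obj a u) v)"
    by (simp add: inverse_arrows_def underlying_def hom_def nu_mu mu_nu)
  then show "is_iso (underlying V D) (TObj T (FObj extension c) v,
      tensorator V (completion V C) (completion_tensoring V C) D T extension c v,
      FObj extension (TObj (completion_tensoring V C) c v))"
    by (auto simp: is_iso_def c tensorator_extension)
qed

end

section \<open>Restriction along the inclusion\<close>

context monoidal_category
begin

lemma act1_eq_act0: "\<lbrakk>j \<in> Arr V; Dom V j = \<one>; x \<in> Obj V\<rbrakk> \<Longrightarrow> act1 j x = \<lambda>\<^sub>V x \<Zsemi> act0 j x"
  by (simp add: act0_eq)

lemma lact_LUnit: "\<lbrakk>f \<in> Arr V; y = Cod V f\<rbrakk> \<Longrightarrow> (\<one> \<rhd> f) \<Zsemi> \<lambda>\<^sub>V y = \<lambda>\<^sub>V (Dom V f) \<Zsemi> f"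
  by (simp add: LUnit_nat)

lemma Seq_LUnit_inv: "\<lbrakk>f \<in> Arr V; y = Cod V f\<rbrakk> \<Longrightarrow> f \<Zsemi> \<i>\<n>\<v> (\<lambda>\<^sub>V y) = \<i>\<n>\<v> (\<lambda>\<^sub>V (Dom V f)) \<Zsemi> (\<one> \<rhd> f)"
  by (simp add: LUnit_inv_nat)

text \<open>The two sides are instances of \<open>precomp\<close> and \<open>postcomp\<close>, whose
  families are known. For the way back from families, \<open>act1_inject\<close> is applied at
  \<one>.\<close>

lemma naturality_iff:
  assumes "v_functor V C D F" "v_functor V C D G" "a \<in> VObj C" "b \<in> VObj C"
    "t \<in> Arr V" "Dom V t = \<one>" "Cod V t = VHom D (FObj F a) (FObj G a)"
    "t' \<in> Arr V" "Dom V t' = \<one>" "Cod V t' = VHom D (FObj F b) (FObj G b)"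
  shows "\<i>\<n>\<v> (\<lambda>\<^sub>V (VHom C a b)) \<Zsemi> (t \<otimes> FMap G a b) \<Zsemi> VComp D (FObj F a) (FObj G a) (FObj G b)
      = \<i>\<n>\<v> (\<rho> (VHom C a b)) \<Zsemi> (FMap F a b \<otimes> t') \<Zsemi> VComp D (FObj F a) (FObj F b) (FObj G b)
    \<longleftrightarrow> (\<forall>x\<in>Obj V. act1 (FMap G a b) x \<Zsemi> (act0 t (VHom D (FObj G a) (FObj G b) \<odot> x)
          \<Zsemi> comp_act D (FObj F a) (FObj G a) (FObj G b) x)
        = act1 (FMap F a b) x \<Zsemi> ((VHom D (FObj F a) (FObj F b) \<rhd> act0 t' x)
          \<Zsemi> comp_act D (FObj F a) (FObj F b) (FObj G b) x))"
    (is "?l = ?r \<longleftrightarrow> (\<forall>x\<in>Obj V. ?L x = ?R x)")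
proof -
  interpret F: v_functor V C D F
    by fact
  interpret G: v_functor V C D G
    by fact
  note assms(3-) [simp]
  have l: "?l = F.D.precomp (FObj F a) (FObj G a) (FObj G b) t (FMap G a b)"
    by (simp add: F.D.precomp_def)
  have r: "?r = F.D.postcomp (FObj F a) (FObj F b) (FObj G b) (FMap F a b) t'"
    by (simp add: F.D.postcomp_def)
  have L: "act1 ?l x = ?L x" and R: "act1 ?r x = ?R x" if "x \<in> Obj V" for x
    using that unfolding l r by (simp_all add: F.D.act1_precomp F.D.act1_postcomp)
  show ?thesis
  proof
    assume "\<forall>x\<in>Obj V. ?L x = ?R x"
    then have "act1 ?l \<one> = act1 ?r \<one>"
      unfolding L[OF Unit_Obj] R[OF Unit_Obj] by simp
    then show "?l = ?r"
      unfolding l r by (rule act1_inject) simp_all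
  next
    assume eq: "?l = ?r"
    show "\<forall>x\<in>Obj V. ?L x = ?R x"
    proof
      fix x
      assume x: "x \<in> Obj V"
      show "?L x = ?R x"
        unfolding L[OF x, symmetric] R[OF x, symmetric] eq ..
    qed
  qed
qed

text \<open>Componentwise inverses of a natural transformation are natural. The direction suits the
  application: \<open>\<tau>\<close> will be the unit, which goes from the given functor to the
  restricted extension.\<close>

lemma v_functors_isomorphicI:
  assumes "v_natural_transformation V C D F G \<tau>"
    and S: "\<And>a. a \<in> VObj C \<Longrightarrow> \<sigma> a \<in> hom V \<one> (VHom D (FObj G a) (FObj F a))"
    and st: "\<And>a. a \<in> VObj C \<Longrightarrow> ucomp V D (FObj G a) (FObj F a) (FObj G a) (\<sigma> a) (\<tau> a) = VId D (FObj G a)"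
    and ts: "\<And>a. a \<in> VObj C \<Longrightarrow> ucomp V D (FObj F a) (FObj G a) (FObj F a) (\<tau> a) (\<sigma> a) = VId D (FObj F a)"
  shows "v_functors_isomorphic V C D G F"
proof -
  interpret v_natural_transformation V C D F G \<tau>
    by fact
  have typing [simp]: "\<tau> a \<in> Arr V" "Dom V (\<tau> a) = \<one>" "Cod V (\<tau> a) = VHom D (FObj F a) (FObj G a)"
    "\<sigma> a \<in> Arr V" "Dom V (\<sigma> a) = \<one>" "Cod V (\<sigma> a) = VHom D (FObj G a) (FObj F a)"
    if "a \<in> VObj C" for a
    using component_hom[OF that] S[OF that] by (simp_all add: hom_iff)
  have nat_inv: "act1 (FMap F a b) x \<Zsemi> (act0 (\<sigma> a) (VHom D (FObj F a) (FObj F b) \<odot> x)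
        \<Zsemi> comp_act D (FObj G a) (FObj F a) (FObj F b) x)
      = act1 (FMap G a b) x \<Zsemi> ((VHom D (FObj G a) (FObj G b) \<rhd> act0 (\<sigma> b) x)
        \<Zsemi> comp_act D (FObj G a) (FObj G b) (FObj F b) x)"
    if [simp]: "a \<in> VObj C" "b \<in> VObj C" "x \<in> Obj V" for a b x
  proof -
    let ?Fa = "FObj F a" and ?Ga = "FObj G a" and ?Fb = "FObj F b" and ?Gb = "FObj G b"
    let ?k = "act1 (FMap G a b) x \<Zsemi> ((VHom D ?Ga ?Gb \<rhd> act0 (\<sigma> b) x) \<Zsemi> comp_act D ?Ga ?Gb ?Fb x)"
    let ?s = "act0 (\<sigma> a) (VHom D ?Fa ?Fb \<odot> x) \<Zsemi> comp_act D ?Ga ?Fa ?Fb x"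
    let ?H = "VHom D ?Ga ?Fb"
    have nat: "act1 (FMap G a b) x \<Zsemi> (act0 (\<tau> a) (VHom D ?Ga ?Gb \<odot> x) \<Zsemi> comp_act D ?Fa ?Ga ?Gb x)
      = act1 (FMap F a b) x \<Zsemi> ((VHom D ?Fa ?Fb \<rhd> act0 (\<tau> b) x) \<Zsemi> comp_act D ?Fa ?Fb ?Gb x)"
      using naturality[OF that(1,2)]
      by (subst (asm) naturality_iff[OF F.v_functor_axioms G.v_functor_axioms]) simp_all
    have st': "act0 (\<tau> a) y \<Zsemi> (act0 (\<sigma> a) (VHom D ?Fa ?Ga \<odot> y) \<Zsemi> comp_act D ?Ga ?Fa ?Ga y) = id_act D ?Ga y"
      if "y \<in> Obj V" for y
      using F.D.act0_ucomp[of ?Ga ?Fa ?Ga "\<sigma> a" "\<tau> a" y] st[of a] that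
      by (simp add: act0_lact[THEN Seq_eq_Seq])
    have ts': "act0 (\<tau> b) x \<Zsemi> ((VHom D ?Fb ?Gb \<rhd> act0 (\<sigma> b) x) \<Zsemi> comp_act D ?Fb ?Gb ?Fb x) = id_act D ?Fb x"
      using F.D.act0_ucomp[of ?Fb ?Gb ?Fb "\<tau> b" "\<sigma> b" x] ts[of b] by simp
    \<comment> \<open>Precomposition with \<open>\<tau> a\<close> and then with
      \<open>\<sigma> a\<close> is precomposition with their composite on \<open>G a\<close>, an
      identity. It is appended to \<open>?k\<close> so that naturality of \<open>\<tau>\<close>
      becomes applicable; afterwards \<open>\<tau> b\<close> meets \<open>\<sigma> b\<close> and
      cancels.\<close>
    have "act0 (\<tau> a) (?H \<odot> x) \<Zsemi> (comp_act D ?Fa ?Ga ?Fb x \<Zsemi> ?s)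
      = act0 (\<tau> a) (?H \<odot> x) \<Zsemi> (act0 (\<sigma> a) (VHom D ?Fa ?Ga \<odot> (?H \<odot> x))
          \<Zsemi> ((VHom D ?Ga ?Fa \<rhd> comp_act D ?Fa ?Ga ?Fb x) \<Zsemi> comp_act D ?Ga ?Fa ?Fb x))"
      by (simp add: act0_lact[THEN Seq_eq_Seq])
    also have "\<dots> = (act0 (\<tau> a) (?H \<odot> x) \<Zsemi> (act0 (\<sigma> a) (VHom D ?Fa ?Ga \<odot> (?H \<odot> x))
          \<Zsemi> comp_act D ?Ga ?Fa ?Ga (?H \<odot> x))) \<Zsemi> comp_act D ?Ga ?Ga ?Fb x"
      by (simp add: F.D.comp_act_assoc)
    also have "\<dots> = \<i>\<d> (?H \<odot> x)"
      by (subst st') (simp_all add: F.D.v_cat_simps)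
    finally have "?k = ?k \<Zsemi> (act0 (\<tau> a) (?H \<odot> x) \<Zsemi> (comp_act D ?Fa ?Ga ?Fb x \<Zsemi> ?s))"
      by simp
    also have "\<dots> = act1 (FMap G a b) x \<Zsemi> (act0 (\<tau> a) (VHom D ?Ga ?Gb \<odot> x)
        \<Zsemi> ((VHom D ?Fa ?Ga \<rhd> ((VHom D ?Ga ?Gb \<rhd> act0 (\<sigma> b) x) \<Zsemi> comp_act D ?Ga ?Gb ?Fb x))
        \<Zsemi> (comp_act D ?Fa ?Ga ?Fb x \<Zsemi> ?s)))"
      by (simp add: act0_lact[THEN Seq_eq_Seq])
    also have "\<dots> = (act1 (FMap G a b) x \<Zsemi> (act0 (\<tau> a) (VHom D ?Ga ?Gb \<odot> x) \<Zsemi> comp_act D ?Fa ?Ga ?Gb x))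
        \<Zsemi> ((VHom D ?Fa ?Gb \<rhd> act0 (\<sigma> b) x) \<Zsemi> (comp_act D ?Fa ?Gb ?Fb x \<Zsemi> ?s))"
      by (simp add: F.D.v_cat_simps lact_act2[THEN Seq_eq_Seq])
    also have "\<dots> = act1 (FMap F a b) x \<Zsemi> ((VHom D ?Fa ?Fb \<rhd> (act0 (\<tau> b) x
        \<Zsemi> ((VHom D ?Fb ?Gb \<rhd> act0 (\<sigma> b) x) \<Zsemi> comp_act D ?Fb ?Gb ?Fb x)))
        \<Zsemi> (comp_act D ?Fa ?Fb ?Fb x \<Zsemi> ?s))"
      unfolding nat by (simp add: F.D.v_cat_simps lact_act2[THEN Seq_eq_Seq])
    also have "\<dots> = act1 (FMap F a b) x \<Zsemi> ?s"
      unfolding ts' by (simp add: F.D.v_cat_simps)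
    finally show ?thesis
      by simp
  qed
  have "v_natural_transformation V C D G F \<sigma>"
  proof
    fix a b
    assume ab: "a \<in> VObj C" "b \<in> VObj C"
    show "\<sigma> a \<in> hom V \<one> (VHom D (FObj G a) (FObj F a))"
      by (simp add: S ab)
    show "\<i>\<n>\<v> (\<lambda>\<^sub>V (VHom C a b)) \<Zsemi> (\<sigma> a \<otimes> FMap F a b) \<Zsemi> VComp D (FObj G a) (FObj F a) (FObj F b)
        = \<i>\<n>\<v> (\<rho> (VHom C a b)) \<Zsemi> (FMap G a b \<otimes> \<sigma> b) \<Zsemi> VComp D (FObj G a) (FObj G b) (FObj F b)"
      by (subst naturality_iff[OF G.v_functor_axioms F.v_functor_axioms ab])
        (simp_all add: ab nat_inv)
  qed
  then show ?thesis
    unfolding v_functors_isomorphic_def using assms by blast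
qed

end

context tensored_extension
begin

lemma incl_simps [simp]:
  "FObj (completion_incl V C) a = a \<triangleleft> \<one>"
  by (simp add: completion_incl_def)

lemma incl_typing [simp]:
  assumes "a \<in> VObj C" "b \<in> VObj C"
  shows "FMap (completion_incl V C) a b \<in> Arr V" "Dom V (FMap (completion_incl V C) a b) = VHom C a b"
    "Cod V (FMap (completion_incl V C) a b) = IHom V \<one> (VHom C a b \<odot> \<one>)"
  using assms by (simp_all add: completion_incl_def)

text \<open>Each unit coherence is needed once: one for the weight \<one> of the source, at which
  evaluation takes place, and one for the weight \<one> of the target.\<close>

lemma act1_incl:
  assumes "a \<in> VObj C" "b \<in> VObj C" "x \<in> Obj V"
  shows "(\<one> \<rhd> act1 (FMap (completion_incl V C) a b) x) \<Zsemi> tenev \<one> a b \<one> x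
    = \<lambda>\<^sub>V (VHom C a b \<odot> x) \<Zsemi> (VHom C a b \<rhd> \<i>\<n>\<v> (\<lambda>\<^sub>V x))"
proof -
  let ?C = "VHom C a b"
  let ?f = "\<lambda>\<^sub>V ?C \<Zsemi> \<i>\<n>\<v> (\<rho> ?C)"
  have "(\<one> \<rhd> act1 (FMap (completion_incl V C) a b) x) \<Zsemi> tenev \<one> a b \<one> x = act2 \<one> ?C ?f x \<Zsemi> \<alpha> ?C \<one> x"
    using assms act1_Mate_ev_act[of ?f \<one> ?C "?C \<odot> \<one>" x, THEN Seq_eq_Seq, of "\<alpha> ?C \<one> x"]
    by (simp add: completion_incl_def tenev_def)
  also have "\<dots> = (\<i>\<n>\<v> (\<alpha> \<one> ?C x) \<Zsemi> act1 (\<lambda>\<^sub>V ?C) x) \<Zsemi> (act1 (\<i>\<n>\<v> (\<rho> ?C)) x \<Zsemi> \<alpha> ?C \<one> x)"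
    using assms by (simp add: act2_eq)
  also have "\<dots> = \<lambda>\<^sub>V (?C \<odot> x) \<Zsemi> (?C \<rhd> \<i>\<n>\<v> (\<lambda>\<^sub>V x))"
    using assms by (simp only: Assoc_inv_LUnit(1) Assoc_inv_RUnit(2) VHom_Obj)
  finally show ?thesis .
qed

text \<open>Oriented so that unitors travel to the front, where opposite ones cancel.\<close>

lemmas LUnit_base = lact_LUnit Seq_LUnit_inv
lemmas LUnit_simps = LUnit_base LUnit_base[THEN Seq_eq_Seq] LUnit_base[THEN lact_eq_lact]
  LUnit_base[THEN lact_eq_lact, THEN Seq_eq_Seq]
lemmas incl_act = act1_incl act1_incl[THEN Seq_eq_Seq] act1_incl[THEN lact_eq_lact]
  act1_incl[THEN lact_eq_lact, THEN Seq_eq_Seq]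

lemma v_functor_incl: "v_functor V C (completion V C) (completion_incl V C)"
  by (rule v_functorI[where s = "\<lambda>_. \<one>" and e = "\<lambda>a b. tenev \<one> a b \<one>"])
    (simp_all add: v_category_axioms v_category_completion hom_iff detects_tenev
      incl_act completion_act lact_act v_cat_simps LUnit_simps)

abbreviation incl_ext :: "('a, 'b, 'm) vfunctor" where
  "incl_ext \<equiv> vfunctor_comp V (completion_incl V C) extension"

lemma v_functor_incl_ext: "v_functor V C D incl_ext"
  by (rule v_functor_vfunctor_comp[OF v_functor_incl v_functor_extension])

lemma incl_ext_simps [simp]:
  "FObj incl_ext a = ext_obj a \<one>"
  "FMap incl_ext a b = FMap (completion_incl V C) a b \<Zsemi> ext_arr a \<one> b \<one>"
  by (simp_all add: vfunctor_comp_def)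

text \<open>\<open>act0\<close> of a unit is an inverse unitor followed by \<open>act1\<close> of
  it, so the rule for \<open>ext_arr\<close> applies with weight \<one>; the inverse unitor cancels
  against the unitor that the inclusion contributes.\<close>

lemma natural_ext_unit:
  assumes [simp]: "a \<in> VObj C" "b \<in> VObj C" "x \<in> Obj V"
  shows "act1 (FMap incl_ext a b) x \<Zsemi> (act0 (ext_unit a \<one>) (VHom D (ext_obj a \<one>) (ext_obj b \<one>) \<odot> x)
      \<Zsemi> comp_act D (FObj F a) (ext_obj a \<one>) (ext_obj b \<one>) x)
    = act1 (FMap F a b) x \<Zsemi> ((VHom D (FObj F a) (FObj F b) \<rhd> act0 (ext_unit b \<one>) x)
      \<Zsemi> comp_act D (FObj F a) (FObj F b) (ext_obj b \<one>) x)"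
proof -
  let ?e = "act1 (ext_unit a \<one>) (VHom D (ext_obj a \<one>) (ext_obj b \<one>) \<odot> x)
      \<Zsemi> comp_act D (FObj F a) (ext_obj a \<one>) (ext_obj b \<one>) x"
  let ?d = "(VHom D (FObj F a) (FObj F b) \<rhd> act1 (ext_unit b \<one>) x)
      \<Zsemi> comp_act D (FObj F a) (FObj F b) (ext_obj b \<one>) x"
  have "act1 (FMap incl_ext a b) x \<Zsemi> (act0 (ext_unit a \<one>) (VHom D (ext_obj a \<one>) (ext_obj b \<one>) \<odot> x)
      \<Zsemi> comp_act D (FObj F a) (ext_obj a \<one>) (ext_obj b \<one>) x)
    = \<i>\<n>\<v> (\<lambda>\<^sub>V (VHom C a b \<odot> x)) \<Zsemi> ((\<one> \<rhd> act1 (FMap (completion_incl V C) a b) x)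
      \<Zsemi> ((\<one> \<rhd> act1 (ext_arr a \<one> b \<one>) x) \<Zsemi> ?e))"
    by (simp add: act0_eq LUnit_simps)
  also have "\<dots> = \<i>\<n>\<v> (\<lambda>\<^sub>V (VHom C a b \<odot> x)) \<Zsemi> (((\<one> \<rhd> act1 (FMap (completion_incl V C) a b) x)
      \<Zsemi> tenev \<one> a b \<one> x) \<Zsemi> (act1 (FMap F a b) (\<one> \<odot> x) \<Zsemi> ?d))"
    by (simp add: act1_ext_arr)
  also have "\<dots> = (VHom C a b \<rhd> \<i>\<n>\<v> (\<lambda>\<^sub>V x)) \<Zsemi> (act1 (FMap F a b) (\<one> \<odot> x) \<Zsemi> ?d)"
    by (subst act1_incl) simp_all
  also have "\<dots> = act1 (FMap F a b) x \<Zsemi> ((VHom D (FObj F a) (FObj F b) \<rhd> act0 (ext_unit b \<one>) x)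
      \<Zsemi> comp_act D (FObj F a) (FObj F b) (ext_obj b \<one>) x)"
    by (simp add: lact_act1[THEN Seq_eq_Seq] act0_eq)
  finally show ?thesis .
qed

lemma v_functors_isomorphic_incl_ext: "v_functors_isomorphic V C D incl_ext F"
proof (rule v_functors_isomorphicI[where \<tau> = "\<lambda>a. ext_unit a \<one>"
      and \<sigma> = "\<lambda>a. D.lift (FObj F a) \<one> (FObj F a) \<one> (\<rho> \<one> \<Zsemi> VId D (FObj F a))"])
  interpret ie: v_functor V C D incl_ext
    by (rule v_functor_incl_ext)
  show "v_natural_transformation V C D F incl_ext (\<lambda>a. ext_unit a \<one>)"
  proof
    fix a b
    assume [simp]: "a \<in> VObj C" "b \<in> VObj C"
    show "ext_unit a \<one> \<in> hom V \<one> (VHom D (FObj F a) (FObj incl_ext a))"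
      by (simp add: hom_iff)
    show "\<i>\<n>\<v> (\<lambda>\<^sub>V (VHom C a b)) \<Zsemi> (ext_unit a \<one> \<otimes> FMap incl_ext a b)
          \<Zsemi> VComp D (FObj F a) (FObj incl_ext a) (FObj incl_ext b)
        = \<i>\<n>\<v> (\<rho> (VHom C a b)) \<Zsemi> (FMap F a b \<otimes> ext_unit b \<one>)
          \<Zsemi> VComp D (FObj F a) (FObj F b) (FObj incl_ext b)"
      by (subst naturality_iff[OF F.v_functor_axioms v_functor_incl_ext])
        (simp_all add: natural_ext_unit del: incl_ext_simps(2))
  qed
  fix a
  assume [simp]: "a \<in> VObj C"
  \<comment> \<open>The arrow out of the tensor with \<one> that corresponds to the identity of
    \<open>F a\<close> under the universal property.\<close>
  let ?s = "D.lift (FObj F a) \<one> (FObj F a) \<one> (\<rho> \<one> \<Zsemi> VId D (FObj F a))"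
  show "?s \<in> hom V \<one> (VHom D (FObj incl_ext a) (FObj F a))"
    by (simp add: hom_iff)
  have unit_s: "act1 (ext_unit a \<one>) x \<Zsemi> ((VHom D (FObj F a) (ext_obj a \<one>) \<rhd> act0 ?s x)
      \<Zsemi> comp_act D (FObj F a) (ext_obj a \<one>) (FObj F a) x) = \<lambda>\<^sub>V x \<Zsemi> id_act D (FObj F a) x"
    if "x \<in> Obj V" for x
    using that by (simp add: D.act0_lift) (simp add: act1_eq_act0)
  show "ucomp V D (FObj F a) (FObj incl_ext a) (FObj F a) (ext_unit a \<one>) ?s = VId D (FObj F a)"
  proof (rule act0_inject)
    show "act0 (ucomp V D (FObj F a) (FObj incl_ext a) (FObj F a) (ext_unit a \<one>) ?s) \<one> = act0 (VId D (FObj F a)) \<one>"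
      using unit_s[of \<one>] by (simp add: D.act0_ucomp act0_eq[of "ext_unit a \<one>"])
  qed simp_all
  show "ucomp V D (FObj incl_ext a) (FObj F a) (FObj incl_ext a) ?s (ext_unit a \<one>) = VId D (FObj incl_ext a)"
  proof (rule D.act2_unit_inject[of "FObj F a" \<one>])
    show "act1 (ext_unit a \<one>) \<one> \<Zsemi> ((VHom D (FObj F a) (ext_obj a \<one>)
          \<rhd> act0 (ucomp V D (FObj incl_ext a) (FObj F a) (FObj incl_ext a) ?s (ext_unit a \<one>)) \<one>)
        \<Zsemi> comp_act D (FObj F a) (ext_obj a \<one>) (FObj incl_ext a) \<one>)
      = act1 (ext_unit a \<one>) \<one> \<Zsemi> ((VHom D (FObj F a) (ext_obj a \<one>) \<rhd> act0 (VId D (FObj incl_ext a)) \<one>)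
        \<Zsemi> comp_act D (FObj F a) (ext_obj a \<one>) (FObj incl_ext a) \<one>)"
      \<comment> \<open>\<open>unit_s\<close> leaves a unitor and the identity of
        \<open>F a\<close>; the identity composes away, and \<open>act1_eq_act0\<close> accounts for
        the unitor on the other side.\<close>
      using unit_s[THEN Seq_eq_Seq3]
      by (simp add: D.act0_ucomp D.v_cat_simps lact_act2 lact_act2[THEN Seq_eq_Seq])
        (simp add: act0_lact[THEN Seq_eq_Seq] D.v_cat_simps act1_eq_act0[of "ext_unit a \<one>"])
  qed simp_all
qed

end

theorem proposition5p7:
  fixes V :: "('o, 'm) closed_monoidal_category"
    and C :: "('o, 'm, 'a) vcategory"
    and D :: "('o, 'm, 'b) vcategory"
    and T :: "('o, 'm, 'b) tensoring"
    and F :: "('a, 'b, 'm) vfunctor"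
  assumes "closed_monoidal_category V"
    and "v_category V C"
    and "tensored_v_category V D T"
    and "v_functor V C D F"
  shows "\<exists>Fbar :: (('a, 'o) formal_tensor, 'b, 'm) vfunctor.
    tensored_v_functor V (completion V C) (completion_tensoring V C) D T Fbar
    \<and> v_functors_isomorphic V C D (vfunctor_comp V (completion_incl V C) Fbar) F"
proof -
  interpret tensored_extension V C D T F
    using assms by (simp add: tensored_extension_def closed_v_category_def)
  show ?thesis
    using tensored_v_functor_extension v_functors_isomorphic_incl_ext by blast
qed

end
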